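(* Let $d\ge 1$ and $n\geq 2$, and let $\mathcal{S}$ be a family of $n$ pairwise disjoint closed balls (of arbitrary positive radii) in $\mathbb{R}^d$. For every geometric permutation of $\mathcal{S}$, the set of line transversals to $\mathcal{S}$ realizing that geometric permutation is contractible.
   Context: A line transversal to $\mathcal{S}$ is a line of $\mathbb{R}^d$ intersecting every ball of $\mathcal{S}$; sets of lines carry the usual topology of the space of (unoriented) affine lines in $\mathbb{R}^d$. A line transversal, with its two orientations, meets the disjoint balls in two mutually reverse orders. A geometric permutation of $\mathcal{S}$ is such a pair of mutually reverse orderings of $\mathcal{S}$ that is realized by at least one line transversal. *)

theory Defs
  imports "HOL-Analysis.Analysis" "HOL-Combinatorics.Multiset_Permutations"
begin

definition affine_lines :: "'a::euclidean_space set set" where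
  "affine_lines = {L. affine L \<and> aff_dim L = 1}"

definition line_through :: "'a::euclidean_space \<Rightarrow> 'a \<Rightarrow> 'a set" where
  "line_through p v = range (\<lambda>t. p + t *\<^sub>R v)"

text \<open>The quotient topology from pairs of a point and a nonzero direction vector;
  see \<open>quotient_map_line_through\<close> below.\<close>

definition line_topology :: "'a::euclidean_space set topology" where
  "line_topology = topology (\<lambda>\<U>. \<U> \<subseteq> affine_lines \<and>
     open {(p, v). v \<noteq> 0 \<and> line_through p v \<in> \<U>})"

definition line_transversals :: "'a::euclidean_space set set \<Rightarrow> 'a set set" where
  "line_transversals S = {L \<in> affine_lines. \<forall>B\<in>S. L \<inter> B \<noteq> {}}"

text \<open>The line through \<open>p\<close> oriented by \<open>v\<close> visits the sets in the order of the list: its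
  parameters inside an earlier set are all smaller than those inside a later one.\<close>

definition visits_in_order :: "'a::euclidean_space \<Rightarrow> 'a \<Rightarrow> 'a set list \<Rightarrow> bool" where
  "visits_in_order p v Bs \<longleftrightarrow>
     sorted_wrt (\<lambda>A B. \<forall>s t. p + s *\<^sub>R v \<in> A \<longrightarrow> p + t *\<^sub>R v \<in> B \<longrightarrow> s < t) Bs"

text \<open>A pair of mutually reverse orderings is the unordered pair \<open>{Bs, rev Bs}\<close>.\<close>

definition realizes :: "'a::euclidean_space set set \<Rightarrow> 'a set \<Rightarrow> 'a set list set \<Rightarrow> bool" where
  "realizes S L P \<longleftrightarrow> L \<in> line_transversals S \<and>
     (\<exists>p v. \<exists>Bs\<in>permutations_of_set S.
        v \<noteq> 0 \<and> L = line_through p v \<and> visits_in_order p v Bs \<and> P = {Bs, rev Bs})"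

definition geometric_permutation :: "'a::euclidean_space set set \<Rightarrow> 'a set list set \<Rightarrow> bool" where
  "geometric_permutation S P \<longleftrightarrow> (\<exists>L. realizes S L P)"

lemma visits_in_order_rev: "visits_in_order p (- v) (rev Bs) \<longleftrightarrow> visits_in_order p v Bs"
proof -
  have "(\<forall>s t. p + s *\<^sub>R (- v) \<in> B \<longrightarrow> p + t *\<^sub>R (- v) \<in> A \<longrightarrow> s < t) \<longleftrightarrow>
        (\<forall>s t. p + s *\<^sub>R v \<in> A \<longrightarrow> p + t *\<^sub>R v \<in> B \<longrightarrow> s < t)" (is "?l = ?r") for A B
  proof
    assume l: ?l
    show ?r
    proof (intro allI impI)
      fix s t assume "p + s *\<^sub>R v \<in> A" "p + t *\<^sub>R v \<in> B"
      then show "s < t" using l[rule_format, of "- t" "- s"] by simp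
    qed
  next
    assume r: ?r
    show ?l
    proof (intro allI impI)
      fix s t assume "p + s *\<^sub>R (- v) \<in> B" "p + t *\<^sub>R (- v) \<in> A"
      then show "s < t" using r[rule_format, of "- t" "- s"] by simp
    qed
  qed
  then show ?thesis
    by (simp only: visits_in_order_def sorted_wrt_rev)
qed

lemma openin_line_topology:
  "openin line_topology \<U> \<longleftrightarrow>
     \<U> \<subseteq> affine_lines \<and> open {(p, v). v \<noteq> 0 \<and> line_through p v \<in> \<U>}"
proof -
  have "istopology (\<lambda>\<U>::'a set set. \<U> \<subseteq> affine_lines \<and>
          open {(p, v). v \<noteq> 0 \<and> line_through p v \<in> \<U>})"
    unfolding istopology_def
  proof (intro conjI allI impI)
    fix S T :: "'a set set"
    assume S: "S \<subseteq> affine_lines \<and> open {(p, v). v \<noteq> 0 \<and> line_through p v \<in> S}"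
      and T: "T \<subseteq> affine_lines \<and> open {(p, v). v \<noteq> 0 \<and> line_through p v \<in> T}"
    show "S \<inter> T \<subseteq> affine_lines" using S by blast
    have "{(p, v). v \<noteq> 0 \<and> line_through p v \<in> S \<inter> T} =
        {(p, v). v \<noteq> 0 \<and> line_through p v \<in> S} \<inter> {(p, v). v \<noteq> 0 \<and> line_through p v \<in> T}"
      by auto
    then show "open {(p, v). v \<noteq> 0 \<and> line_through p v \<in> S \<inter> T}"
      using S T by (simp add: open_Int)
  next
    fix K :: "'a set set set"
    assume K: "\<forall>U\<in>K. U \<subseteq> affine_lines \<and> open {(p, v). v \<noteq> 0 \<and> line_through p v \<in> U}"
    show "\<Union>K \<subseteq> affine_lines" using K by blast
    have "{(p, v). v \<noteq> 0 \<and> line_through p v \<in> \<Union>K} =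
        (\<Union>U\<in>K. {(p, v). v \<noteq> 0 \<and> line_through p v \<in> U})"
      by auto
    then show "open {(p, v). v \<noteq> 0 \<and> line_through p v \<in> \<Union>K}"
      using K by (simp only:) blast
  qed
  then show ?thesis
    unfolding line_topology_def by (simp add: topology_inverse')
qed

lemma line_through_affine_hull: "line_through p v = affine hull {p, p + v}"
  by (auto simp: line_through_def affine_hull_2_alt)

lemma affine_lines_eq: "affine_lines = (\<lambda>(p, v). line_through p v) ` {(p, v). v \<noteq> 0}"
proof (intro equalityI subsetI)
  fix L :: "'a set" assume "L \<in> affine_lines"
  then have L: "affine L" "aff_dim L = 1" by (auto simp: affine_lines_def)
  then have "L \<noteq> {}" by auto
  then obtain p where p: "p \<in> L" by blast
  have "L \<noteq> {p}" using L by auto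
  then obtain q where q: "q \<in> L" "q \<noteq> p" using p by blast
  have "affine hull {p, q} = L"
    using L p q hull_minimal[of "{p, q}" L affine] by (intro affine_dim_equal) auto
  then have "L = line_through p (q - p)" by (simp add: line_through_affine_hull)
  then show "L \<in> (\<lambda>(p, v). line_through p v) ` {(p, v). v \<noteq> 0}"
    using q by force
qed (auto simp: affine_lines_def line_through_affine_hull)

lemma topspace_line_topology: "topspace line_topology = affine_lines"
proof -
  have "{(p::'a, v::'a). v \<noteq> 0 \<and> line_through p v \<in> affine_lines} = UNIV \<times> (- {0})"
    using affine_lines_eq by auto
  then have "openin line_topology (affine_lines :: 'a set set)"
    by (simp add: openin_line_topology open_Times open_Compl)
  then show ?thesis
    by (metis openin_line_topology openin_subset openin_topspace subset_antisym)
qed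

lemma quotient_map_line_through:
  "quotient_map (top_of_set {(p, v). v \<noteq> 0}) line_topology (\<lambda>(p, v). line_through p v)"
proof -
  have "{(p::'a, v::'a). v \<noteq> 0} = UNIV \<times> (- {0})" by auto
  then have op: "open {(p::'a, v::'a). v \<noteq> 0}" by (simp add: open_Times open_Compl)
  have eq: "{x \<in> {(p, v). v \<noteq> 0}. (case x of (p, v) \<Rightarrow> line_through p v) \<in> U} =
      {(p, v). v \<noteq> 0 \<and> line_through p v \<in> U}" for U :: "'a set set"
    by auto
  show ?thesis
    unfolding quotient_map_def topspace_line_topology openin_line_topology
      topspace_euclidean_subtopology eq openin_open_eq[OF op]
    by (auto simp: affine_lines_eq)
qed

end

theory Submission
  imports Defs
begin

text \<open>
  A line of direction \<open>w\<close> meets all the balls iff their projections along \<open>w\<close>, which are discs in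
  the hyperplane orthogonal to \<open>w\<close>, have a common point.  The line also meets disjoint balls in
  the order of the projections of their centres to the line.  So the lines that realize a given
  order, oriented accordingly, fibre over the set of their directions, and each fibre is convex,
  being an intersection of discs.  Contractibility follows from two facts: the set of directions is
  a convex cone, and every fibre can be contracted to a point that depends continuously on the
  direction.

  \<^emph>\<open>Directions.\<close>  Let \<open>u\<close> and \<open>v\<close> be directions of two ordered transversals and \<open>w\<close> a positive
  combination of them.  All balls are cut with the affine span of the two transversals, of
  dimension at most three; the lines of direction \<open>w\<close> in it are parametrised by a plane, and Helly's theorem there
  reduces the problem to three balls (\<open>ordered_transversal_directions_convex\<close>).

  For three balls, minimax duality turns the existence of a transversal of direction \<open>w\<close> into the
  condition that a function \<open>excess\<close>, polynomial in \<open>w\<close> and in weights \<open>a\<close> on the balls, is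
  nonpositive for all weights.  The argument that this condition passes from \<open>u\<close> and \<open>v\<close> to the
  arc between them (\<open>three_ball_arc\<close>) is of the type ``connected and locally convex implies convex''.
  Three points \<open>M 1\<close>, \<open>M 2 = (1 - t) M 1 + t M 3\<close>, \<open>M 3\<close> of a transversal are encoded by
  \<open>(t, (1 - t) M 1, t M 3)\<close>, and these triples range over a convex set; so \<open>u\<close> and \<open>v\<close> are joined by
  a path of directions \<open>V \<sigma>\<close> of transversals (\<open>chord_path\<close>).  Consider the largest excess, relative
  to the squared length of the direction, on the arc from \<open>u\<close> to \<open>V \<sigma>\<close>.  If it were a small positive
  \<open>\<mu>\<close>, then enlarging all squared radii by \<open>\<mu>\<close> would give balls that are still disjoint and that are
  tangent, at some interior direction of the arc, to a line locked between them, while all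
  neighbouring directions of the arc still admit transversals
  (\<open>no_small_positive_maximum\<close>).  A second-order expansion excludes this
  (\<open>tangent_direction_not_flat\<close>).  So the largest excess along the path is never small and positive;
  it is nonpositive for \<open>V 0 = u\<close>, and a connectedness argument keeps it nonpositive up to \<open>V 1 = v\<close>.

  The geometric core is the second-order estimate \<open>second_order_gain\<close>.  There the balance of the
  three contact normals gives a triangle with sides \<open>l1, l2, l3\<close>, disjointness of the balls bounds
  the distances of the contact points from below in terms of this triangle, and the claim becomes
  an elementary polynomial inequality (\<open>disc_inequality\<close>).

  \<^emph>\<open>Fibres.\<close>  In each direction the point that minimises the largest of the differences between
  squared distance and squared radius is unique by strict convexity and depends continuously on
  the direction by compactness.  Sliding every line straight to it deforms the set of
  transversals onto a copy of the convex set of directions.  Normalising direction and base point of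
  a line against a fixed vector gives a continuous section of the quotient map onto the space of
  lines, through which the contraction descends.
\<close>

section \<open>Squared distances from a line\<close>

text \<open>For \<open>w \<noteq> 0\<close> this is \<open>w \<bullet> w\<close> times the squared distance of \<open>y\<close> from the line spanned by \<open>w\<close>.  Without the
division it is a polynomial, homogeneous of degree two in \<open>w\<close>, so directions need not be unit vectors.\<close>

definition shadow :: "'a::real_inner \<Rightarrow> 'a \<Rightarrow> real" where
  "shadow w y = (w \<bullet> w) * (y \<bullet> y) - (w \<bullet> y)\<^sup>2"

lemma shadow_nonneg: "shadow w y \<ge> 0"
  using Cauchy_Schwarz_ineq[of w y] by (simp add: shadow_def)

lemma shadow_shift: "shadow w (y + t *\<^sub>R w) = shadow w y"
  by (simp add: shadow_def inner_add_left inner_add_right inner_commute power2_eq_square algebra_simps)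

lemma shadow_scale: "shadow (s *\<^sub>R w) y = s\<^sup>2 * shadow w y"
  by (simp add: shadow_def power2_eq_square algebra_simps)

lemma shadow_le_iff:
  assumes "w \<noteq> 0" "r \<ge> 0"
  shows "shadow w (c - p) \<le> r\<^sup>2 * (w \<bullet> w) \<longleftrightarrow> (\<exists>t. p + t *\<^sub>R w \<in> cball c r)"
proof
  have ww: "w \<bullet> w > 0" using assms by simp
  have id: "shadow w (c - p) = (w \<bullet> w) * ((c - (p + t *\<^sub>R w)) \<bullet> (c - (p + t *\<^sub>R w))) - (w \<bullet> (c - (p + t *\<^sub>R w)))\<^sup>2" for t
    using shadow_shift[of w "c - (p + t *\<^sub>R w)" t] by (simp add: shadow_def)
  have cb: "p + t *\<^sub>R w \<in> cball c r \<longleftrightarrow> (c - (p + t *\<^sub>R w)) \<bullet> (c - (p + t *\<^sub>R w)) \<le> r\<^sup>2" for t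
    using assms(2) by (simp add: dist_norm norm_le_square)
  { assume le: "shadow w (c - p) \<le> r\<^sup>2 * (w \<bullet> w)"
    define t where "t = w \<bullet> (c - p) / (w \<bullet> w)"
    have "w \<bullet> (c - (p + t *\<^sub>R w)) = 0" using ww by (simp add: t_def inner_diff_right inner_add_right)
    then have "(w \<bullet> w) * ((c - (p + t *\<^sub>R w)) \<bullet> (c - (p + t *\<^sub>R w))) \<le> (w \<bullet> w) * r\<^sup>2"
      using le id[of t] by (simp add: mult.commute)
    then show "\<exists>t. p + t *\<^sub>R w \<in> cball c r" using ww cb by auto }
  { assume "\<exists>t. p + t *\<^sub>R w \<in> cball c r"
    then obtain t where "(c - (p + t *\<^sub>R w)) \<bullet> (c - (p + t *\<^sub>R w)) \<le> r\<^sup>2" using cb by auto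
    then have "(w \<bullet> w) * ((c - (p + t *\<^sub>R w)) \<bullet> (c - (p + t *\<^sub>R w))) \<le> (w \<bullet> w) * r\<^sup>2"
      using ww by simp
    then show "shadow w (c - p) \<le> r\<^sup>2 * (w \<bullet> w)"
      using id[of t] zero_le_power2[of "w \<bullet> (c - (p + t *\<^sub>R w))"] by (simp only: mult.commute) }
qed

section \<open>Duality for a common point of discs\<close>

text \<open>The standard simplex, inside \<open>real ^ 'n\<close> so that its compactness supplies maximisers.\<close>

definition weights :: "(real ^ 'n) set" where
  "weights = {a. (\<forall>i. 0 \<le> a $ i) \<and> (\<Sum>i\<in>UNIV. a $ i) = 1}"

text \<open>The Lagrange dual of minimising, over all points \<open>p\<close>, the largest of the numbers
\<open>shadow w (c i - p) - k i * (w \<bullet> w)\<close>: the minimum over \<open>p\<close> of their average with weights \<open>a\<close>, which is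
attained at the weighted mean of the \<open>c i\<close>.  If the \<open>k i\<close> are squared radii, a line of direction \<open>w\<close>
meets all balls iff the excess is nonpositive for all weights.\<close>

definition excess :: "('n::finite \<Rightarrow> 'a::real_inner) \<Rightarrow> ('n \<Rightarrow> real) \<Rightarrow> 'a \<Rightarrow> real ^ 'n \<Rightarrow> real" where
  "excess c k w a = (\<Sum>i\<in>UNIV. a $ i * (shadow w (c i) - k i * (w \<bullet> w))) - shadow w (\<Sum>i\<in>UNIV. a $ i *\<^sub>R c i)"

lemma excess_scale: "excess c k (s *\<^sub>R w) a = s\<^sup>2 * excess c k w a"
  by (simp add: excess_def shadow_scale right_diff_distrib sum_distrib_left power2_eq_square algebra_simps sum_subtractf sum.distrib)

lemma shadow_diff:
  "shadow w (y - p) = shadow w y - 2 * ((w \<bullet> w) * (y \<bullet> p) - (w \<bullet> y) * (w \<bullet> p)) + shadow w p"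
  by (simp add: shadow_def inner_diff_left inner_diff_right inner_commute power2_eq_square algebra_simps)

text \<open>Variance decomposition of the weighted average about an arbitrary base point \<open>p\<close>.\<close>

lemma excess_at_point:
  assumes "(\<Sum>i\<in>UNIV. a $ i) = 1"
  shows "excess c k w a =
    (\<Sum>i\<in>UNIV. a $ i * (shadow w (c i - p) - k i * (w \<bullet> w))) - shadow w ((\<Sum>i\<in>UNIV. a $ i *\<^sub>R c i) - p)"
proof -
  define x where "x = (\<Sum>i\<in>UNIV. a $ i *\<^sub>R c i)"
  have 1: "(\<Sum>i\<in>UNIV. a $ i * ((w \<bullet> w) * (c i \<bullet> p) - (w \<bullet> c i) * (w \<bullet> p))) = (w \<bullet> w) * (x \<bullet> p) - (w \<bullet> x) * (w \<bullet> p)"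
    by (simp add: x_def inner_sum_left inner_sum_right right_diff_distrib sum_subtractf sum_distrib_left sum_distrib_right algebra_simps)
  have "(\<Sum>i\<in>UNIV. a $ i * (shadow w (c i - p) - k i * (w \<bullet> w)))
     = (\<Sum>i\<in>UNIV. a $ i * (shadow w (c i) - k i * (w \<bullet> w))
          - 2 * (a $ i * ((w \<bullet> w) * (c i \<bullet> p) - (w \<bullet> c i) * (w \<bullet> p))) + shadow w p * a $ i)"
    by (rule sum.cong) (simp_all add: shadow_diff algebra_simps)
  also have "\<dots> = (\<Sum>i\<in>UNIV. a $ i * (shadow w (c i) - k i * (w \<bullet> w)))
     - 2 * ((w \<bullet> w) * (x \<bullet> p) - (w \<bullet> x) * (w \<bullet> p)) + shadow w p * (\<Sum>i\<in>UNIV. a $ i)"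
    unfolding 1[symmetric] by (simp add: sum.distrib sum_subtractf sum_distrib_left)
  finally show ?thesis by (simp add: excess_def shadow_diff[of w x p] assms x_def[symmetric])
qed

lemma excess_nonpos:
  assumes "a \<in> weights" "\<And>i. a $ i > 0 \<Longrightarrow> shadow w (c i - p) \<le> k i * (w \<bullet> w)"
  shows "excess c k w a \<le> 0"
proof -
  have "a $ i * (shadow w (c i - p) - k i * (w \<bullet> w)) \<le> 0" for i
    using assms by (cases "a $ i = 0") (auto simp: weights_def mult_le_0_iff order_less_le)
  then have "(\<Sum>i\<in>UNIV. a $ i * (shadow w (c i - p) - k i * (w \<bullet> w))) \<le> 0" by (simp add: sum_nonpos)
  then show ?thesis
    using excess_at_point[of a c k w p] assms(1) shadow_nonneg[of w "(\<Sum>i\<in>UNIV. a $ i *\<^sub>R c i) - p"]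
    by (simp add: weights_def)
qed

text \<open>The excess is concave in the weights, and its one-sided derivative towards the \<open>i\<close>-th vertex of the
simplex is the difference between the \<open>i\<close>-th term at \<open>x\<close> and the excess itself.  So at a maximiser no
term exceeds the excess; as the excess is their weighted average, those of positive weight equal it.\<close>

lemma excess_maximiser:
  assumes a: "a \<in> weights" and max: "\<And>b. b \<in> weights \<Longrightarrow> excess c k w b \<le> excess c k w a"
  defines "x \<equiv> \<Sum>i\<in>UNIV. a $ i *\<^sub>R c i"
  shows "shadow w (c i - x) - k i * (w \<bullet> w) \<le> excess c k w a"
    and "a $ i > 0 \<Longrightarrow> shadow w (c i - x) - k i * (w \<bullet> w) = excess c k w a"
proof -
  define g where "g i = shadow w (c i - x) - k i * (w \<bullet> w)" for i
  define F where "F = excess c k w a"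
  have sum_a: "(\<Sum>i\<in>UNIV. a $ i) = 1" and a0: "0 \<le> a $ i" for i using a by (auto simp: weights_def)
  have avg: "F = (\<Sum>i\<in>UNIV. a $ i * g i)"
    using excess_at_point[OF sum_a, of c k w x] by (simp add: F_def g_def x_def shadow_def)
  have le: "g i \<le> F" for i
  proof (rule ccontr)
    assume "\<not> g i \<le> F"
    then have gF: "g i - F > 0" by simp
    define B where "B = shadow w (c i - x)"
    have bound: "t * (g i - F) \<le> t\<^sup>2 * B" if t: "0 \<le> t" "t \<le> 1" for t
    proof -
      define b where "b = (1 - t) *\<^sub>R a + t *\<^sub>R axis i 1"
      have bi: "b $ j = (1 - t) * a $ j + t * (if j = i then 1 else 0)" for j
        by (simp add: b_def axis_def)
      have sum_b: "(\<Sum>j\<in>UNIV. b $ j) = 1"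
        by (simp add: bi sum.distrib sum_distrib_left[symmetric] sum_a)
      have "b \<in> weights" using t a0 sum_b by (simp add: weights_def bi)
      then have "excess c k w b \<le> F" unfolding F_def by (rule max)
      moreover have "(\<Sum>j\<in>UNIV. b $ j *\<^sub>R c j) - x = t *\<^sub>R (c i - x)"
      proof -
        have "(\<Sum>j\<in>UNIV. b $ j *\<^sub>R c j) = (\<Sum>j\<in>UNIV. (1 - t) *\<^sub>R (a $ j *\<^sub>R c j) + (if j = i then t *\<^sub>R c j else 0))"
          by (rule sum.cong) (auto simp: bi algebra_simps)
        also have "\<dots> = (1 - t) *\<^sub>R x + t *\<^sub>R c i"
          by (simp add: sum.distrib scaleR_sum_right x_def)
        finally show ?thesis by (simp add: algebra_simps)
      qed
      moreover have "(\<Sum>j\<in>UNIV. b $ j * g j) = (1 - t) * F + t * g i"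
      proof -
        have "(\<Sum>j\<in>UNIV. b $ j * g j) = (\<Sum>j\<in>UNIV. (1 - t) * (a $ j * g j) + (if j = i then t * g j else 0))"
          by (rule sum.cong) (auto simp: bi algebra_simps)
        then show ?thesis by (simp add: sum.distrib sum_distrib_left[symmetric] avg)
      qed
      moreover have "shadow w (t *\<^sub>R (c i - x)) = t\<^sup>2 * B"
        by (simp add: shadow_def B_def power2_eq_square algebra_simps)
      ultimately have "(1 - t) * F + t * g i - t\<^sup>2 * B \<le> F"
        using excess_at_point[OF sum_b, of c k w x] by (simp add: g_def)
      then show ?thesis by (simp add: algebra_simps)
    qed
    have B: "B \<ge> 0" by (simp add: B_def shadow_nonneg)
    \<comment> \<open>For a step this small towards vertex \<open>i\<close> the linear gain exceeds the quadratic loss \<open>t\<^sup>2 * B\<close>.\<close>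
    define t where "t = min 1 ((g i - F) / (2 * (B + 1)))"
    have t: "0 < t" "t \<le> 1" "t \<le> (g i - F) / (2 * (B + 1))" using gF B by (auto simp: t_def)
    have "t * (g i - F) \<le> t * (t * B)" using bound[of t] t by (simp add: power2_eq_square)
    then have "g i - F \<le> t * B" using t by simp
    also have "\<dots> \<le> (g i - F) / (2 * (B + 1)) * (B + 1)" using t gF B by (intro mult_mono) auto
    also have "\<dots> = (g i - F) / 2" using B by (simp add: field_simps)
    finally show False using gF by simp
  qed
  show "shadow w (c i - x) - k i * (w \<bullet> w) \<le> excess c k w a" using le by (simp add: g_def F_def)
  assume ai: "a $ i > 0"
  have "(\<Sum>j\<in>UNIV. a $ j * (F - g j)) = 0"
    by (simp add: right_diff_distrib sum_subtractf avg[symmetric] sum_distrib_right[symmetric] sum_a)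
  moreover have "a $ j * (F - g j) \<ge> 0" for j using le[of j] a0[of j] by simp
  ultimately have "a $ i * (F - g i) = 0" by (simp add: sum_nonneg_eq_0_iff)
  then show "shadow w (c i - x) - k i * (w \<bullet> w) = excess c k w a" using ai by (simp add: g_def F_def)
qed

lemma compact_weights: "compact (weights :: (real ^ 'n::finite) set)"
proof (rule compact_eq_bounded_closed[THEN iffD2], intro conjI)
  show "bounded (weights :: (real ^ 'n) set)"
  proof (rule boundedI)
    fix a :: "real ^ 'n" assume a: "a \<in> weights"
    have "norm a \<le> (\<Sum>i\<in>UNIV. \<bar>a $ i\<bar>)" by (rule norm_le_l1_cart)
    then show "norm a \<le> 1" using a by (simp add: weights_def)
  qed
  have "weights = (\<Inter>i. {a::real ^ 'n. 0 \<le> a $ i}) \<inter> {a. (\<Sum>i\<in>UNIV. a $ i) = 1}"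
    by (auto simp: weights_def)
  moreover have "closed {a::real ^ 'n. 0 \<le> a $ i}" for i by (intro closed_Collect_le continuous_intros)
  moreover have "closed {a::real ^ 'n. (\<Sum>i\<in>UNIV. a $ i) = 1}" by (intro closed_Collect_eq continuous_intros)
  ultimately show "closed (weights :: (real ^ 'n) set)" by (metis closed_INT closed_Int)
qed

lemma continuous_on_excess [continuous_intros]:
  assumes "continuous_on S f" "continuous_on S g"
  shows "continuous_on S (\<lambda>x. excess c k (f x) (g x))"
  unfolding excess_def shadow_def by (intro continuous_intros assms)

section \<open>A second-order inequality for three tangent balls\<close>

text \<open>Writing each \<open>y\<close> as \<open>1 + t\<close> leaves a polynomial in the \<open>t\<close> with nonnegative coefficients, whose constant
term is \<open>3 * (m1 * m2 * m3)\<close>.\<close>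

lemma disc_inequality:
  fixes m1 m2 m3 y1 y2 y3 :: real
  assumes "m1 > 0" "m2 > 0" "m3 > 0" "y1 \<ge> 1" "y2 \<ge> 1" "y3 \<ge> 1"
  shows "(m1 + m2 + m3) * (m2 * m3 * y1 + m1 * m3 * y2 + m1 * m2 * y3)
     < m1 * (m2 + m3)\<^sup>2 * (y2 * y3) + m2 * (m1 + m3)\<^sup>2 * (y1 * y3) + m3 * (m1 + m2)\<^sup>2 * (y1 * y2)"
proof -
  define t1 t2 t3 where "t1 = y1 - 1" "t2 = y2 - 1" "t3 = y3 - 1"
  have y: "y1 = 1 + t1" "y2 = 1 + t2" "y3 = 1 + t3" and t: "t1 \<ge> 0" "t2 \<ge> 0" "t3 \<ge> 0"
    using assms by (auto simp: t1_t2_t3_def)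
  have "m1 * (m2 + m3)\<^sup>2 * (y2 * y3) + m2 * (m1 + m3)\<^sup>2 * (y1 * y3) + m3 * (m1 + m2)\<^sup>2 * (y1 * y2)
     - (m1 + m2 + m3) * (m2 * m3 * y1 + m1 * m3 * y2 + m1 * m2 * y3)
     = 3 * (m1 * m2 * m3)
     + t1 * (m1\<^sup>2 * (m2 + m3) + 3 * (m1 * m2 * m3))
     + t2 * (m2\<^sup>2 * (m1 + m3) + 3 * (m1 * m2 * m3))
     + t3 * (m3\<^sup>2 * (m1 + m2) + 3 * (m1 * m2 * m3))
     + m1 * (m2 + m3)\<^sup>2 * (t2 * t3) + m2 * (m1 + m3)\<^sup>2 * (t1 * t3) + m3 * (m1 + m2)\<^sup>2 * (t1 * t2)"
    unfolding y by (simp add: power2_eq_square algebra_simps)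
  moreover have "\<dots> > 0"
    using assms t by (intro add_pos_nonneg mult_nonneg_nonneg mult_pos_pos add_nonneg_nonneg) auto
  ultimately show ?thesis by linarith
qed

lemma plane_vector_with_products:
  fixes n1 n2 :: "'a::real_inner"
  assumes "(n1 \<bullet> n1) * (n2 \<bullet> n2) - (n1 \<bullet> n2)\<^sup>2 \<noteq> 0"
  obtains \<alpha> \<beta> where "(\<alpha> *\<^sub>R n1 + \<beta> *\<^sub>R n2) \<bullet> n1 = s" "(\<alpha> *\<^sub>R n1 + \<beta> *\<^sub>R n2) \<bullet> n2 = t"
proof -
  define G where "G = (n1 \<bullet> n1) * (n2 \<bullet> n2) - (n1 \<bullet> n2)\<^sup>2"
  define \<alpha> where "\<alpha> = (s * (n2 \<bullet> n2) - t * (n1 \<bullet> n2)) / G"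
  define \<beta> where "\<beta> = (t * (n1 \<bullet> n1) - s * (n1 \<bullet> n2)) / G"
  have G: "G \<noteq> 0" using assms by (simp add: G_def)
  have "(\<alpha> * (n1 \<bullet> n1) + \<beta> * (n1 \<bullet> n2)) * G = s * G"
    using G by (simp add: \<alpha>_def \<beta>_def field_simps) (simp add: G_def power2_eq_square algebra_simps)
  moreover have "(\<alpha> * (n1 \<bullet> n2) + \<beta> * (n2 \<bullet> n2)) * G = t * G"
    using G by (simp add: \<alpha>_def \<beta>_def field_simps) (simp add: G_def power2_eq_square algebra_simps)
  ultimately show thesis
    using G that[of \<alpha> \<beta>] by (simp add: inner_add_left inner_add_right inner_commute)
qed

text \<open>In the plane spanned by \<open>n1\<close> and \<open>n2\<close>, a vector orthogonal to \<open>n1\<close> is determined up to sign by its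
product with \<open>n2\<close>; the factor on the left is the Gram determinant.\<close>

lemma plane_vector_norm:
  fixes n1 n2 :: "'a::real_inner"
  assumes z: "z = \<alpha> *\<^sub>R n1 + \<beta> *\<^sub>R n2" and orth: "z \<bullet> n1 = 0"
  shows "(z \<bullet> z) * ((n1 \<bullet> n1) * (n2 \<bullet> n2) - (n1 \<bullet> n2)\<^sup>2) = (z \<bullet> n2)\<^sup>2 * (n1 \<bullet> n1)"
proof -
  have 1: "\<alpha> * (n1 \<bullet> n1) + \<beta> * (n1 \<bullet> n2) = 0"
    using orth by (simp add: z inner_add_left inner_add_right inner_commute)
  have 2: "z \<bullet> n2 = \<alpha> * (n1 \<bullet> n2) + \<beta> * (n2 \<bullet> n2)"
    by (simp add: z inner_add_left inner_add_right inner_commute)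
  have "z \<bullet> z = z \<bullet> (\<alpha> *\<^sub>R n1 + \<beta> *\<^sub>R n2)" by (simp add: z)
  then have 3: "z \<bullet> z = \<beta> * (z \<bullet> n2)" using orth by (simp add: inner_add_right)
  have "\<beta> * ((n1 \<bullet> n1) * (n2 \<bullet> n2) - (n1 \<bullet> n2)\<^sup>2)
     = (n1 \<bullet> n1) * (\<alpha> * (n1 \<bullet> n2) + \<beta> * (n2 \<bullet> n2)) - (n1 \<bullet> n2) * (\<alpha> * (n1 \<bullet> n1) + \<beta> * (n1 \<bullet> n2))"
    by (simp add: power2_eq_square algebra_simps)
  also have "\<dots> = (n1 \<bullet> n1) * (z \<bullet> n2)" by (simp add: 1 2)
  finally have 4: "\<beta> * ((n1 \<bullet> n1) * (n2 \<bullet> n2) - (n1 \<bullet> n2)\<^sup>2) = (n1 \<bullet> n1) * (z \<bullet> n2)" .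
  have "(z \<bullet> z) * ((n1 \<bullet> n1) * (n2 \<bullet> n2) - (n1 \<bullet> n2)\<^sup>2)
     = (z \<bullet> n2) * (\<beta> * ((n1 \<bullet> n1) * (n2 \<bullet> n2) - (n1 \<bullet> n2)\<^sup>2))" unfolding 3 by (simp only: ac_simps)
  then show ?thesis unfolding 4 by (simp only: power2_eq_square ac_simps)
qed

lemma solve_balance:
  fixes x y z :: "'a::real_vector"
  assumes "a *\<^sub>R x + b *\<^sub>R y + c *\<^sub>R z = 0" "c \<noteq> 0"
  shows "z = (- a / c) *\<^sub>R x + (- b / c) *\<^sub>R y"
proof -
  have "c *\<^sub>R z = c *\<^sub>R ((- a / c) *\<^sub>R x + (- b / c) *\<^sub>R y)"
    using assms by (simp add: scaleR_add_right algebra_simps eq_neg_iff_add_eq_0)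
  then show ?thesis using assms(2) by simp
qed

text \<open>Three balls of radii \<open>r1, r2, r3\<close> touch a line; the \<open>ni\<close> are the vectors from the line to the centres,
the \<open>\<omega>i\<close> the positions of the contact points on it, and the weights \<open>ai\<close> balance the normals.  The
positive quantity is the second-order coefficient of the excess when the direction is turned towards
\<open>\<xi>\<close> while the weights move along \<open>\<eta>\<close>.  For \<open>\<eta> = 0\<close> it can be negative; it has to be maximised over \<open>\<eta>\<close>.

Let \<open>Y\<close> be the projection of \<open>\<xi>\<close> to the plane of the normals.  The optimal \<open>\<eta>\<close> is the one with
\<open>\<eta>1 n1 + \<eta>2 n2 + \<eta>3 n3 = p\<close>, where \<open>p\<close> is the displacement for which each \<open>D \<omega>i = p + \<omega>i Y\<close> is orthogonal
to \<open>ni\<close>, so that the moving line stays tangent to first order.  The coefficient is then at least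
\<open>a1 (|D \<omega>1|\<^sup>2 - (n1 \<bullet> \<xi>)\<^sup>2) + a2 (|D \<omega>2|\<^sup>2 - (n2 \<bullet> \<xi>)\<^sup>2) + a3 (|D \<omega>3|\<^sup>2 - (n3 \<bullet> \<xi>)\<^sup>2)\<close>.
The first-order condition determines the numbers \<open>ni \<bullet> \<xi>\<close> up to a common factor \<open>\<tau>\<close>, and everything is
expressed through the triangle with sides \<open>li = ai ri\<close>.\<close>

lemma second_order_gain:
  fixes n1 n2 n3 \<xi> :: "'a::real_inner"
  assumes a: "a1 > 0" "a2 > 0" "a3 > 0" and bal: "a1 *\<^sub>R n1 + a2 *\<^sub>R n2 + a3 *\<^sub>R n3 = 0"
    and a_sum: "a1 + a2 + a3 = 1"
    and r: "r1 > 0" "r2 > 0" "r3 > 0"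
    and nr: "n1 \<bullet> n1 = r1\<^sup>2" "n2 \<bullet> n2 = r2\<^sup>2" "n3 \<bullet> n3 = r3\<^sup>2"
    and S: "r2 * r3 + n2 \<bullet> n3 > 0" "r1 * r3 + n1 \<bullet> n3 > 0" "r1 * r2 + n1 \<bullet> n2 > 0"
    and \<Omega>: "(\<omega>2 - \<omega>3)\<^sup>2 > 2 * (r2 * r3 + n2 \<bullet> n3)" "(\<omega>3 - \<omega>1)\<^sup>2 > 2 * (r1 * r3 + n1 \<bullet> n3)"
      "(\<omega>1 - \<omega>2)\<^sup>2 > 2 * (r1 * r2 + n1 \<bullet> n2)"
    and centred: "a1 * \<omega>1 + a2 * \<omega>2 + a3 * \<omega>3 = 0"
    and first: "a1 * \<omega>1 * (n1 \<bullet> \<xi>) + a2 * \<omega>2 * (n2 \<bullet> \<xi>) + a3 * \<omega>3 * (n3 \<bullet> \<xi>) = 0"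
    and \<xi>: "\<xi> \<noteq> 0"
  obtains \<eta>1 \<eta>2 \<eta>3 where "\<eta>1 + \<eta>2 + \<eta>3 = 0"
    "0 < (\<xi> \<bullet> \<xi>) * (a1 * \<omega>1\<^sup>2 + a2 * \<omega>2\<^sup>2 + a3 * \<omega>3\<^sup>2)
       - 2 * (\<eta>1 * \<omega>1 * (n1 \<bullet> \<xi>) + \<eta>2 * \<omega>2 * (n2 \<bullet> \<xi>) + \<eta>3 * \<omega>3 * (n3 \<bullet> \<xi>))
       - (a1 * (n1 \<bullet> \<xi>)\<^sup>2 + a2 * (n2 \<bullet> \<xi>)\<^sup>2 + a3 * (n3 \<bullet> \<xi>)\<^sup>2)
       - (\<eta>1 *\<^sub>R n1 + \<eta>2 *\<^sub>R n2 + \<eta>3 *\<^sub>R n3) \<bullet> (\<eta>1 *\<^sub>R n1 + \<eta>2 *\<^sub>R n2 + \<eta>3 *\<^sub>R n3)"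
proof -
  define l1 l2 l3 where "l1 = a1 * r1" "l2 = a2 * r2" "l3 = a3 * r3"
  note l = l1_l2_l3_def
  \<comment> \<open>The \<open>li\<close> are the lengths of the vectors \<open>ai ni\<close>, whose sum is \<open>0\<close>; so they are the sides of a triangle
    and the \<open>mi\<close> are positive.\<close>
  define m1 m2 m3 where "m1 = l2 + l3 - l1" "m2 = l1 + l3 - l2" "m3 = l1 + l2 - l3"
  note m = m1_m2_m3_def
  define d1 d2 d3 where "d1 = n2 \<bullet> n3" "d2 = n1 \<bullet> n3" "d3 = n1 \<bullet> n2"
  note d = d1_d2_d3_def
  have lpos: "l1 > 0" "l2 > 0" "l3 > 0" using a r by (auto simp: l)
  have e1: "a1 * r1\<^sup>2 + a2 * d3 + a3 * d2 = 0"
    using arg_cong[OF bal, of "\<lambda>z. n1 \<bullet> z"] by (simp add: inner_add_right d nr inner_commute)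
  have e2: "a1 * d3 + a2 * r2\<^sup>2 + a3 * d1 = 0"
    using arg_cong[OF bal, of "\<lambda>z. n2 \<bullet> z"] by (simp add: inner_add_right d nr inner_commute)
  have e3: "a1 * d2 + a2 * d1 + a3 * r3\<^sup>2 = 0"
    using arg_cong[OF bal, of "\<lambda>z. n3 \<bullet> z"] by (simp add: inner_add_right d nr inner_commute)
  have f1: "a1\<^sup>2 * r1\<^sup>2 + a1 * a2 * d3 + a1 * a3 * d2 = 0"
    using arg_cong[OF e1, of "\<lambda>z. a1 * z"] by (simp add: algebra_simps power2_eq_square)
  have f2: "a1 * a2 * d3 + a2\<^sup>2 * r2\<^sup>2 + a2 * a3 * d1 = 0"
    using arg_cong[OF e2, of "\<lambda>z. a2 * z"] by (simp add: algebra_simps power2_eq_square)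
  have f3: "a1 * a3 * d2 + a2 * a3 * d1 + a3\<^sup>2 * r3\<^sup>2 = 0"
    using arg_cong[OF e3, of "\<lambda>z. a3 * z"] by (simp add: algebra_simps power2_eq_square)
  have s1: "2 * (a2 * a3) * (r2 * r3 + d1) = m2 * m3"
    using f1 f2 f3 by (simp add: m l algebra_simps power2_eq_square)
  have s2: "2 * (a1 * a3) * (r1 * r3 + d2) = m1 * m3"
    using f1 f2 f3 by (simp add: m l algebra_simps power2_eq_square)
  have s3: "2 * (a1 * a2) * (r1 * r2 + d3) = m1 * m2"
    using f1 f2 f3 by (simp add: m l algebra_simps power2_eq_square)
  have mm: "m2 * m3 > 0" "m1 * m3 > 0" "m1 * m2 > 0"
    using s1 s2 s3 a S by (metis d mult_pos_pos zero_less_numeral)+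
  have mpos: "m1 > 0" "m2 > 0" "m3 > 0"
  proof -
    have "m1 + m2 > 0" "m1 + m3 > 0" using lpos by (auto simp: m)
    then show "m1 > 0" "m2 > 0" "m3 > 0" using mm by (auto simp: zero_less_mult_iff)
  qed
  define s where "s = m1 + m2 + m3"
  define \<Lambda> where "\<Lambda> = a1 * a2 * a3"
  define H where "H = m1 * m2 * m3 * s"
  have pos: "s > 0" "\<Lambda> > 0" "H > 0" using mpos a by (auto simp: s_def \<Lambda>_def H_def)
  have ll: "l1 = (m2 + m3) / 2" "l2 = (m1 + m3) / 2" "l3 = (m1 + m2) / 2" by (auto simp: m)
  \<comment> \<open>Heron's formula: the Gram determinants of pairs of normals are all proportional to \<open>H\<close>, which is
    16 times the squared area of the triangle.\<close>
  have gram_aux: "4 * (A * B)\<^sup>2 * (x\<^sup>2 * y\<^sup>2 - e\<^sup>2) = H"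
    if "2 * (A * B) * (x * y + e) = u * v" "A * x = (t + v) / 2" "B * y = (t + u) / 2" "H = t * u * v * s" "s = t + u + v"
    for A B x y e t u v
  proof -
    have "4 * (A * B)\<^sup>2 * (x\<^sup>2 * y\<^sup>2 - e\<^sup>2)
       = (2 * (A * B) * (x * y + e)) * (4 * ((A * x) * (B * y)) - 2 * (A * B) * (x * y + e))"
      by (simp add: algebra_simps power2_eq_square)
    also have "\<dots> = H" unfolding that by (simp add: field_simps)
    finally show ?thesis .
  qed
  have g3: "4 * (a1 * a2)\<^sup>2 * (r1\<^sup>2 * r2\<^sup>2 - d3\<^sup>2) = H"
    using gram_aux[of a1 a2 r1 r2 d3 m1 m2 m3] s3 by (simp add: ll(1,2)[unfolded l] H_def s_def algebra_simps)
  have g1: "4 * (a2 * a3)\<^sup>2 * (r2\<^sup>2 * r3\<^sup>2 - d1\<^sup>2) = H"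
    using gram_aux[of a2 a3 r2 r3 d1 m2 m3 m1] s1 by (simp add: ll(2,3)[unfolded l] H_def s_def algebra_simps)
  have g2: "4 * (a3 * a1)\<^sup>2 * (r3\<^sup>2 * r1\<^sup>2 - d2\<^sup>2) = H"
    using gram_aux[of a3 a1 r3 r1 d2 m3 m1 m2] s2 by (simp add: ll(1,3)[unfolded l] H_def s_def algebra_simps)
  define \<nu>1 \<nu>2 \<nu>3 where "\<nu>1 = n1 \<bullet> \<xi>" "\<nu>2 = n2 \<bullet> \<xi>" "\<nu>3 = n3 \<bullet> \<xi>"
  note \<nu> = \<nu>1_\<nu>2_\<nu>3_def
  have N: "a1 * \<nu>1 + a2 * \<nu>2 + a3 * \<nu>3 = 0"
    using arg_cong[OF bal, of "\<lambda>z. z \<bullet> \<xi>"] by (simp add: inner_add_left \<nu>)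
  have F: "a1 * \<omega>1 * \<nu>1 + a2 * \<omega>2 * \<nu>2 + a3 * \<omega>3 * \<nu>3 = 0" using first by (simp add: \<nu>)
  have \<Omega>0: "(\<omega>2 - \<omega>3)\<^sup>2 > 0" "(\<omega>3 - \<omega>1)\<^sup>2 > 0" "(\<omega>1 - \<omega>2)\<^sup>2 > 0" using \<Omega> S by (smt (verit))+
  then have ne: "\<omega>2 - \<omega>3 \<noteq> 0" "\<omega>3 - \<omega>1 \<noteq> 0" "\<omega>1 - \<omega>2 \<noteq> 0" by auto
  define \<tau> where "\<tau> = a1 * \<nu>1 / (\<omega>2 - \<omega>3)"
  have t1: "a1 * \<nu>1 = \<tau> * (\<omega>2 - \<omega>3)" using ne by (simp add: \<tau>_def)
  have "a2 * \<nu>2 * (\<omega>2 - \<omega>3) = - (a1 * \<nu>1) * (\<omega>1 - \<omega>3)"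
  proof -
    have "a2 * \<nu>2 * (\<omega>2 - \<omega>3) + (a1 * \<nu>1) * (\<omega>1 - \<omega>3) = (a1 * \<omega>1 * \<nu>1 + a2 * \<omega>2 * \<nu>2 + a3 * \<omega>3 * \<nu>3)
         - \<omega>3 * (a1 * \<nu>1 + a2 * \<nu>2 + a3 * \<nu>3)" by (simp add: algebra_simps)
    then show ?thesis using N F by simp
  qed
  then have "a2 * \<nu>2 * (\<omega>2 - \<omega>3) = (\<tau> * (\<omega>3 - \<omega>1)) * (\<omega>2 - \<omega>3)" unfolding t1 by (simp add: algebra_simps)
  then have t2: "a2 * \<nu>2 = \<tau> * (\<omega>3 - \<omega>1)" using ne by simp
  have t3: "a3 * \<nu>3 = \<tau> * (\<omega>1 - \<omega>2)" using N t1 t2 by (simp add: algebra_simps)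
  show thesis
  proof (cases "\<tau> = 0")
    case True
    then have 0: "\<nu>1 = 0" "\<nu>2 = 0" "\<nu>3 = 0" using t1 t2 t3 a by auto
    have "a1 * \<omega>1\<^sup>2 + a2 * \<omega>2\<^sup>2 + a3 * \<omega>3\<^sup>2 > 0"
    proof (rule ccontr)
      assume "\<not> ?thesis"
      moreover have "a1 * \<omega>1\<^sup>2 \<ge> 0" "a2 * \<omega>2\<^sup>2 \<ge> 0" "a3 * \<omega>3\<^sup>2 \<ge> 0" using a by auto
      ultimately have "a1 * \<omega>1\<^sup>2 = 0" "a2 * \<omega>2\<^sup>2 = 0" by linarith+
      then show False using a ne by simp
    qed
    then show thesis using that[of 0 0 0] 0 \<xi> by (simp add: \<nu>)
  next
    case False
    have G: "(n1 \<bullet> n1) * (n2 \<bullet> n2) - (n1 \<bullet> n2)\<^sup>2 \<noteq> 0" using g3 pos a by (auto simp: nr d)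
    obtain \<alpha> \<beta> where p0: "(\<alpha> *\<^sub>R n1 + \<beta> *\<^sub>R n2) \<bullet> n1 = - \<omega>1 * \<nu>1" "(\<alpha> *\<^sub>R n1 + \<beta> *\<^sub>R n2) \<bullet> n2 = - \<omega>2 * \<nu>2"
      using plane_vector_with_products[OF G] by metis
    obtain \<gamma> \<delta> where Y0: "(\<gamma> *\<^sub>R n1 + \<delta> *\<^sub>R n2) \<bullet> n1 = \<nu>1" "(\<gamma> *\<^sub>R n1 + \<delta> *\<^sub>R n2) \<bullet> n2 = \<nu>2"
      using plane_vector_with_products[OF G] by metis
    define p where "p = \<alpha> *\<^sub>R n1 + \<beta> *\<^sub>R n2"
    define Y where "Y = \<gamma> *\<^sub>R n1 + \<delta> *\<^sub>R n2"
    have p: "p \<bullet> n1 = - \<omega>1 * \<nu>1" "p \<bullet> n2 = - \<omega>2 * \<nu>2" using p0 by (simp_all only: p_def)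
    have Y: "Y \<bullet> n1 = \<nu>1" "Y \<bullet> n2 = \<nu>2" using Y0 by (simp_all only: Y_def)
    have n1: "n1 = (- a2 / a1) *\<^sub>R n2 + (- a3 / a1) *\<^sub>R n3"
      using solve_balance[of a2 n2 a3 n3 a1 n1] bal a by (simp add: ac_simps)
    have n2: "n2 = (- a1 / a2) *\<^sub>R n1 + (- a3 / a2) *\<^sub>R n3"
      using solve_balance[of a1 n1 a3 n3 a2 n2] bal a by (simp add: ac_simps)
    have p3: "p \<bullet> n3 = - \<omega>3 * \<nu>3"
    proof -
      have "a3 * (p \<bullet> n3) = a1 * \<omega>1 * \<nu>1 + a2 * \<omega>2 * \<nu>2"
        using arg_cong[OF bal, of "\<lambda>z. p \<bullet> z"] by (simp add: inner_add_right p algebra_simps)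
      then have "a3 * (p \<bullet> n3) = a3 * (- \<omega>3 * \<nu>3)" using F by (simp add: algebra_simps)
      then show ?thesis using a mult_left_cancel[of a3 "p \<bullet> n3" "- \<omega>3 * \<nu>3"] by simp
    qed
    have Y3: "Y \<bullet> n3 = \<nu>3"
    proof -
      have "a1 * \<nu>1 + a2 * \<nu>2 + a3 * (Y \<bullet> n3) = 0"
        using arg_cong[OF bal, of "\<lambda>z. Y \<bullet> z"] by (simp add: inner_add_right Y)
      then have "a3 * (Y \<bullet> n3) = a3 * \<nu>3" using N by linarith
      then show ?thesis using a by simp
    qed
    define D where "D = (\<lambda>w. p + w *\<^sub>R Y)"
    have Dn: "D w \<bullet> n1 = (w - \<omega>1) * \<nu>1" "D w \<bullet> n2 = (w - \<omega>2) * \<nu>2" "D w \<bullet> n3 = (w - \<omega>3) * \<nu>3" for w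
      using p p3 Y Y3 by (simp_all add: D_def inner_add_left algebra_simps)
    have D12: "D w = (\<alpha> + w * \<gamma>) *\<^sub>R n1 + (\<beta> + w * \<delta>) *\<^sub>R n2" for w
      by (simp add: D_def p_def Y_def algebra_simps)
    have D13: "\<exists>x y. D w = x *\<^sub>R n3 + y *\<^sub>R n1" for w
    proof -
      have "D w = ((\<beta> + w * \<delta>) * (- a3 / a2)) *\<^sub>R n3 + ((\<alpha> + w * \<gamma>) + (\<beta> + w * \<delta>) * (- a1 / a2)) *\<^sub>R n1"
        unfolding D12 by (subst n2) (simp add: algebra_simps)
      then show ?thesis by blast
    qed
    have D32: "\<exists>x y. D w = x *\<^sub>R n2 + y *\<^sub>R n3" for w
    proof -
      have "D w = ((\<beta> + w * \<delta>) + (\<alpha> + w * \<gamma>) * (- a2 / a1)) *\<^sub>R n2 + ((\<alpha> + w * \<gamma>) * (- a3 / a1)) *\<^sub>R n3"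
        unfolding D12 by (subst n1) (simp add: algebra_simps)
      then show ?thesis by blast
    qed
    define E where "E = (\<lambda>w. D w \<bullet> D w)"
    have E1: "E \<omega>1 * (r1\<^sup>2 * r2\<^sup>2 - d3\<^sup>2) = ((\<omega>1 - \<omega>2) * \<nu>2)\<^sup>2 * r1\<^sup>2"
      using plane_vector_norm[OF D12[of \<omega>1]] by (simp add: Dn E_def nr d)
    obtain x y where "D \<omega>3 = x *\<^sub>R n3 + y *\<^sub>R n1" using D13 by blast
    from plane_vector_norm[OF this] have E3: "E \<omega>3 * (r3\<^sup>2 * r1\<^sup>2 - d2\<^sup>2) = ((\<omega>3 - \<omega>1) * \<nu>1)\<^sup>2 * r3\<^sup>2"
      by (simp add: Dn E_def nr d inner_commute[of n3 n1])
    obtain x y where "D \<omega>2 = x *\<^sub>R n2 + y *\<^sub>R n3" using D32 by blast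
    from plane_vector_norm[OF this] have E2: "E \<omega>2 * (r2\<^sup>2 * r3\<^sup>2 - d1\<^sup>2) = ((\<omega>2 - \<omega>3) * \<nu>3)\<^sup>2 * r2\<^sup>2"
      by (simp add: Dn E_def nr d inner_commute[of n3 n1])
    define X1 X2 X3 where "X1 = (\<omega>2 - \<omega>3)\<^sup>2" "X2 = (\<omega>3 - \<omega>1)\<^sup>2" "X3 = (\<omega>1 - \<omega>2)\<^sup>2"
    note X = X1_X2_X3_def
    \<comment> \<open>The factors by which the squared distances of the contact points exceed the bounds given by disjointness;
      \<open>y = 1\<close> means that two of the balls touch.\<close>
    define y1 y2 y3 where "y1 = X1 * (a2 * a3) / (m2 * m3)" "y2 = X2 * (a1 * a3) / (m1 * m3)"
      "y3 = X3 * (a1 * a2) / (m1 * m2)"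
    note y = y1_y2_y3_def
    have y_ge: "y1 \<ge> 1" "y2 \<ge> 1" "y3 \<ge> 1"
    proof -
      have "X1 * (a2 * a3) \<ge> 2 * (r2 * r3 + d1) * (a2 * a3)"
        using \<Omega>(1) a by (intro mult_right_mono) (auto simp: X d)
      then show "y1 \<ge> 1" using s1 mm by (simp add: y algebra_simps)
      have "X2 * (a1 * a3) \<ge> 2 * (r1 * r3 + d2) * (a1 * a3)"
        using \<Omega>(2) a by (intro mult_right_mono) (auto simp: X d)
      then show "y2 \<ge> 1" using s2 mm by (simp add: y algebra_simps)
      have "X3 * (a1 * a2) \<ge> 2 * (r1 * r2 + d3) * (a1 * a2)"
        using \<Omega>(3) a by (intro mult_right_mono) (auto simp: X d)
      then show "y3 \<ge> 1" using s3 mm by (simp add: y algebra_simps)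
    qed
    have Xy: "X1 = y1 * (m2 * m3) / (a2 * a3)" "X2 = y2 * (m1 * m3) / (a1 * a3)" "X3 = y3 * (m1 * m2) / (a1 * a2)"
      using mpos a by (auto simp: y)
    have K: "A * W = \<tau>\<^sup>2 * yj * yk * u * (v + t)\<^sup>2 / (s * \<Lambda>)"
      if "W * (x\<^sup>2 * z\<^sup>2 - e\<^sup>2) = (o1 * q)\<^sup>2 * x\<^sup>2" "4 * (A * B)\<^sup>2 * (x\<^sup>2 * z\<^sup>2 - e\<^sup>2) = H"
        "B * q = \<tau> * o2" "A * x = (v + t) / 2" "o1\<^sup>2 = yk * (u * v) / (A * B)" "o2\<^sup>2 = yj * (u * t) / (A * C)"
        "H = u * v * t * s" "\<Lambda> = A * B * C" "A > 0" "B > 0" "C > 0" "u > 0" "v > 0" "t > 0"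
      for A B C W x z e o1 o2 q u v t yj yk
    proof -
      have "W * H = 4 * (A * B)\<^sup>2 * (W * (x\<^sup>2 * z\<^sup>2 - e\<^sup>2))" using that(2) by (simp add: algebra_simps)
      also have "\<dots> = 4 * (A * B)\<^sup>2 * ((o1 * q)\<^sup>2 * x\<^sup>2)" using that(1) by simp
      also have "\<dots> = 4 * o1\<^sup>2 * (B * q)\<^sup>2 * (A * x)\<^sup>2" by (simp add: power2_eq_square algebra_simps)
      also have "\<dots> = \<tau>\<^sup>2 * o1\<^sup>2 * o2\<^sup>2 * (v + t)\<^sup>2" unfolding that(3,4) by (simp add: power2_eq_square field_simps)
      also have "\<dots> = \<tau>\<^sup>2 * (yk * (u * v) / (A * B)) * (yj * (u * t) / (A * C)) * (v + t)\<^sup>2" unfolding that(5,6) ..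
      finally have W: "W * H = \<tau>\<^sup>2 * (yk * (u * v) / (A * B)) * (yj * (u * t) / (A * C)) * (v + t)\<^sup>2" .
      have W: "W = \<tau>\<^sup>2 * (yk * (u * v) / (A * B)) * (yj * (u * t) / (A * C)) * (v + t)\<^sup>2 / H"
        using pos by (intro eq_divide_imp W) auto
      show ?thesis unfolding W that(7,8) using that(9-) pos by (simp add: field_simps power2_eq_square)
    qed
    have k1: "a1 * E \<omega>1 = \<tau>\<^sup>2 * y2 * y3 * m1 * (m2 + m3)\<^sup>2 / (s * \<Lambda>)"
      using K[OF E1 g3 t2, of m2 m3 y3 m1 y2 a3] a mpos Xy X ll l
      by (simp add: H_def \<Lambda>_def algebra_simps)
    have k2: "a2 * E \<omega>2 = \<tau>\<^sup>2 * y3 * y1 * m2 * (m3 + m1)\<^sup>2 / (s * \<Lambda>)"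
      using K[OF E2 g1 t3, of m3 m1 y1 m2 y3 a1] a mpos Xy X ll l
      by (simp add: H_def \<Lambda>_def algebra_simps)
    have k3: "a3 * E \<omega>3 = \<tau>\<^sup>2 * y1 * y2 * m3 * (m1 + m2)\<^sup>2 / (s * \<Lambda>)"
      using K[OF E3 g2 t1, of m1 m2 y2 m3 y1 a2] a mpos Xy X ll l
      by (simp add: H_def \<Lambda>_def algebra_simps)
    have q1: "a1 * \<nu>1\<^sup>2 = \<tau>\<^sup>2 * (y1 * m2 * m3) / \<Lambda>"
    proof -
      have "a1 * \<nu>1\<^sup>2 = (a1 * \<nu>1)\<^sup>2 / a1" using a by (simp add: power2_eq_square)
      also have "\<dots> = \<tau>\<^sup>2 * X1 / a1" unfolding t1 X by (simp add: power_mult_distrib)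
      finally show ?thesis unfolding Xy \<Lambda>_def using a by (simp add: field_simps)
    qed
    have q2: "a2 * \<nu>2\<^sup>2 = \<tau>\<^sup>2 * (y2 * m1 * m3) / \<Lambda>"
    proof -
      have "a2 * \<nu>2\<^sup>2 = (a2 * \<nu>2)\<^sup>2 / a2" using a by (simp add: power2_eq_square)
      also have "\<dots> = \<tau>\<^sup>2 * X2 / a2" unfolding t2 X by (simp add: power_mult_distrib)
      finally show ?thesis unfolding Xy \<Lambda>_def using a by (simp add: field_simps)
    qed
    have q3: "a3 * \<nu>3\<^sup>2 = \<tau>\<^sup>2 * (y3 * m1 * m2) / \<Lambda>"
    proof -
      have "a3 * \<nu>3\<^sup>2 = (a3 * \<nu>3)\<^sup>2 / a3" using a by (simp add: power2_eq_square)
      also have "\<dots> = \<tau>\<^sup>2 * X3 / a3" unfolding t3 X by (simp add: power_mult_distrib)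
      finally show ?thesis unfolding Xy \<Lambda>_def using a by (simp add: field_simps)
    qed
    have main: "a1 * E \<omega>1 + a2 * E \<omega>2 + a3 * E \<omega>3 - (a1 * \<nu>1\<^sup>2 + a2 * \<nu>2\<^sup>2 + a3 * \<nu>3\<^sup>2) > 0"
    proof -
      have "a1 * E \<omega>1 + a2 * E \<omega>2 + a3 * E \<omega>3 - (a1 * \<nu>1\<^sup>2 + a2 * \<nu>2\<^sup>2 + a3 * \<nu>3\<^sup>2)
        = \<tau>\<^sup>2 / (s * \<Lambda>) * (m1 * (m2 + m3)\<^sup>2 * (y2 * y3) + m2 * (m1 + m3)\<^sup>2 * (y1 * y3) + m3 * (m1 + m2)\<^sup>2 * (y1 * y2)
           - s * (m2 * m3 * y1 + m1 * m3 * y2 + m1 * m2 * y3))"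
        unfolding k1 k2 k3 q1 q2 q3 using pos by (simp add: field_simps)
      also have "\<dots> > 0"
        using disc_inequality[OF mpos y_ge] False pos by (intro mult_pos_pos divide_pos_pos) (auto simp: s_def)
      finally show ?thesis .
    qed
    have EE: "a1 * E \<omega>1 + a2 * E \<omega>2 + a3 * E \<omega>3 = p \<bullet> p + (Y \<bullet> Y) * (a1 * \<omega>1\<^sup>2 + a2 * \<omega>2\<^sup>2 + a3 * \<omega>3\<^sup>2)"
    proof -
      have "E w = p \<bullet> p + 2 * w * (p \<bullet> Y) + w\<^sup>2 * (Y \<bullet> Y)" for w
        by (simp add: E_def D_def inner_add_left inner_add_right inner_commute power2_eq_square algebra_simps)
      then have "a1 * E \<omega>1 + a2 * E \<omega>2 + a3 * E \<omega>3 = (a1 + a2 + a3) * (p \<bullet> p) + 2 * (p \<bullet> Y) * (a1 * \<omega>1 + a2 * \<omega>2 + a3 * \<omega>3)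
          + (Y \<bullet> Y) * (a1 * \<omega>1\<^sup>2 + a2 * \<omega>2\<^sup>2 + a3 * \<omega>3\<^sup>2)" by (simp add: algebra_simps)
      then show ?thesis using centred a_sum by simp
    qed
    have YY: "\<xi> \<bullet> \<xi> \<ge> Y \<bullet> Y"
    proof -
      have "Y \<bullet> \<xi> = \<gamma> * \<nu>1 + \<delta> * \<nu>2" by (simp add: Y_def \<nu> inner_add_left)
      moreover have "Y \<bullet> Y = Y \<bullet> (\<gamma> *\<^sub>R n1 + \<delta> *\<^sub>R n2)" by (simp add: Y_def)
      ultimately have "Y \<bullet> \<xi> = Y \<bullet> Y" by (simp add: inner_add_right Y)
      then have "(\<xi> - Y) \<bullet> (\<xi> - Y) = \<xi> \<bullet> \<xi> - Y \<bullet> Y" by (simp add: inner_diff_left inner_diff_right inner_commute)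
      then show ?thesis using inner_ge_zero[of "\<xi> - Y"] by linarith
    qed
    \<comment> \<open>Subtracting a multiple of the balanced weights makes the sum of \<open>\<eta>\<close> vanish and does not change
      \<open>\<eta>1 n1 + \<eta>2 n2 + \<eta>3 n3 = p\<close>.\<close>
    define k where "k = \<alpha> + \<beta>"
    define \<eta>1 \<eta>2 \<eta>3 where "\<eta>1 = \<alpha> - k * a1" "\<eta>2 = \<beta> - k * a2" "\<eta>3 = - (k * a3)"
    note \<eta> = \<eta>1_\<eta>2_\<eta>3_def
    have \<eta>0: "\<eta>1 + \<eta>2 + \<eta>3 = 0"
    proof -
      have "\<eta>1 + \<eta>2 + \<eta>3 = k * (1 - (a1 + a2 + a3))" by (simp add: \<eta> k_def algebra_simps)
      then show ?thesis using a_sum by simp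
    qed
    have \<eta>p: "\<eta>1 *\<^sub>R n1 + \<eta>2 *\<^sub>R n2 + \<eta>3 *\<^sub>R n3 = p"
    proof -
      have "\<eta>1 *\<^sub>R n1 + \<eta>2 *\<^sub>R n2 + \<eta>3 *\<^sub>R n3 = p - k *\<^sub>R (a1 *\<^sub>R n1 + a2 *\<^sub>R n2 + a3 *\<^sub>R n3)"
        by (simp add: \<eta> p_def algebra_simps)
      then show ?thesis using bal by simp
    qed
    have \<eta>\<nu>: "\<eta>1 * \<omega>1 * \<nu>1 + \<eta>2 * \<omega>2 * \<nu>2 + \<eta>3 * \<omega>3 * \<nu>3 = - (p \<bullet> p)"
    proof -
      have "p \<bullet> p = p \<bullet> (\<eta>1 *\<^sub>R n1 + \<eta>2 *\<^sub>R n2 + \<eta>3 *\<^sub>R n3)" by (simp only: \<eta>p)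
      then show ?thesis by (simp add: inner_add_right p p3)
    qed
    have "(Y \<bullet> Y) * (a1 * \<omega>1\<^sup>2 + a2 * \<omega>2\<^sup>2 + a3 * \<omega>3\<^sup>2) \<le> (\<xi> \<bullet> \<xi>) * (a1 * \<omega>1\<^sup>2 + a2 * \<omega>2\<^sup>2 + a3 * \<omega>3\<^sup>2)"
      using YY a by (intro mult_right_mono) auto
    moreover have "0 < x - 2 * e - n - q" if "y \<le> x" "0 < q + y - n" "e = - q" for x y n q e :: real
      using that by linarith
    ultimately have "0 < (\<xi> \<bullet> \<xi>) * (a1 * \<omega>1\<^sup>2 + a2 * \<omega>2\<^sup>2 + a3 * \<omega>3\<^sup>2)
       - 2 * (\<eta>1 * \<omega>1 * \<nu>1 + \<eta>2 * \<omega>2 * \<nu>2 + \<eta>3 * \<omega>3 * \<nu>3) - (a1 * \<nu>1\<^sup>2 + a2 * \<nu>2\<^sup>2 + a3 * \<nu>3\<^sup>2) - p \<bullet> p"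
      using main \<eta>\<nu> unfolding EE by blast
    then show thesis by (intro that[OF \<eta>0]) (simp only: \<eta>p \<nu>)
  qed
qed

section \<open>Tangency cannot persist along an arc of directions\<close>

text \<open>Both signs of \<open>\<epsilon>\<close> occur near \<open>0\<close>, so the linear coefficient vanishes and the quadratic one takes over.\<close>

lemma quartic_nonpos_near_0:
  fixes b1 b2 b3 b4 :: real
  assumes ev: "\<forall>\<^sub>F \<epsilon> in at 0. \<epsilon> * b1 + \<epsilon>\<^sup>2 * b2 + \<epsilon> ^ 3 * b3 + \<epsilon> ^ 4 * b4 \<le> 0"
  shows "b1 = 0" "b2 \<le> 0"
proof -
  have evR: "\<forall>\<^sub>F \<epsilon> in at_right 0. \<epsilon> * b1 + \<epsilon>\<^sup>2 * b2 + \<epsilon> ^ 3 * b3 + \<epsilon> ^ 4 * b4 \<le> 0"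
    and evL: "\<forall>\<^sub>F \<epsilon> in at_left 0. \<epsilon> * b1 + \<epsilon>\<^sup>2 * b2 + \<epsilon> ^ 3 * b3 + \<epsilon> ^ 4 * b4 \<le> 0"
    using ev by (auto simp: eventually_at_split)
  have fac: "\<epsilon> * b1 + \<epsilon>\<^sup>2 * b2 + \<epsilon> ^ 3 * b3 + \<epsilon> ^ 4 * b4 = \<epsilon> * (b1 + \<epsilon> * b2 + \<epsilon>\<^sup>2 * b3 + \<epsilon> ^ 3 * b4)" for \<epsilon>
    by (simp add: algebra_simps power2_eq_square power3_eq_cube power4_eq_xxxx)
  have lim1: "((\<lambda>\<epsilon>. b1 + \<epsilon> * b2 + \<epsilon>\<^sup>2 * b3 + \<epsilon> ^ 3 * b4) \<longlongrightarrow> b1) (at 0 within S)" for S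
    by (rule tendsto_eq_intros | simp)+
  have "b1 \<le> 0"
  proof (rule tendsto_upperbound[OF lim1])
    show "\<forall>\<^sub>F \<epsilon> in at_right 0. b1 + \<epsilon> * b2 + \<epsilon>\<^sup>2 * b3 + \<epsilon> ^ 3 * b4 \<le> 0"
      using evR eventually_at_right_less[of 0] by eventually_elim (simp add: fac mult_le_0_iff)
  qed simp
  moreover have "b1 \<ge> 0"
  proof (rule tendsto_lowerbound[OF lim1])
    have "\<forall>\<^sub>F \<epsilon>::real in at_left 0. \<epsilon> < 0" by (auto simp: eventually_at_filter)
    with evL show "\<forall>\<^sub>F \<epsilon> in at_left 0. 0 \<le> b1 + \<epsilon> * b2 + \<epsilon>\<^sup>2 * b3 + \<epsilon> ^ 3 * b4"
      by eventually_elim (simp add: fac mult_le_0_iff)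
  qed simp
  ultimately show b1: "b1 = 0" by simp
  have fac2: "\<epsilon> * b1 + \<epsilon>\<^sup>2 * b2 + \<epsilon> ^ 3 * b3 + \<epsilon> ^ 4 * b4 = \<epsilon>\<^sup>2 * (b2 + \<epsilon> * b3 + \<epsilon>\<^sup>2 * b4)" for \<epsilon>
    by (simp add: b1 algebra_simps power2_eq_square power3_eq_cube power4_eq_xxxx)
  have lim2: "((\<lambda>\<epsilon>. b2 + \<epsilon> * b3 + \<epsilon>\<^sup>2 * b4) \<longlongrightarrow> b2) (at_right 0)"
    by (rule tendsto_eq_intros | simp)+
  show "b2 \<le> 0"
  proof (rule tendsto_upperbound[OF lim2])
    show "\<forall>\<^sub>F \<epsilon> in at_right 0. b2 + \<epsilon> * b3 + \<epsilon>\<^sup>2 * b4 \<le> 0"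
      using evR eventually_at_right_less[of 0] by eventually_elim (simp add: fac2 mult_le_0_iff)
  qed simp
qed

text \<open>At a line through \<open>x\<close> of unit direction \<open>w\<close> that touches all balls, the excess is expanded while the
direction turns towards \<open>\<xi>\<close> and the weights move along \<open>\<eta>\<close>.  The constant term vanishes by tangency.  The
higher coefficients are left unspecified, since only their independence of \<open>\<epsilon>\<close> matters.\<close>

lemma excess_expansion:
  fixes c :: "'n::finite \<Rightarrow> 'a::real_inner"
  assumes w: "w \<bullet> w = 1" and \<xi>w: "w \<bullet> \<xi> = 0"
    and a: "(\<Sum>i\<in>UNIV. a $ i) = 1" and \<eta>: "(\<Sum>i\<in>UNIV. \<eta> $ i) = 0"
    and x: "x = (\<Sum>i\<in>UNIV. a $ i *\<^sub>R c i)"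
    and \<omega>: "\<And>i. \<omega> i = w \<bullet> (c i - x)" and n: "\<And>i. n i = c i - x - \<omega> i *\<^sub>R w"
    and tangent: "\<And>i. shadow w (c i - x) = k i"
  shows "\<exists>b3 b4. \<forall>\<epsilon>. excess c k (w + \<epsilon> *\<^sub>R \<xi>) (a + \<epsilon> *\<^sub>R \<eta>) =
     \<epsilon> * (- 2 * (\<Sum>i\<in>UNIV. a $ i * \<omega> i * (n i \<bullet> \<xi>)))
     + \<epsilon>\<^sup>2 * ((\<xi> \<bullet> \<xi>) * (\<Sum>i\<in>UNIV. a $ i * (\<omega> i)\<^sup>2) - 2 * (\<Sum>i\<in>UNIV. \<eta> $ i * \<omega> i * (n i \<bullet> \<xi>))
          - (\<Sum>i\<in>UNIV. a $ i * (n i \<bullet> \<xi>)\<^sup>2) - (\<Sum>i\<in>UNIV. \<eta> $ i *\<^sub>R n i) \<bullet> (\<Sum>i\<in>UNIV. \<eta> $ i *\<^sub>R n i))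
     + \<epsilon> ^ 3 * b3 + \<epsilon> ^ 4 * b4"
proof -
  define s where "s = (\<Sum>i\<in>UNIV. \<eta> $ i * \<omega> i)"
  define m where "m = (\<Sum>i\<in>UNIV. \<eta> $ i *\<^sub>R n i)"
  have wn: "w \<bullet> n i = 0" for i by (simp add: n \<omega> inner_diff_right w)
  have cx: "c i - x = \<omega> i *\<^sub>R w + n i" for i by (simp add: n)
  have nn: "n i \<bullet> n i = k i" for i
  proof -
    have "shadow w (\<omega> i *\<^sub>R w + n i) = n i \<bullet> n i"
      using wn[of i] by (simp add: shadow_def inner_add_left inner_add_right inner_commute w power2_eq_square)
    then show ?thesis using tangent[of i] unfolding cx by simp
  qed
  have wm: "w \<bullet> m = 0" by (simp add: m_def inner_sum_right wn)
  have WW: "(w + \<epsilon> *\<^sub>R \<xi>) \<bullet> (w + \<epsilon> *\<^sub>R \<xi>) = 1 + \<epsilon>\<^sup>2 * (\<xi> \<bullet> \<xi>)" for \<epsilon>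
    using \<xi>w by (simp add: inner_add_left inner_add_right inner_commute w power2_eq_square)
  have summand: "shadow (w + \<epsilon> *\<^sub>R \<xi>) (c i - x) - k i * ((w + \<epsilon> *\<^sub>R \<xi>) \<bullet> (w + \<epsilon> *\<^sub>R \<xi>))
     = \<epsilon>\<^sup>2 * ((\<xi> \<bullet> \<xi>) * (\<omega> i)\<^sup>2) - 2 * \<epsilon> * (\<omega> i * (n i \<bullet> \<xi>)) - \<epsilon>\<^sup>2 * (n i \<bullet> \<xi>)\<^sup>2" for \<epsilon> i
  proof -
    have 1: "(c i - x) \<bullet> (c i - x) = (\<omega> i)\<^sup>2 + k i"
      unfolding cx using wn[of i] nn[of i] by (simp add: inner_add_left inner_add_right inner_commute w power2_eq_square)
    have 2: "(w + \<epsilon> *\<^sub>R \<xi>) \<bullet> (c i - x) = \<omega> i + \<epsilon> * (n i \<bullet> \<xi>)"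
      unfolding cx using wn[of i] \<xi>w by (simp add: inner_add_left inner_add_right inner_commute w)
    show ?thesis unfolding shadow_def WW 1 2 by (simp add: power2_eq_square algebra_simps)
  qed
  have g: "(\<Sum>i\<in>UNIV. (a + \<epsilon> *\<^sub>R \<eta>) $ i *\<^sub>R c i) - x = \<epsilon> *\<^sub>R (s *\<^sub>R w + m)" for \<epsilon>
  proof -
    have "s *\<^sub>R w + m = (\<Sum>i\<in>UNIV. \<eta> $ i *\<^sub>R (c i - x))"
      by (simp add: s_def m_def cx scaleR_add_right sum.distrib scaleR_sum_left)
    also have "\<dots> = (\<Sum>i\<in>UNIV. \<eta> $ i *\<^sub>R c i) - (\<Sum>i\<in>UNIV. \<eta> $ i) *\<^sub>R x"
      by (simp add: scaleR_diff_right sum_subtractf scaleR_sum_left)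
    finally have "s *\<^sub>R w + m = (\<Sum>i\<in>UNIV. \<eta> $ i *\<^sub>R c i)" by (simp add: \<eta>)
    then show ?thesis by (simp add: x scaleR_add_left sum.distrib scaleR_sum_right)
  qed
  have sg: "shadow (w + \<epsilon> *\<^sub>R \<xi>) (\<epsilon> *\<^sub>R (s *\<^sub>R w + m)) =
     \<epsilon>\<^sup>2 * (m \<bullet> m) - \<epsilon> ^ 3 * (2 * s * (\<xi> \<bullet> m)) + \<epsilon> ^ 4 * ((\<xi> \<bullet> \<xi>) * (s\<^sup>2 + m \<bullet> m) - (\<xi> \<bullet> m)\<^sup>2)" for \<epsilon>
  proof -
    have 1: "(\<epsilon> *\<^sub>R (s *\<^sub>R w + m)) \<bullet> (\<epsilon> *\<^sub>R (s *\<^sub>R w + m)) = \<epsilon>\<^sup>2 * (s\<^sup>2 + m \<bullet> m)"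
      using wm by (simp add: inner_add_left inner_add_right inner_commute w power2_eq_square algebra_simps)
    have 2: "(w + \<epsilon> *\<^sub>R \<xi>) \<bullet> (\<epsilon> *\<^sub>R (s *\<^sub>R w + m)) = \<epsilon> * (s + \<epsilon> * (\<xi> \<bullet> m))"
      using wm \<xi>w by (simp add: inner_add_left inner_add_right inner_commute w algebra_simps)
    show ?thesis unfolding shadow_def WW 1 2 by (simp add: power2_eq_square power3_eq_cube power4_eq_xxxx algebra_simps)
  qed
  define b3 where "b3 = (\<Sum>i\<in>UNIV. \<eta> $ i * ((\<xi> \<bullet> \<xi>) * (\<omega> i)\<^sup>2 - (n i \<bullet> \<xi>)\<^sup>2)) + 2 * s * (\<xi> \<bullet> m)"
  define b4 where "b4 = - ((\<xi> \<bullet> \<xi>) * (s\<^sup>2 + m \<bullet> m) - (\<xi> \<bullet> m)\<^sup>2)"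
  have "excess c k (w + \<epsilon> *\<^sub>R \<xi>) (a + \<epsilon> *\<^sub>R \<eta>) =
     \<epsilon> * (- 2 * (\<Sum>i\<in>UNIV. a $ i * \<omega> i * (n i \<bullet> \<xi>)))
     + \<epsilon>\<^sup>2 * ((\<xi> \<bullet> \<xi>) * (\<Sum>i\<in>UNIV. a $ i * (\<omega> i)\<^sup>2) - 2 * (\<Sum>i\<in>UNIV. \<eta> $ i * \<omega> i * (n i \<bullet> \<xi>))
          - (\<Sum>i\<in>UNIV. a $ i * (n i \<bullet> \<xi>)\<^sup>2) - m \<bullet> m)
     + \<epsilon> ^ 3 * b3 + \<epsilon> ^ 4 * b4" for \<epsilon>
  proof -
    have sum1: "(\<Sum>i\<in>UNIV. (a + \<epsilon> *\<^sub>R \<eta>) $ i) = 1"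
      using a \<eta> by (simp add: sum.distrib sum_distrib_left[symmetric])
    have "(\<Sum>i\<in>UNIV. (a + \<epsilon> *\<^sub>R \<eta>) $ i * (shadow (w + \<epsilon> *\<^sub>R \<xi>) (c i - x) - k i * ((w + \<epsilon> *\<^sub>R \<xi>) \<bullet> (w + \<epsilon> *\<^sub>R \<xi>))))
      = (\<Sum>i\<in>UNIV. \<epsilon> * (- 2 * (a $ i * \<omega> i * (n i \<bullet> \<xi>)))
         + \<epsilon>\<^sup>2 * ((\<xi> \<bullet> \<xi>) * (a $ i * (\<omega> i)\<^sup>2) - 2 * (\<eta> $ i * \<omega> i * (n i \<bullet> \<xi>)) - a $ i * (n i \<bullet> \<xi>)\<^sup>2)
         + \<epsilon> ^ 3 * (\<eta> $ i * ((\<xi> \<bullet> \<xi>) * (\<omega> i)\<^sup>2 - (n i \<bullet> \<xi>)\<^sup>2)))"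
      unfolding summand by (rule sum.cong) (simp_all add: power2_eq_square power3_eq_cube algebra_simps)
    also have "\<dots> = \<epsilon> * (- 2 * (\<Sum>i\<in>UNIV. a $ i * \<omega> i * (n i \<bullet> \<xi>)))
         + \<epsilon>\<^sup>2 * ((\<xi> \<bullet> \<xi>) * (\<Sum>i\<in>UNIV. a $ i * (\<omega> i)\<^sup>2) - 2 * (\<Sum>i\<in>UNIV. \<eta> $ i * \<omega> i * (n i \<bullet> \<xi>)) - (\<Sum>i\<in>UNIV. a $ i * (n i \<bullet> \<xi>)\<^sup>2))
         + \<epsilon> ^ 3 * (\<Sum>i\<in>UNIV. \<eta> $ i * ((\<xi> \<bullet> \<xi>) * (\<omega> i)\<^sup>2 - (n i \<bullet> \<xi>)\<^sup>2))"
      by (simp only: sum.distrib sum_subtractf sum_distrib_left[symmetric])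
    finally show ?thesis
      unfolding excess_at_point[OF sum1, of c k _ x] g sg b3_def b4_def by (simp add: algebra_simps)
  qed
  then show ?thesis unfolding m_def[symmetric] by blast
qed

text \<open>A line locked between three disjoint balls cannot be turned both ways in the plane of \<open>w\<close> and \<open>\<xi>\<close>
within the directions of transversals.  If the first-order coefficient of the excess does not vanish,
one of the two senses of rotation makes the excess positive; otherwise \<open>second_order_gain\<close> provides a
motion of the weights that makes it positive in both.

The assumption \<open>cross\<close> says that the discs overlap pairwise.  It excludes that two of the normals are
opposite, in which case the three normals would not span a plane.\<close>

lemma tangent_direction_not_flat:
  fixes c :: "3 \<Rightarrow> 'a::real_inner" and r :: "3 \<Rightarrow> real"
  assumes w: "w \<bullet> w = 1" and \<xi>w: "w \<bullet> \<xi> = 0" and \<xi>: "\<xi> \<noteq> 0"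
    and a: "a \<in> weights" and a_pos: "\<And>i. a $ i > 0" and r: "\<And>i. r i > 0"
    and x: "x = (\<Sum>i\<in>UNIV. a $ i *\<^sub>R c i)"
    and tangent: "\<And>i. shadow w (c i - x) = (r i)\<^sup>2"
    and disj: "\<And>i j. i \<noteq> j \<Longrightarrow> r i + r j < dist (c i) (c j)"
    and cross: "\<And>i j. i \<noteq> j \<Longrightarrow> shadow w (c i - c j) < (r i + r j)\<^sup>2"
  shows "\<not> (\<forall>\<^sub>F \<epsilon> in at 0. \<forall>b\<in>weights. excess c (\<lambda>i. (r i)\<^sup>2) (w + \<epsilon> *\<^sub>R \<xi>) b \<le> 0)"
proof
  assume ev: "\<forall>\<^sub>F \<epsilon> in at 0. \<forall>b\<in>weights. excess c (\<lambda>i. (r i)\<^sup>2) (w + \<epsilon> *\<^sub>R \<xi>) b \<le> 0"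
  define \<omega> where "\<omega> i = w \<bullet> (c i - x)" for i
  define n where "n i = c i - x - \<omega> i *\<^sub>R w" for i
  have sum_a: "(\<Sum>i\<in>UNIV. a $ i) = 1" using a by (simp add: weights_def)
  have wn: "w \<bullet> n i = 0" for i by (simp add: n_def \<omega>_def inner_diff_right w)
  have cx: "c i - x = \<omega> i *\<^sub>R w + n i" for i by (simp add: n_def)
  have nn: "n i \<bullet> n i = (r i)\<^sup>2" for i
  proof -
    have "shadow w (\<omega> i *\<^sub>R w + n i) = n i \<bullet> n i"
      using wn[of i] by (simp add: shadow_def inner_add_left inner_add_right inner_commute w power2_eq_square)
    then show ?thesis using tangent[of i] unfolding cx by simp
  qed
  have cij: "c i - c j = (\<omega> i - \<omega> j) *\<^sub>R w + (n i - n j)" for i j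
    using cx[of i] cx[of j] by (simp add: algebra_simps)
  have nij: "(n i - n j) \<bullet> (n i - n j) = (r i)\<^sup>2 + (r j)\<^sup>2 - 2 * (n i \<bullet> n j)" for i j
    by (simp add: inner_diff_left inner_diff_right inner_commute nn)
  have wnij: "w \<bullet> (n i - n j) = 0" for i j by (simp add: inner_diff_right wn)
  have S: "r i * r j + n i \<bullet> n j > 0" if "i \<noteq> j" for i j
  proof -
    have "shadow w (c i - c j) = (n i - n j) \<bullet> (n i - n j)"
      unfolding cij using wnij[of i j] by (simp add: shadow_def inner_add_left inner_add_right inner_commute w power2_eq_square)
    then show ?thesis using cross[OF that] nij[of i j] by (simp add: power2_eq_square algebra_simps)
  qed
  have \<Omega>: "2 * (r i * r j + n i \<bullet> n j) < (\<omega> i - \<omega> j)\<^sup>2" if "i \<noteq> j" for i j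
  proof -
    have "(r i + r j)\<^sup>2 < (dist (c i) (c j))\<^sup>2"
      using disj[OF that] r[of i] r[of j] by (intro power_strict_mono) auto
    also have "\<dots> = (c i - c j) \<bullet> (c i - c j)" by (simp add: dist_norm power2_norm_eq_inner)
    also have "\<dots> = (\<omega> i - \<omega> j)\<^sup>2 + (n i - n j) \<bullet> (n i - n j)"
      unfolding cij using wnij[of i j] by (simp add: inner_add_left inner_add_right inner_commute w power2_eq_square)
    finally show ?thesis using nij[of i j] by (simp add: power2_eq_square algebra_simps)
  qed
  have centred: "(\<Sum>i\<in>UNIV. a $ i * \<omega> i) = 0"
  proof -
    have "(\<Sum>i\<in>UNIV. a $ i * \<omega> i) = w \<bullet> x - (\<Sum>i\<in>UNIV. a $ i) * (w \<bullet> x)"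
      by (simp add: \<omega>_def inner_diff_right right_diff_distrib sum_subtractf x inner_sum_right sum_distrib_right)
    then show ?thesis by (simp add: sum_a)
  qed
  have bal: "(\<Sum>i\<in>UNIV. a $ i *\<^sub>R n i) = 0"
  proof -
    have "(\<Sum>i\<in>UNIV. a $ i *\<^sub>R n i) = x - (\<Sum>i\<in>UNIV. a $ i) *\<^sub>R x - (\<Sum>i\<in>UNIV. a $ i * \<omega> i) *\<^sub>R w"
      by (simp add: n_def scaleR_diff_right sum_subtractf scaleR_sum_left x)
    then show ?thesis by (simp add: sum_a centred)
  qed
  have poly: False if \<eta>: "(\<Sum>i\<in>UNIV. \<eta> $ i) = 0" and
    bad: "(\<Sum>i\<in>UNIV. a $ i * \<omega> i * (n i \<bullet> \<xi>)) \<noteq> 0 \<or>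
      0 < (\<xi> \<bullet> \<xi>) * (\<Sum>i\<in>UNIV. a $ i * (\<omega> i)\<^sup>2) - 2 * (\<Sum>i\<in>UNIV. \<eta> $ i * \<omega> i * (n i \<bullet> \<xi>))
          - (\<Sum>i\<in>UNIV. a $ i * (n i \<bullet> \<xi>)\<^sup>2) - (\<Sum>i\<in>UNIV. \<eta> $ i *\<^sub>R n i) \<bullet> (\<Sum>i\<in>UNIV. \<eta> $ i *\<^sub>R n i)" for \<eta>
  proof -
    obtain b3 b4 where exp: "\<And>\<epsilon>. excess c (\<lambda>i. (r i)\<^sup>2) (w + \<epsilon> *\<^sub>R \<xi>) (a + \<epsilon> *\<^sub>R \<eta>) =
     \<epsilon> * (- 2 * (\<Sum>i\<in>UNIV. a $ i * \<omega> i * (n i \<bullet> \<xi>)))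
     + \<epsilon>\<^sup>2 * ((\<xi> \<bullet> \<xi>) * (\<Sum>i\<in>UNIV. a $ i * (\<omega> i)\<^sup>2) - 2 * (\<Sum>i\<in>UNIV. \<eta> $ i * \<omega> i * (n i \<bullet> \<xi>))
          - (\<Sum>i\<in>UNIV. a $ i * (n i \<bullet> \<xi>)\<^sup>2) - (\<Sum>i\<in>UNIV. \<eta> $ i *\<^sub>R n i) \<bullet> (\<Sum>i\<in>UNIV. \<eta> $ i *\<^sub>R n i))
     + \<epsilon> ^ 3 * b3 + \<epsilon> ^ 4 * b4"
      using excess_expansion[OF w \<xi>w sum_a \<eta> x \<omega>_def n_def tangent] by blast
    have "\<forall>\<^sub>F \<epsilon> in at 0. 0 \<le> a $ i + \<epsilon> * \<eta> $ i" for i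
    proof -
      have "((\<lambda>\<epsilon>. a $ i + \<epsilon> * \<eta> $ i) \<longlongrightarrow> a $ i) (at 0)" by (rule tendsto_eq_intros | simp)+
      from order_tendstoD(1)[OF this a_pos[of i]] show ?thesis by eventually_elim simp
    qed
    then have "\<forall>\<^sub>F \<epsilon> in at 0. \<forall>i. 0 \<le> a $ i + \<epsilon> * \<eta> $ i" by (rule eventually_all_finite)
    with ev have "\<forall>\<^sub>F \<epsilon> in at 0. excess c (\<lambda>i. (r i)\<^sup>2) (w + \<epsilon> *\<^sub>R \<xi>) (a + \<epsilon> *\<^sub>R \<eta>) \<le> 0"
    proof eventually_elim
      case (elim \<epsilon>)
      have "a + \<epsilon> *\<^sub>R \<eta> \<in> weights"
        using elim(2) sum_a \<eta> by (simp add: weights_def sum.distrib sum_distrib_left[symmetric])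
      with elim(1) show ?case by blast
    qed
    from quartic_nonpos_near_0[OF this[unfolded exp]] bad show False by simp
  qed
  have "(\<Sum>i\<in>UNIV. a $ i * \<omega> i * (n i \<bullet> \<xi>)) = 0" using poly[of 0] by auto
  then obtain \<eta>1 \<eta>2 \<eta>3 where \<eta>: "\<eta>1 + \<eta>2 + \<eta>3 = 0"
    "0 < (\<xi> \<bullet> \<xi>) * (a $ 1 * (\<omega> 1)\<^sup>2 + a $ 2 * (\<omega> 2)\<^sup>2 + a $ 3 * (\<omega> 3)\<^sup>2)
       - 2 * (\<eta>1 * \<omega> 1 * (n 1 \<bullet> \<xi>) + \<eta>2 * \<omega> 2 * (n 2 \<bullet> \<xi>) + \<eta>3 * \<omega> 3 * (n 3 \<bullet> \<xi>))
       - (a $ 1 * (n 1 \<bullet> \<xi>)\<^sup>2 + a $ 2 * (n 2 \<bullet> \<xi>)\<^sup>2 + a $ 3 * (n 3 \<bullet> \<xi>)\<^sup>2)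
       - (\<eta>1 *\<^sub>R n 1 + \<eta>2 *\<^sub>R n 2 + \<eta>3 *\<^sub>R n 3) \<bullet> (\<eta>1 *\<^sub>R n 1 + \<eta>2 *\<^sub>R n 2 + \<eta>3 *\<^sub>R n 3)"
    using second_order_gain[of "a $ 1" "a $ 2" "a $ 3" "n 1" "n 2" "n 3" "r 1" "r 2" "r 3" "\<omega> 2" "\<omega> 3" "\<omega> 1" \<xi>]
      a_pos r nn S \<Omega>[of 2 3] \<Omega>[of 1 3] \<Omega>[of 1 2] sum_a centred bal \<xi>
    by (auto simp: sum_3 power2_commute[of "\<omega> 3" "\<omega> 1"])
  show False
    by (rule poly[of "vector [\<eta>1, \<eta>2, \<eta>3]"]) (use \<eta> in \<open>simp_all add: sum_3 vector_3\<close>)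
qed

section \<open>Arcs of directions for three balls\<close>

text \<open>Since the weights sum to \<open>1\<close>, enlarging all squared radii by \<open>\<mu>\<close> lowers the excess by an amount that does
not depend on the weights; this is why the balls are enlarged in their squared radii and not in their radii.\<close>

lemma excess_inflate:
  assumes "a \<in> weights"
  shows "excess c (\<lambda>i. k i + \<mu>) w a = excess c k w a - \<mu> * (w \<bullet> w)"
proof -
  have "(\<Sum>i\<in>UNIV. a $ i * (shadow w (c i) - (k i + \<mu>) * (w \<bullet> w)))
     = (\<Sum>i\<in>UNIV. a $ i * (shadow w (c i) - k i * (w \<bullet> w)) - a $ i * (\<mu> * (w \<bullet> w)))"
    by (rule sum.cong) (simp_all add: algebra_simps)
  also have "\<dots> = (\<Sum>i\<in>UNIV. a $ i * (shadow w (c i) - k i * (w \<bullet> w))) - (\<Sum>i\<in>UNIV. a $ i) * (\<mu> * (w \<bullet> w))"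
    by (simp add: sum_subtractf sum_distrib_right)
  finally show ?thesis using assms by (simp add: excess_def weights_def)
qed

lemma shadow_unit: "w \<bullet> w = 1 \<Longrightarrow> shadow w y = (norm (y - (w \<bullet> y) *\<^sub>R w))\<^sup>2"
  unfolding power2_norm_eq_inner
  by (simp add: shadow_def inner_diff_left inner_diff_right inner_commute power2_eq_square)

lemma shadow_triangle:
  assumes w: "w \<bullet> w = 1" and "shadow w (x - p) \<le> r\<^sup>2" "shadow w (y - p) \<le> s\<^sup>2" "0 \<le> r" "0 \<le> s"
  shows "shadow w (x - y) \<le> (r + s)\<^sup>2"
proof -
  have 1: "norm ((x - p) - (w \<bullet> (x - p)) *\<^sub>R w) \<le> r" "norm ((y - p) - (w \<bullet> (y - p)) *\<^sub>R w) \<le> s"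
    using assms by (auto simp: shadow_unit intro: power2_le_imp_le)
  have e: "(x - y) - (w \<bullet> (x - y)) *\<^sub>R w
     = ((x - p) - (w \<bullet> (x - p)) *\<^sub>R w) - ((y - p) - (w \<bullet> (y - p)) *\<^sub>R w)"
    by (simp add: inner_diff_right algebra_simps)
  have "norm ((x - y) - (w \<bullet> (x - y)) *\<^sub>R w) \<le> r + s"
    unfolding e using 1 norm_triangle_ineq4[of "(x - p) - (w \<bullet> (x - p)) *\<^sub>R w" "(y - p) - (w \<bullet> (y - p)) *\<^sub>R w"] by linarith
  then show ?thesis unfolding shadow_unit[OF w] by (intro power_mono) auto
qed

text \<open>The largest relative excess on the arc from \<open>u\<close> to \<open>v\<close> cannot be a positive \<open>\<mu>\<close> so small that the balls of
squared radii \<open>(r i)\<^sup>2 + \<mu>\<close> are still disjoint.  At the direction \<open>W t\<close> and the weights \<open>a\<close> where it is attained,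
the enlarged balls have excess \<open>0\<close>, and nonpositive excess in all neighbouring directions of the arc.
All three weights are positive because any two balls have a transversal of direction \<open>W t\<close>; hence the
enlarged balls are tangent to one line, against \<open>tangent_direction_not_flat\<close>.\<close>

lemma no_small_positive_maximum:
  fixes c :: "3 \<Rightarrow> 'a::real_inner" and r :: "3 \<Rightarrow> real"
  assumes \<mu>: "\<mu> > 0" and r: "\<And>i. r i \<ge> 0"
    and disj: "\<And>i j. i \<noteq> j \<Longrightarrow> sqrt ((r i)\<^sup>2 + \<mu>) + sqrt ((r j)\<^sup>2 + \<mu>) < dist (c i) (c j)"
    and pairs: "\<And>\<tau> k. \<tau> \<in> {0..1} \<Longrightarrow> \<exists>p. \<forall>i. i \<noteq> k \<longrightarrow> shadow (W \<tau>) (c i - p) \<le> (r i)\<^sup>2 * (W \<tau> \<bullet> W \<tau>)"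
    and W: "\<And>\<tau>. W \<tau> = (1 - \<tau>) *\<^sub>R u + \<tau> *\<^sub>R v"
    and nz: "\<And>\<tau>. \<tau> \<in> {0..1} \<Longrightarrow> W \<tau> \<noteq> 0"
    and ends: "\<And>a. a \<in> weights \<Longrightarrow> excess c (\<lambda>i. (r i)\<^sup>2) u a \<le> 0" "\<And>a. a \<in> weights \<Longrightarrow> excess c (\<lambda>i. (r i)\<^sup>2) v a \<le> 0"
    and bound: "\<And>\<tau> a. \<tau> \<in> {0..1} \<Longrightarrow> a \<in> weights \<Longrightarrow> excess c (\<lambda>i. (r i)\<^sup>2) (W \<tau>) a \<le> \<mu> * (W \<tau> \<bullet> W \<tau>)"
    and t: "t \<in> {0..1}" and a: "a \<in> weights"
    and eq: "excess c (\<lambda>i. (r i)\<^sup>2) (W t) a = \<mu> * (W t \<bullet> W t)"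
  shows False
proof -
  define s where "s i = sqrt ((r i)\<^sup>2 + \<mu>)" for i
  have s2: "(s i)\<^sup>2 = (r i)\<^sup>2 + \<mu>" for i using \<mu> by (simp add: s_def)
  have s_pos: "s i > 0" for i using \<mu> by (simp add: s_def add_nonneg_pos)
  have s_gt: "r i < s i" for i using \<mu> r[of i] by (simp add: s_def real_less_rsqrt)
  have infl: "excess c (\<lambda>i. (s i)\<^sup>2) w b = excess c (\<lambda>i. (r i)\<^sup>2) w b - \<mu> * (w \<bullet> w)" if "b \<in> weights" for w b
    unfolding s2 by (rule excess_inflate[OF that])
  have W0: "W 0 = u" and W1: "W 1 = v" by (simp_all add: W)
  have Wpos: "W \<tau> \<bullet> W \<tau> > 0" if "\<tau> \<in> {0..1}" for \<tau> using nz[OF that] by simp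
  have t01: "0 < t" "t < 1"
  proof -
    have "t \<noteq> 0" using eq ends(1)[OF a] mult_pos_pos[OF \<mu> Wpos[of 0]] by (auto simp: W0)
    moreover have "t \<noteq> 1" using eq ends(2)[OF a] mult_pos_pos[OF \<mu> Wpos[of 1]] by (auto simp: W1)
    ultimately show "0 < t" "t < 1" using t by auto
  qed
  define N where "N = norm (W t)"
  define w where "w = W t /\<^sub>R N"
  have N: "N > 0" using nz[OF t] by (simp add: N_def)
  have Wt: "W t = N *\<^sub>R w" using N by (simp add: w_def)
  have w: "w \<bullet> w = 1" using N by (simp add: w_def N_def flip: power2_norm_eq_inner)
  have WtWt: "W t \<bullet> W t = N\<^sup>2" by (simp add: Wt w power2_eq_square)
  have shw: "shadow (W t) y = N\<^sup>2 * shadow w y" for y unfolding Wt by (rule shadow_scale)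
  have eq0: "excess c (\<lambda>i. (s i)\<^sup>2) w a = 0"
    using infl[OF a, of "W t"] eq N by (simp add: Wt excess_scale)
  have max: "excess c (\<lambda>i. (s i)\<^sup>2) w b \<le> excess c (\<lambda>i. (s i)\<^sup>2) w a" if "b \<in> weights" for b
  proof -
    have "N\<^sup>2 * excess c (\<lambda>i. (s i)\<^sup>2) w b \<le> 0"
      using infl[OF that, of "W t"] bound[OF t that] unfolding Wt excess_scale by linarith
    then show ?thesis using N eq0 by (simp add: mult_le_0_iff)
  qed
  have a_pos: "a $ k > 0" for k
  proof (rule ccontr)
    assume "\<not> a $ k > 0"
    obtain p where "\<And>i. i \<noteq> k \<Longrightarrow> shadow (W t) (c i - p) \<le> (r i)\<^sup>2 * (W t \<bullet> W t)"
      using pairs[OF t, of k] by blast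
    then have "excess c (\<lambda>i. (r i)\<^sup>2) (W t) a \<le> 0"
      using \<open>\<not> a $ k > 0\<close> by (intro excess_nonpos[OF a, of _ _ p]) metis
    then show False using eq Wpos[OF t] \<mu> by (simp add: mult_le_0_iff)
  qed
  define x where "x = (\<Sum>i\<in>UNIV. a $ i *\<^sub>R c i)"
  have tangent: "shadow w (c i - x) = (s i)\<^sup>2" for i
    using excess_maximiser(2)[OF a max a_pos[of i]] eq0 w by (simp add: x_def)
  have cross: "shadow w (c i - c j) < (s i + s j)\<^sup>2" if ij: "i \<noteq> j" for i j
  proof -
    have "card {i, j} < CARD(3)" by (simp add: card_insert_if)
    then have "{i, j} \<noteq> UNIV" by (metis less_irrefl)
    then obtain k where "k \<notin> {i, j}" by blast
    then have k: "i \<noteq> k" "j \<noteq> k" by auto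
    obtain p where "\<And>i. i \<noteq> k \<Longrightarrow> shadow (W t) (c i - p) \<le> (r i)\<^sup>2 * (W t \<bullet> W t)"
      using pairs[OF t, of k] by blast
    then have "shadow w (c i - p) \<le> (r i)\<^sup>2" "shadow w (c j - p) \<le> (r j)\<^sup>2"
      using k N by (simp_all add: shw WtWt mult.commute)
    then have "shadow w (c i - c j) \<le> (r i + r j)\<^sup>2" using r by (intro shadow_triangle[OF w])
    also have "\<dots> < (s i + s j)\<^sup>2" using s_gt[of i] s_gt[of j] r[of i] r[of j] by (intro power_strict_mono) auto
    finally show ?thesis .
  qed
  \<comment> \<open>Only the component \<open>\<xi>\<close> of \<open>v - u\<close> orthogonal to \<open>w\<close> turns the direction; near \<open>t\<close> the arc
    is a rescaling of \<open>w + \<epsilon> \<xi>\<close>.\<close>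
  define \<kappa> where "\<kappa> = w \<bullet> (v - u)"
  define \<xi> where "\<xi> = (v - u) - \<kappa> *\<^sub>R w"
  have w\<xi>: "w \<bullet> \<xi> = 0" by (simp add: \<xi>_def \<kappa>_def inner_diff_right w)
  have vu: "v - u = \<kappa> *\<^sub>R w + \<xi>" by (simp add: \<xi>_def)
  have Wt\<theta>: "W (t + \<theta>) = N *\<^sub>R w + \<theta> *\<^sub>R (\<kappa> *\<^sub>R w + \<xi>)" for \<theta>
    using Wt unfolding W vu[symmetric] by (simp add: algebra_simps)
  have \<xi>: "\<xi> \<noteq> 0"
  proof
    assume "\<xi> = 0"
    then have "u = (N - t * \<kappa>) *\<^sub>R w" using Wt\<theta>[of "- t"] by (simp add: W0 algebra_simps)
    then have "excess c (\<lambda>i. (s i)\<^sup>2) u a = 0" by (simp add: excess_scale eq0)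
    then have "\<mu> * (u \<bullet> u) \<le> 0" using infl[OF a, of u] ends(1)[OF a] by simp
    then show False using mult_pos_pos[OF \<mu> Wpos[of 0]] by (simp add: W0)
  qed
  have "\<forall>\<^sub>F \<epsilon> in at 0. \<forall>b\<in>weights. excess c (\<lambda>i. (s i)\<^sup>2) (w + \<epsilon> *\<^sub>R \<xi>) b \<le> 0"
  proof -
    have l1: "((\<lambda>\<epsilon>. 1 - \<epsilon> * \<kappa>) \<longlongrightarrow> 1) (at 0)" by (rule tendsto_eq_intros | simp)+
    have l2: "((\<lambda>\<epsilon>. t + \<epsilon> * N / (1 - \<epsilon> * \<kappa>)) \<longlongrightarrow> t) (at 0)" by (rule tendsto_eq_intros | simp)+
    have e1: "\<forall>\<^sub>F \<epsilon> in at 0. 0 < 1 - \<epsilon> * \<kappa>" by (rule order_tendstoD(1)[OF l1]) simp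
    have e2: "\<forall>\<^sub>F \<epsilon> in at 0. 0 < t + \<epsilon> * N / (1 - \<epsilon> * \<kappa>)" by (rule order_tendstoD(1)[OF l2 t01(1)])
    have e3: "\<forall>\<^sub>F \<epsilon> in at 0. t + \<epsilon> * N / (1 - \<epsilon> * \<kappa>) < 1" by (rule order_tendstoD(2)[OF l2 t01(2)])
    from e1 e2 e3 show ?thesis
    proof eventually_elim
      case (elim \<epsilon>)
      define \<theta> where "\<theta> = \<epsilon> * N / (1 - \<epsilon> * \<kappa>)"
      define f where "f = N / (1 - \<epsilon> * \<kappa>)"
      have f: "f > 0" using N elim by (simp add: f_def)
      have "N + \<theta> * \<kappa> = f" "\<theta> = f * \<epsilon>" using elim(1) by (simp_all add: \<theta>_def f_def field_simps)
      then have Wf: "W (t + \<theta>) = f *\<^sub>R (w + \<epsilon> *\<^sub>R \<xi>)"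
        unfolding Wt\<theta> by (simp add: scaleR_add_right flip: scaleR_add_left)
      show ?case
      proof
        fix b :: "real ^ 3" assume b: "b \<in> weights"
        have "t + \<theta> \<in> {0..1}" using elim by (simp add: \<theta>_def)
        from bound[OF this b] infl[OF b, of "W (t + \<theta>)"]
        have "f\<^sup>2 * excess c (\<lambda>i. (s i)\<^sup>2) (w + \<epsilon> *\<^sub>R \<xi>) b \<le> 0"
          unfolding Wf excess_scale by simp
        then show "excess c (\<lambda>i. (s i)\<^sup>2) (w + \<epsilon> *\<^sub>R \<xi>) b \<le> 0" using f by (simp add: mult_le_0_iff)
      qed
    qed
  qed
  moreover have "s i + s j < dist (c i) (c j)" if "i \<noteq> j" for i j using disj[OF that] by (simp add: s_def)
  ultimately show False
    using tangent_direction_not_flat[OF w w\<xi> \<xi> a a_pos s_pos x_def tangent _ cross] by blast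
qed

text \<open>For two convex bodies, the directions of lines from the first to the second are the differences of their
points, hence form a convex cone.\<close>

lemma pair_transversal:
  fixes w :: "'a::real_inner"
  assumes "A \<in> cball c r" "A' \<in> cball c r" "C \<in> cball d s" "C' \<in> cball d s"
    and w: "w = \<alpha> *\<^sub>R (C - A) + \<beta> *\<^sub>R (C' - A')" and ab: "0 \<le> \<alpha>" "0 \<le> \<beta>" "0 < \<alpha> + \<beta>" and wn: "w \<noteq> 0"
    and rs: "0 \<le> r" "0 \<le> s"
  shows "\<exists>p. shadow w (c - p) \<le> r\<^sup>2 * (w \<bullet> w) \<and> shadow w (d - p) \<le> s\<^sup>2 * (w \<bullet> w)"
proof -
  define \<rho> where "\<rho> = \<beta> / (\<alpha> + \<beta>)"
  have \<rho>: "0 \<le> \<rho>" "\<rho> \<le> 1" "1 - \<rho> = \<alpha> / (\<alpha> + \<beta>)" using ab by (auto simp: \<rho>_def field_simps)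
  define p where "p = (1 - \<rho>) *\<^sub>R A + \<rho> *\<^sub>R A'"
  have "p \<in> cball c r" unfolding p_def using assms \<rho> by (intro convexD_alt[OF convex_cball]) auto
  moreover have e: "p + (1 / (\<alpha> + \<beta>)) *\<^sub>R w = (1 - \<rho>) *\<^sub>R C + \<rho> *\<^sub>R C'"
    unfolding p_def w \<rho>(3) unfolding \<rho>_def by (simp add: algebra_simps)
  have "p + (1 / (\<alpha> + \<beta>)) *\<^sub>R w \<in> cball d s"
    unfolding e by (rule convexD_alt[OF convex_cball assms(3,4) \<rho>(1,2)])
  ultimately show ?thesis
    unfolding shadow_le_iff[OF wn rs(1)] shadow_le_iff[OF wn rs(2)]
    by (metis add.right_neutral scaleR_zero_left)
qed

text \<open>Points of the three balls in this order on a line, with the middle one at ratio \<open>t\<close>.\<close>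

definition chord :: "(3 \<Rightarrow> 'a::real_inner) \<Rightarrow> (3 \<Rightarrow> real) \<Rightarrow> (3 \<Rightarrow> 'a) \<Rightarrow> real \<Rightarrow> bool" where
  "chord c r M t \<longleftrightarrow> (\<forall>i. M i \<in> cball (c i) (r i)) \<and> 0 < t \<and> t < 1 \<and> M 2 = (1 - t) *\<^sub>R M 1 + t *\<^sub>R M 3"

lemma chord_arc_nonzero:
  assumes M: "chord c r M t" and M': "chord c r M' t'" and disj: "r 1 + r 3 < dist (c 1) (c 3)" and \<tau>: "\<tau> \<in> {0..1}"
  shows "(1 - \<tau>) *\<^sub>R (M 3 - M 1) + \<tau> *\<^sub>R (M' 3 - M' 1) \<noteq> 0"
proof
  assume eq: "(1 - \<tau>) *\<^sub>R (M 3 - M 1) + \<tau> *\<^sub>R (M' 3 - M' 1) = 0"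
  define A where "A = (1 - \<tau>) *\<^sub>R M 1 + \<tau> *\<^sub>R M' 1"
  define C where "C = (1 - \<tau>) *\<^sub>R M 3 + \<tau> *\<^sub>R M' 3"
  have "A \<in> cball (c 1) (r 1)" unfolding A_def using M M' \<tau>
    by (intro convexD_alt[OF convex_cball]) (auto simp: chord_def)
  moreover have "C \<in> cball (c 3) (r 3)" unfolding C_def using M M' \<tau>
    by (intro convexD_alt[OF convex_cball]) (auto simp: chord_def)
  moreover have "A = C" using eq by (simp add: A_def C_def algebra_simps)
  ultimately show False using disj dist_triangle2[of "c 1" "c 3" A] by (simp add: dist_commute)
qed

lemma chord_excess_nonpos:
  assumes M: "chord c r M t" and disj: "r 1 + r 3 < dist (c 1) (c 3)" and r: "\<And>i. 0 \<le> r i" and a: "a \<in> weights"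
  shows "excess c (\<lambda>i. (r i)\<^sup>2) (M 3 - M 1) a \<le> 0"
proof (rule excess_nonpos[OF a])
  have u: "M 3 - M 1 \<noteq> 0" using chord_arc_nonzero[OF M M disj, of 0] by simp
  fix i
  have "M 1 + 0 *\<^sub>R (M 3 - M 1) = M 1" "M 1 + t *\<^sub>R (M 3 - M 1) = M 2" "M 1 + 1 *\<^sub>R (M 3 - M 1) = M 3"
    using M by (auto simp: chord_def algebra_simps)
  then obtain s where "M 1 + s *\<^sub>R (M 3 - M 1) = M i" using exhaust_3[of i] by metis
  then have "\<exists>s. M 1 + s *\<^sub>R (M 3 - M 1) \<in> cball (c i) (r i)" using M unfolding chord_def by metis
  then show "shadow (M 3 - M 1) (c i - M 1) \<le> (r i)\<^sup>2 * ((M 3 - M 1) \<bullet> (M 3 - M 1))"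
    unfolding shadow_le_iff[OF u r] .
qed

lemma chord_arc_pairs:
  assumes M: "chord c r M t" and M': "chord c r M' t'" and disj: "r 1 + r 3 < dist (c 1) (c 3)"
    and r: "\<And>i. 0 \<le> r i" and \<tau>: "\<tau> \<in> {0..1}"
    and w: "w = (1 - \<tau>) *\<^sub>R (M 3 - M 1) + \<tau> *\<^sub>R (M' 3 - M' 1)"
  shows "\<exists>p. \<forall>i. i \<noteq> k \<longrightarrow> shadow w (c i - p) \<le> (r i)\<^sup>2 * (w \<bullet> w)"
proof -
  have wn: "w \<noteq> 0" unfolding w by (rule chord_arc_nonzero[OF M M' disj \<tau>])
  have B: "M i \<in> cball (c i) (r i)" "M' i \<in> cball (c i) (r i)" for i using M M' by (auto simp: chord_def)
  have t: "0 < t" "t < 1" "0 < t'" "t' < 1" and M2: "M 2 = (1 - t) *\<^sub>R M 1 + t *\<^sub>R M 3" "M' 2 = (1 - t') *\<^sub>R M' 1 + t' *\<^sub>R M' 3"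
    using M M' by (auto simp: chord_def)
  have pr: "\<exists>p. shadow w (c i - p) \<le> (r i)\<^sup>2 * (w \<bullet> w) \<and> shadow w (c j - p) \<le> (r j)\<^sup>2 * (w \<bullet> w)"
    if "M j - M i = x *\<^sub>R (M 3 - M 1)" "M' j - M' i = y *\<^sub>R (M' 3 - M' 1)" "x > 0" "y > 0" for i j x y
  proof (rule pair_transversal[OF B(1)[of i] B(2)[of i] B(1)[of j] B(2)[of j] _ _ _ _ wn r r])
    show "w = ((1 - \<tau>) / x) *\<^sub>R (M j - M i) + (\<tau> / y) *\<^sub>R (M' j - M' i)" using that by (simp add: w)
    show "0 \<le> (1 - \<tau>) / x" "0 \<le> \<tau> / y" using \<tau> that by auto
    show "0 < (1 - \<tau>) / x + \<tau> / y"
      using \<tau> that by (cases "\<tau> = 0") (auto intro!: add_nonneg_pos)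
  qed
  have "\<exists>p. shadow w (c 1 - p) \<le> (r 1)\<^sup>2 * (w \<bullet> w) \<and> shadow w (c 2 - p) \<le> (r 2)\<^sup>2 * (w \<bullet> w)"
    using t by (intro pr[of 2 1 t t']) (auto simp: M2 algebra_simps)
  moreover have "\<exists>p. shadow w (c 1 - p) \<le> (r 1)\<^sup>2 * (w \<bullet> w) \<and> shadow w (c 3 - p) \<le> (r 3)\<^sup>2 * (w \<bullet> w)"
    by (intro pr[of 3 1 1 1]) auto
  moreover have "\<exists>p. shadow w (c 2 - p) \<le> (r 2)\<^sup>2 * (w \<bullet> w) \<and> shadow w (c 3 - p) \<le> (r 3)\<^sup>2 * (w \<bullet> w)"
    using t by (intro pr[of 3 2 "1 - t" "1 - t'"]) (auto simp: M2 algebra_simps)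
  ultimately show ?thesis using exhaust_3[of k] by (auto simp: forall_3)
qed

text \<open>In the coordinates \<open>(t, (1 - t) M 1, t M 3)\<close> the condition on a chord becomes convex: \<open>M 1\<close> and \<open>M 3\<close> lie in
the balls iff the last two coordinates lie in the balls scaled by \<open>1 - t\<close> and \<open>t\<close>, and the middle point is
the sum of these coordinates.  The path is a segment in these coordinates.\<close>

lemma chord_path:
  assumes M: "chord c r M t" and M': "chord c r M' t'"
  obtains V :: "real \<Rightarrow> 'a::real_inner" where "continuous_on {0..1} V" "V 0 = M 3 - M 1" "V 1 = M' 3 - M' 1"
    "\<And>\<sigma>. \<sigma> \<in> {0..1} \<Longrightarrow> \<exists>L s. chord c r L s \<and> V \<sigma> = L 3 - L 1"
proof -
  have t: "0 < t" "t < 1" "0 < t'" "t' < 1" and M2: "M 2 = (1 - t) *\<^sub>R M 1 + t *\<^sub>R M 3" "M' 2 = (1 - t') *\<^sub>R M' 1 + t' *\<^sub>R M' 3"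
    using M M' by (auto simp: chord_def)
  have B: "M i \<in> cball (c i) (r i)" "M' i \<in> cball (c i) (r i)" for i using M M' by (auto simp: chord_def)
  define T where "T \<sigma> = (1 - \<sigma>) * t + \<sigma> * t'" for \<sigma>
  have T: "0 < T \<sigma>" "T \<sigma> < 1" if "\<sigma> \<in> {0..1}" for \<sigma>
  proof -
    have "T \<sigma> = t + \<sigma> *\<^sub>R (t' - t)" by (simp add: T_def algebra_simps)
    have "T \<sigma> \<in> closed_segment t t'" using that by (auto simp: T_def closed_segment_def intro!: exI[of _ \<sigma>])
    then show "0 < T \<sigma>" "T \<sigma> < 1" using t by (auto simp: closed_segment_eq_real_ivl split: if_splits)
  qed
  define A where "A \<sigma> = ((1 - \<sigma>) * (1 - t) / (1 - T \<sigma>)) *\<^sub>R M 1 + (\<sigma> * (1 - t') / (1 - T \<sigma>)) *\<^sub>R M' 1" for \<sigma>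
  define C where "C \<sigma> = ((1 - \<sigma>) * t / T \<sigma>) *\<^sub>R M 3 + (\<sigma> * t' / T \<sigma>) *\<^sub>R M' 3" for \<sigma>
  define D where "D \<sigma> = (1 - \<sigma>) *\<^sub>R M 2 + \<sigma> *\<^sub>R M' 2" for \<sigma>
  define V where "V \<sigma> = C \<sigma> - A \<sigma>" for \<sigma>
  show thesis
  proof (rule that[of V])
    show "continuous_on {0..1} V"
    proof -
      have "\<forall>\<sigma>\<in>{0..1}. T \<sigma> \<noteq> 0" "\<forall>\<sigma>\<in>{0..1}. 1 - T \<sigma> \<noteq> 0" using T by force+
      then show ?thesis unfolding V_def A_def C_def T_def by (intro continuous_intros) auto
    qed
    show "V 0 = M 3 - M 1" "V 1 = M' 3 - M' 1" using t by (simp_all add: V_def A_def C_def T_def)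
    fix \<sigma> :: real assume \<sigma>: "\<sigma> \<in> {0..1}"
    define L :: "3 \<Rightarrow> 'a" where "L i = (if i = 1 then A \<sigma> else if i = 2 then D \<sigma> else C \<sigma>)" for i
    have L: "L 1 = A \<sigma>" "L 2 = D \<sigma>" "L 3 = C \<sigma>" by (simp_all add: L_def)
    have s1: "(1 - \<sigma>) * (1 - t) / (1 - T \<sigma>) + \<sigma> * (1 - t') / (1 - T \<sigma>) = 1"
    proof -
      have "(1 - \<sigma>) * (1 - t) + \<sigma> * (1 - t') = 1 - T \<sigma>" by (simp add: T_def algebra_simps)
      then show ?thesis using T[OF \<sigma>] by (simp flip: add_divide_distrib)
    qed
    have s3: "(1 - \<sigma>) * t / T \<sigma> + \<sigma> * t' / T \<sigma> = 1"
    proof -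
      have "(1 - \<sigma>) * t + \<sigma> * t' = T \<sigma>" by (simp add: T_def)
      then show ?thesis using T[OF \<sigma>] by (simp flip: add_divide_distrib)
    qed
    have "A \<sigma> \<in> cball (c 1) (r 1)" unfolding A_def
      using B[of 1] \<sigma> t T[OF \<sigma>] by (intro convexD[OF convex_cball _ _ _ _ s1]) auto
    moreover have "C \<sigma> \<in> cball (c 3) (r 3)" unfolding C_def
      using B[of 3] \<sigma> t T[OF \<sigma>] by (intro convexD[OF convex_cball _ _ _ _ s3]) auto
    moreover have "D \<sigma> \<in> cball (c 2) (r 2)" unfolding D_def
      using B[of 2] \<sigma> by (intro convexD_alt[OF convex_cball]) auto
    moreover have "D \<sigma> = (1 - T \<sigma>) *\<^sub>R A \<sigma> + T \<sigma> *\<^sub>R C \<sigma>"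
    proof -
      have "(1 - T \<sigma>) *\<^sub>R A \<sigma> = ((1 - \<sigma>) * (1 - t)) *\<^sub>R M 1 + (\<sigma> * (1 - t')) *\<^sub>R M' 1"
        using T[OF \<sigma>] by (simp add: A_def scaleR_add_right)
      moreover have "T \<sigma> *\<^sub>R C \<sigma> = ((1 - \<sigma>) * t) *\<^sub>R M 3 + (\<sigma> * t') *\<^sub>R M' 3"
        using T[OF \<sigma>] by (simp add: C_def scaleR_add_right)
      ultimately show ?thesis by (simp add: D_def M2 algebra_simps)
    qed
    ultimately have "chord c r L (T \<sigma>)" using T[OF \<sigma>] by (auto simp: chord_def L forall_3)
    then show "\<exists>L s. chord c r L s \<and> V \<sigma> = L 3 - L 1" using L by (metis V_def)
  qed
qed

lemma slight_inflation_disjoint: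
  fixes c :: "'n::finite \<Rightarrow> 'a::metric_space" and r :: "'n \<Rightarrow> real"
  assumes r: "\<And>i. 0 \<le> r i" and disj: "\<And>i j. i \<noteq> j \<Longrightarrow> r i + r j < dist (c i) (c j)"
  obtains \<mu>0 where "\<mu>0 > 0" "\<And>\<mu> i j. 0 < \<mu> \<Longrightarrow> \<mu> < \<mu>0 \<Longrightarrow> i \<noteq> j \<Longrightarrow>
     sqrt ((r i)\<^sup>2 + \<mu>) + sqrt ((r j)\<^sup>2 + \<mu>) < dist (c i) (c j)"
proof -
  have "\<forall>\<^sub>F \<mu> in at_right 0. i \<noteq> j \<longrightarrow> sqrt ((r i)\<^sup>2 + \<mu>) + sqrt ((r j)\<^sup>2 + \<mu>) < dist (c i) (c j)" for i j
  proof (cases "i = j")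
    case False
    have "((\<lambda>\<mu>. sqrt ((r i)\<^sup>2 + \<mu>) + sqrt ((r j)\<^sup>2 + \<mu>)) \<longlongrightarrow> sqrt ((r i)\<^sup>2 + 0) + sqrt ((r j)\<^sup>2 + 0)) (at_right 0)"
      by (intro tendsto_intros)
    then show ?thesis using r disj[OF False] by (intro eventually_mono[OF order_tendstoD(2)]) auto
  qed simp
  then have "\<forall>\<^sub>F \<mu> in at_right 0. \<forall>i j. i \<noteq> j \<longrightarrow> sqrt ((r i)\<^sup>2 + \<mu>) + sqrt ((r j)\<^sup>2 + \<mu>) < dist (c i) (c j)"
    by (intro eventually_all_finite)
  then show thesis using that by (auto simp: eventually_at_right_field)
qed

text \<open>Along the path \<open>V\<close> from the first direction to the second, the unit interval is covered by two disjoint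
closed sets: \<open>A\<close>, where the whole arc from \<open>u\<close> to \<open>V \<sigma>\<close> has nonpositive excess, and \<open>B\<close>, where the
relative excess reaches \<open>\<mu>1\<close> somewhere on it.  They cover by \<open>no_small_positive_maximum\<close>, and \<open>0\<close> belongs
to \<open>A\<close>.\<close>

lemma three_ball_arc:
  fixes c :: "3 \<Rightarrow> 'a::euclidean_space" and r :: "3 \<Rightarrow> real"
  assumes r: "\<And>i. 0 \<le> r i" and disj: "\<And>i j. i \<noteq> j \<Longrightarrow> r i + r j < dist (c i) (c j)"
    and M: "chord c r M t" and M': "chord c r M' t'"
    and \<tau>: "\<tau> \<in> {0..1}" and a: "a \<in> weights"
  shows "excess c (\<lambda>i. (r i)\<^sup>2) ((1 - \<tau>) *\<^sub>R (M 3 - M 1) + \<tau> *\<^sub>R (M' 3 - M' 1)) a \<le> 0"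
proof -
  define u where "u = M 3 - M 1"
  define k where "k = (\<lambda>i. (r i)\<^sup>2)"
  have disj13: "r 1 + r 3 < dist (c 1) (c 3)" by (rule disj) simp
  obtain V :: "real \<Rightarrow> 'a" where V: "continuous_on {0..1} V" "V 0 = u" "V 1 = M' 3 - M' 1"
    "\<And>\<sigma>. \<sigma> \<in> {0..1} \<Longrightarrow> \<exists>L s. chord c r L s \<and> V \<sigma> = L 3 - L 1"
    using chord_path[OF M M', folded u_def] by metis
  define W where "W \<sigma> \<tau> = (1 - \<tau>) *\<^sub>R u + \<tau> *\<^sub>R V \<sigma>" for \<sigma> \<tau>
  have Wnz: "W \<sigma> \<tau> \<noteq> 0" if "\<sigma> \<in> {0..1}" "\<tau> \<in> {0..1}" for \<sigma> \<tau>
    using V(4)[OF that(1)] chord_arc_nonzero[OF M _ disj13 that(2)] by (auto simp: W_def u_def)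
  have Wpos: "W \<sigma> \<tau> \<bullet> W \<sigma> \<tau> > 0" if "\<sigma> \<in> {0..1}" "\<tau> \<in> {0..1}" for \<sigma> \<tau> using Wnz[OF that] by simp
  obtain \<mu>0 where \<mu>0: "\<mu>0 > 0" "\<And>\<mu> i j. 0 < \<mu> \<Longrightarrow> \<mu> < \<mu>0 \<Longrightarrow> i \<noteq> j \<Longrightarrow>
     sqrt ((r i)\<^sup>2 + \<mu>) + sqrt ((r j)\<^sup>2 + \<mu>) < dist (c i) (c j)"
    using slight_inflation_disjoint[of r c] r disj by blast
  define \<mu>1 where "\<mu>1 = \<mu>0 / 2"
  define Z where "Z = (weights :: (real ^ 3) set) \<times> {0..1::real}"
  have Z: "compact Z" "Z \<noteq> {}" using a by (auto simp: Z_def intro: compact_Times compact_weights)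
  define e where "e \<sigma> z = excess c k (W \<sigma> (snd z)) (fst z)" for \<sigma> z
  define q where "q \<sigma> z = W \<sigma> (snd z) \<bullet> W \<sigma> (snd z)" for \<sigma> and z :: "(real ^ 3) \<times> real"
  have qpos: "q \<sigma> z > 0" if "\<sigma> \<in> {0..1}" "z \<in> Z" for \<sigma> z using that Wpos by (auto simp: q_def Z_def)
  have contW: "continuous_on ({0..1} \<times> Z) (\<lambda>x. W (fst x) (snd (snd x)))"
    unfolding W_def by (intro continuous_intros continuous_on_compose2[OF V(1)]) auto
  have conte: "continuous_on ({0..1} \<times> Z) (\<lambda>x. e (fst x) (snd x))"
    unfolding e_def by (intro continuous_intros contW)
  have contq: "continuous_on ({0..1} \<times> Z) (\<lambda>x. q (fst x) (snd x))"
    unfolding q_def by (intro continuous_intros contW)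
  define A where "A = {\<sigma>\<in>{0..1}. \<forall>z\<in>Z. e \<sigma> z \<le> 0}"
  define B where "B = {\<sigma>\<in>{0..1}. \<exists>z\<in>Z. \<mu>1 * q \<sigma> z \<le> e \<sigma> z}"
  have "closed A"
  proof -
    have "A = (\<Inter>z\<in>Z. {\<sigma>\<in>{0..1}. e \<sigma> z \<le> 0})" using Z(2) by (auto simp: A_def)
    moreover have "closed {\<sigma>\<in>{0..1}. e \<sigma> z \<le> 0}" if "z \<in> Z" for z
    proof -
      have "continuous_on {0..1} (\<lambda>\<sigma>. e \<sigma> z)"
      proof -
        have "continuous_on {0..1} (\<lambda>\<sigma>. e (fst (\<sigma>, z)) (snd (\<sigma>, z)))"
          by (rule continuous_on_compose2[OF conte]) (use that in \<open>auto intro!: continuous_intros\<close>)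
        then show ?thesis by simp
      qed
      then show ?thesis by (intro continuous_on_closed_Collect_le continuous_intros) auto
    qed
    ultimately show ?thesis by auto
  qed
  moreover have "closed B"
  proof -
    define G where "G = {x \<in> {0..1} \<times> Z. \<mu>1 * q (fst x) (snd x) \<le> e (fst x) (snd x)}"
    have cl: "closed ({0..1::real} \<times> Z)" using Z(1) by (intro closed_Times compact_imp_closed) auto
    have "closed G" unfolding G_def
      by (intro continuous_on_closed_Collect_le continuous_intros contq conte cl)
    moreover have "compact ({0..1::real} \<times> Z)" using Z(1) by (intro compact_Times) auto
    moreover have "G = ({0..1} \<times> Z) \<inter> G" by (auto simp: G_def)
    ultimately have "compact G" by (metis compact_Int_closed)
    then have "compact (fst ` G)" by (intro compact_continuous_image continuous_intros)
    moreover have "fst ` G = B" by (force simp: G_def B_def)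
    ultimately show ?thesis by (simp add: compact_imp_closed)
  qed
  moreover have "{0..1} \<subseteq> A \<union> B"
  proof
    fix \<sigma> :: real assume \<sigma>: "\<sigma> \<in> {0..1}"
    obtain L s where L: "chord c r L s" "V \<sigma> = L 3 - L 1" using V(4)[OF \<sigma>] by blast
    have "continuous_on Z (\<lambda>z. e \<sigma> z / q \<sigma> z)"
    proof (intro continuous_on_divide)
      show "continuous_on Z (e \<sigma>)"
      proof -
        have "continuous_on Z (\<lambda>z. e (fst (\<sigma>, z)) (snd (\<sigma>, z)))"
          by (rule continuous_on_compose2[OF conte]) (use \<sigma> in \<open>auto intro!: continuous_intros\<close>)
        then show ?thesis by simp
      qed
      show "continuous_on Z (q \<sigma>)"
      proof -
        have "continuous_on Z (\<lambda>z. q (fst (\<sigma>, z)) (snd (\<sigma>, z)))"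
          by (rule continuous_on_compose2[OF contq]) (use \<sigma> in \<open>auto intro!: continuous_intros\<close>)
        then show ?thesis by simp
      qed
      show "\<forall>z\<in>Z. q \<sigma> z \<noteq> 0" using qpos[OF \<sigma>] by force
    qed
    then obtain z0 where z0: "z0 \<in> Z" "\<And>z. z \<in> Z \<Longrightarrow> e \<sigma> z / q \<sigma> z \<le> e \<sigma> z0 / q \<sigma> z0"
      using continuous_attains_sup[OF Z, of "\<lambda>z. e \<sigma> z / q \<sigma> z"] by auto
    define \<mu> where "\<mu> = e \<sigma> z0 / q \<sigma> z0"
    have le: "e \<sigma> z \<le> \<mu> * q \<sigma> z" if "z \<in> Z" for z
      using z0(2)[OF that] qpos[OF \<sigma> that] by (simp add: \<mu>_def[symmetric] field_simps)
    have eq: "e \<sigma> z0 = \<mu> * q \<sigma> z0" using qpos[OF \<sigma> z0(1)] by (simp add: \<mu>_def)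
    consider "\<mu> \<le> 0" | "0 < \<mu>" "\<mu> < \<mu>0" | "\<mu>0 \<le> \<mu>" by linarith
    then show "\<sigma> \<in> A \<union> B"
    proof cases
      case 1
      then have "e \<sigma> z \<le> 0" if "z \<in> Z" for z
        using le[OF that] qpos[OF \<sigma> that] by (meson mult_nonpos_nonneg order_less_imp_le order_trans)
      then show ?thesis using \<sigma> by (auto simp: A_def)
    next
      case 2
      have False
      proof (rule no_small_positive_maximum[of \<mu> r c "W \<sigma>" u "V \<sigma>" "snd z0" "fst z0"])
        show "excess c (\<lambda>i. (r i)\<^sup>2) u b \<le> 0" if "b \<in> weights" for b
          unfolding u_def by (rule chord_excess_nonpos[OF M disj13 r that])
        show "excess c (\<lambda>i. (r i)\<^sup>2) (V \<sigma>) b \<le> 0" if "b \<in> weights" for b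
          unfolding L(2) by (rule chord_excess_nonpos[OF L(1) disj13 r that])
        show "\<exists>p. \<forall>i. i \<noteq> j \<longrightarrow> shadow (W \<sigma> \<tau>) (c i - p) \<le> (r i)\<^sup>2 * (W \<sigma> \<tau> \<bullet> W \<sigma> \<tau>)"
          if "\<tau> \<in> {0..1}" for \<tau> j
          by (rule chord_arc_pairs[OF M L(1) disj13 r that]) (simp add: W_def u_def L(2))
        show "excess c (\<lambda>i. (r i)\<^sup>2) (W \<sigma> \<tau>) b \<le> \<mu> * (W \<sigma> \<tau> \<bullet> W \<sigma> \<tau>)"
          if "\<tau> \<in> {0..1}" "b \<in> weights" for \<tau> b
          using le[of "(b, \<tau>)"] that by (simp add: Z_def e_def q_def k_def)
        show "excess c (\<lambda>i. (r i)\<^sup>2) (W \<sigma> (snd z0)) (fst z0) = \<mu> * (W \<sigma> (snd z0) \<bullet> W \<sigma> (snd z0))"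
          using eq by (simp add: e_def q_def k_def)
        show "snd z0 \<in> {0..1}" "fst z0 \<in> weights" using z0(1) by (auto simp: Z_def)
      qed (use 2 r \<mu>0(2) Wnz[OF \<sigma>] W_def in auto)
      then show ?thesis ..
    next
      case 3
      have "\<mu>1 * q \<sigma> z0 \<le> e \<sigma> z0"
        unfolding eq using 3 \<mu>0(1) qpos[OF \<sigma> z0(1)] by (simp add: \<mu>1_def)
      then show ?thesis using \<sigma> z0(1) by (auto simp: B_def)
    qed
  qed
  moreover have "A \<inter> B \<inter> {0..1} = {}"
  proof -
    have False if "\<sigma> \<in> {0..1}" "z \<in> Z" "e \<sigma> z \<le> 0" "\<mu>1 * q \<sigma> z \<le> e \<sigma> z" for \<sigma> z
    proof -
      have "0 < \<mu>1 * q \<sigma> z" using qpos[OF that(1,2)] \<mu>0(1) by (simp add: \<mu>1_def)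
      then show False using that by linarith
    qed
    then show ?thesis by (auto simp: A_def B_def)
  qed
  moreover have "A \<inter> {0..1} \<noteq> {}"
  proof -
    have "e 0 z \<le> 0" if "z \<in> Z" for z
    proof -
      have "W 0 (snd z) = u" by (simp add: W_def V(2) algebra_simps)
      then show ?thesis using chord_excess_nonpos[OF M disj13 r, of "fst z"] that
        by (auto simp: e_def k_def u_def Z_def)
    qed
    then show ?thesis by (auto simp: A_def intro!: exI[of _ 0])
  qed
  ultimately have "B \<inter> {0..1} = {}"
    using connected_Icc[of 0 "1::real", unfolded connected_closed] by meson
  moreover have "(1::real) \<in> {0..1}" by simp
  ultimately have "1 \<in> A" using \<open>{0..1} \<subseteq> A \<union> B\<close> by blast
  then have "e 1 (a, \<tau>) \<le> 0" using a \<tau> by (simp add: A_def Z_def)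
  then show ?thesis by (simp add: e_def k_def W_def V(3) u_def)
qed

section \<open>Convexity of the set of directions\<close>

lemma transversal_of_excess_nonpos:
  fixes c :: "'n::finite \<Rightarrow> 'a::real_inner"
  assumes "\<And>a. a \<in> weights \<Longrightarrow> excess c k w a \<le> 0"
  obtains a where "a \<in> weights" "\<And>i. shadow w (c i - (\<Sum>j\<in>UNIV. a $ j *\<^sub>R c j)) \<le> k i * (w \<bullet> w)"
proof -
  have "axis undefined 1 \<in> (weights :: (real ^ 'n) set)" by (simp add: weights_def axis_def)
  then have "weights \<noteq> ({} :: (real ^ 'n) set)" by blast
  then obtain a where a: "a \<in> weights" "\<And>b. b \<in> weights \<Longrightarrow> excess c k w b \<le> excess c k w a"
    using continuous_attains_sup[OF compact_weights _ continuous_on_excess[OF continuous_on_const continuous_on_id], of c k w]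
    by auto
  show thesis
    using that[OF a(1)] excess_maximiser(1)[OF a] assms[OF a(1)] by (smt (verit))
qed

text \<open>Helly's theorem for a family in which sets may repeat.\<close>

lemma Helly_indexed:
  fixes E :: "'i \<Rightarrow> 'a::euclidean_space set"
  assumes fin: "finite I" and card: "DIM('a) + 1 \<le> card I" and conv: "\<And>i. i \<in> I \<Longrightarrow> convex (E i)"
    and meet: "\<And>T. T \<subseteq> I \<Longrightarrow> card T = DIM('a) + 1 \<Longrightarrow> \<Inter>(E ` T) \<noteq> {}"
  shows "\<Inter>(E ` I) \<noteq> {}"
proof (cases "DIM('a) + 1 \<le> card (E ` I)")
  case True
  then show ?thesis
  proof (rule Helly)
    show "\<forall>s\<in>E ` I. convex s" using conv by auto
    fix t assume t: "t \<subseteq> E ` I" "card t = DIM('a) + 1"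
    then obtain T where "T \<subseteq> I" "inj_on E T" "t = E ` T" by (auto simp: subset_image_inj)
    then show "\<Inter>t \<noteq> {}" using t(2) meet[of T] by (simp add: card_image)
  qed
next
  case False
  obtain T0 where T0: "T0 \<subseteq> I" "inj_on E T0" "E ` I = E ` T0"
    using subset_image_inj[of "E ` I" E I] by auto
  then have "card T0 \<le> DIM('a) + 1" using False by (simp add: card_image)
  then obtain T where T: "T0 \<subseteq> T" "T \<subseteq> I" "card T = DIM('a) + 1"
    using exists_subset_between[OF _ card T0(1) fin] by blast
  then have "E ` I = E ` T" using T0(3) by blast
  then show ?thesis using meet[OF T(2,3)] by simp
qed

lemma foot_of_perpendicular:
  fixes w :: "'a::real_inner"
  assumes "w \<noteq> 0" "0 \<le> r" "shadow w (c - p) \<le> r\<^sup>2 * (w \<bullet> w)"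
  shows "p + (w \<bullet> (c - p) / (w \<bullet> w)) *\<^sub>R w \<in> cball c r"
proof -
  define d where "d = c - (p + (w \<bullet> (c - p) / (w \<bullet> w)) *\<^sub>R w)"
  have ww: "w \<bullet> w > 0" using assms by simp
  have "w \<bullet> d = 0" using ww by (simp add: d_def inner_diff_right inner_add_right)
  moreover have "shadow w (c - p) = shadow w d"
    using shadow_shift[of w d "w \<bullet> (c - p) / (w \<bullet> w)"] by (simp add: d_def)
  ultimately have "(w \<bullet> w) * (d \<bullet> d) \<le> (w \<bullet> w) * r\<^sup>2" using assms(3) by (simp add: shadow_def mult.commute)
  then have "d \<bullet> d \<le> r\<^sup>2" using ww by simp
  then show ?thesis using assms(2) by (simp add: dist_norm norm_le_square d_def)
qed

lemma convex_line_meets_cball: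
  fixes w :: "'a::real_inner"
  assumes w: "w \<noteq> 0" and r: "0 \<le> r"
  shows "convex {p. shadow w (c - p) \<le> r\<^sup>2 * (w \<bullet> w)}"
proof (rule convexI)
  fix p q and x y :: real
  assume pq: "p \<in> {p. shadow w (c - p) \<le> r\<^sup>2 * (w \<bullet> w)}" "q \<in> {p. shadow w (c - p) \<le> r\<^sup>2 * (w \<bullet> w)}"
    and xy: "0 \<le> x" "0 \<le> y" "x + y = 1"
  from pq obtain s t where "p + s *\<^sub>R w \<in> cball c r" "q + t *\<^sub>R w \<in> cball c r"
    unfolding mem_Collect_eq shadow_le_iff[OF w r] by blast
  from convexD[OF convex_cball this xy]
  have "x *\<^sub>R p + y *\<^sub>R q + (x * s + y * t) *\<^sub>R w \<in> cball c r"
    by (simp add: scaleR_add_right scaleR_add_left ac_simps)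
  then show "x *\<^sub>R p + y *\<^sub>R q \<in> {p. shadow w (c - p) \<le> r\<^sup>2 * (w \<bullet> w)}"
    unfolding mem_Collect_eq shadow_le_iff[OF w r] by blast
qed

text \<open>Between disjoint balls, the order along a line of direction \<open>v\<close> is the order of the projections of the
centres, which makes it a condition that is linear in \<open>v\<close>.\<close>

definition ordered_transversal :: "nat \<Rightarrow> (nat \<Rightarrow> 'a::real_inner) \<Rightarrow> (nat \<Rightarrow> real) \<Rightarrow> 'a \<Rightarrow> 'a \<Rightarrow> bool" where
  "ordered_transversal n c r p v \<longleftrightarrow>
     (\<forall>i<n. shadow v (c i - p) \<le> (r i)\<^sup>2 * (v \<bullet> v)) \<and> (\<forall>i j. i < j \<longrightarrow> j < n \<longrightarrow> 0 < v \<bullet> (c j - c i))"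

lemma ordered_transversal_scale:
  assumes "ordered_transversal n c r p v" "s > 0"
  shows "ordered_transversal n c r p (s *\<^sub>R v)"
  using assms by (auto simp: ordered_transversal_def shadow_scale power2_eq_square mult.assoc)

lemma sliced_triple_transversal:
  fixes c :: "3 \<Rightarrow> 'a::euclidean_space"
  assumes \<rho>: "\<And>i. 0 \<le> \<rho> i" and disj: "\<And>i j. i \<noteq> j \<Longrightarrow> \<rho> i + \<rho> j < dist (c i) (c j)"
    and on_u: "\<And>i. p + s i *\<^sub>R u \<in> cball (c i) (\<rho> i)" and s: "s 1 < s 2" "s 2 < s 3"
    and on_v: "\<And>i. q + t i *\<^sub>R v \<in> cball (c i) (\<rho> i)" and t: "t 1 < t 2" "t 2 < t 3"
    and \<alpha>\<beta>: "0 < \<alpha>" "0 < \<beta>"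
  shows "\<exists>a\<in>weights. \<forall>i. shadow (\<alpha> *\<^sub>R u + \<beta> *\<^sub>R v) (c i - (\<Sum>j\<in>UNIV. a $ j *\<^sub>R c j)) \<le> (\<rho> i)\<^sup>2 * ((\<alpha> *\<^sub>R u + \<beta> *\<^sub>R v) \<bullet> (\<alpha> *\<^sub>R u + \<beta> *\<^sub>R v))"
proof -
  have chords: "chord c \<rho> (\<lambda>i. p + s i *\<^sub>R u) ((s 2 - s 1) / (s 3 - s 1))"
    if "\<And>i. p + s i *\<^sub>R u \<in> cball (c i) (\<rho> i)" "s 1 < s 2" "s 2 < s 3" for p u and s :: "3 \<Rightarrow> real"
  proof -
    define t where "t = (s 2 - s 1) / (s 3 - s 1)"
    have s2: "s 2 = s 1 + t * (s 3 - s 1)" using that by (simp add: t_def)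
    have "p + s 2 *\<^sub>R u = (1 - t) *\<^sub>R (p + s 1 *\<^sub>R u) + t *\<^sub>R (p + s 3 *\<^sub>R u)"
      unfolding s2 by (simp add: algebra_simps)
    moreover have "0 < t" "t < 1" using that by (auto simp: t_def)
    ultimately show ?thesis using that(1) by (simp add: chord_def t_def)
  qed
  define x where "x = \<alpha> / (s 3 - s 1)"
  define y where "y = \<beta> / (t 3 - t 1)"
  have xy: "0 < x" "0 < y" using s t \<alpha>\<beta> by (auto simp: x_def y_def)
  define \<tau> where "\<tau> = y / (x + y)"
  have \<tau>: "\<tau> \<in> {0..1}" "(x + y) * (1 - \<tau>) = x" "(x + y) * \<tau> = y" using xy by (auto simp: \<tau>_def field_simps)
  define W0 where "W0 = (1 - \<tau>) *\<^sub>R ((p + s 3 *\<^sub>R u) - (p + s 1 *\<^sub>R u)) + \<tau> *\<^sub>R ((q + t 3 *\<^sub>R v) - (q + t 1 *\<^sub>R v))"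
  have "(x + y) *\<^sub>R W0 = x *\<^sub>R ((s 3 - s 1) *\<^sub>R u) + y *\<^sub>R ((t 3 - t 1) *\<^sub>R v)"
    unfolding W0_def scaleR_add_right scaleR_scaleR \<tau>(2,3) by (simp add: algebra_simps)
  also have "\<dots> = \<alpha> *\<^sub>R u + \<beta> *\<^sub>R v" using s t by (simp add: x_def y_def)
  finally have W: "\<alpha> *\<^sub>R u + \<beta> *\<^sub>R v = (x + y) *\<^sub>R W0" ..
  have nonpos: "excess c (\<lambda>i. (\<rho> i)\<^sup>2) (\<alpha> *\<^sub>R u + \<beta> *\<^sub>R v) a \<le> 0" if "a \<in> weights" for a
    using three_ball_arc[OF \<rho> disj chords[OF on_u s] chords[OF on_v t] \<tau>(1) that]
    unfolding W excess_scale W0_def by (simp add: mult_nonneg_nonpos)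
  show ?thesis by (rule transversal_of_excess_nonpos[OF nonpos]) blast+
qed

lemma three_element_nat_set:
  assumes "card (T :: nat set) = 3"
  obtains i j k where "T = {i, j, k}" "i < j" "j < k"
proof -
  obtain x y z where T: "T = {x, y, z}" "x \<noteq> y" "x \<noteq> z" "y \<noteq> z" using assms by (auto simp: card_3_iff)
  consider "x < y \<and> y < z" | "x < z \<and> z < y" | "y < x \<and> x < z" | "y < z \<and> z < x" | "z < x \<and> x < y" | "z < y \<and> y < x"
    using T by linarith
  then show thesis by cases (use T that in \<open>metis insert_commute\<close>)+
qed

text \<open>Two disjoint balls with centres \<open>h + o1\<close> and \<open>h' + o2\<close> are cut by a subspace through \<open>h\<close> and \<open>h'\<close> that is
orthogonal to \<open>o1\<close> and \<open>o2\<close>.  The balls of radii \<open>\<rho>\<close> and \<open>\<rho>'\<close> cut out of it are disjoint, because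
\<open>\<rho> \<rho>' + |o1| |o2| \<le> r r'\<close> by the Cauchy--Schwarz inequality in the plane.\<close>

lemma slice_disjoint:
  fixes h h' o1 o2 :: "'a::real_inner"
  assumes orth: "(h - h') \<bullet> (o1 - o2) = 0" and gt: "r + r' < norm ((h - h') + (o1 - o2))"
    and \<rho>: "0 \<le> \<rho>" "0 \<le> \<rho>'" "\<rho>\<^sup>2 + (norm o1)\<^sup>2 = r\<^sup>2" "\<rho>'\<^sup>2 + (norm o2)\<^sup>2 = r'\<^sup>2" and r: "0 \<le> r" "0 \<le> r'"
  shows "\<rho> + \<rho>' < norm (h - h')"
proof -
  have "(\<rho> * \<rho>' + norm o1 * norm o2)\<^sup>2 + (\<rho> * norm o2 - norm o1 * \<rho>')\<^sup>2 = (r * r')\<^sup>2"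
    unfolding power_mult_distrib \<rho>(3,4)[symmetric] by (simp add: power2_eq_square algebra_simps)
  then have "(\<rho> * \<rho>' + norm o1 * norm o2)\<^sup>2 \<le> (r * r')\<^sup>2" using zero_le_power2[of "\<rho> * norm o2 - norm o1 * \<rho>'"] by linarith
  then have cs: "\<rho> * \<rho>' + norm o1 * norm o2 \<le> r * r'" using r by (auto intro: power2_le_imp_le)
  have "(r + r')\<^sup>2 < (norm ((h - h') + (o1 - o2)))\<^sup>2" using gt r by (intro power_strict_mono) auto
  also have "\<dots> = (norm (h - h'))\<^sup>2 + (norm (o1 - o2))\<^sup>2"
    using orth by (simp add: power2_norm_eq_inner inner_add_left inner_add_right inner_commute)
  also have "(norm (o1 - o2))\<^sup>2 \<le> (norm o1 + norm o2)\<^sup>2" by (intro power_mono norm_triangle_ineq4) auto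
  finally have "(r + r')\<^sup>2 < (norm (h - h'))\<^sup>2 + (norm o1 + norm o2)\<^sup>2" by simp
  then have "(\<rho> + \<rho>')\<^sup>2 < (norm (h - h'))\<^sup>2" using cs \<rho>(3,4) by (simp add: power2_sum)
  then show ?thesis by (rule power2_less_imp_less) simp
qed

text \<open>For at least three balls, the argument takes place in the affine span \<open>p + U\<close> of the two given lines.  The
lines of direction \<open>W\<close> in it are parametrised by the plane: the pair \<open>(x, y)\<close> stands for the one through
\<open>p + x (q - p) + y u\<close>.  For each ball the parameters of the lines that meet it form a convex set \<open>E i\<close>, and
Helly's theorem applies.  Any three of these sets meet by \<open>sliced_triple_transversal\<close>, whose line passes
through a weighted mean of centres of sliced balls and so stays inside \<open>p + U\<close>.\<close>

theorem ordered_transversal_directions_convex: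
  fixes c :: "nat \<Rightarrow> 'a::euclidean_space"
  assumes n: "2 \<le> n" and r: "\<And>i. i < n \<Longrightarrow> 0 \<le> r i"
    and disj: "\<And>i j. i < n \<Longrightarrow> j < n \<Longrightarrow> i \<noteq> j \<Longrightarrow> r i + r j < dist (c i) (c j)"
    and u: "ordered_transversal n c r p u" and v: "ordered_transversal n c r q v"
    and \<alpha>\<beta>: "0 \<le> \<alpha>" "0 \<le> \<beta>" "0 < \<alpha> + \<beta>"
  shows "\<exists>x. ordered_transversal n c r x (\<alpha> *\<^sub>R u + \<beta> *\<^sub>R v)"
proof -
  consider "\<alpha> = 0" "0 < \<beta>" | "\<beta> = 0" "0 < \<alpha>" | "0 < \<alpha>" "0 < \<beta>" using \<alpha>\<beta> by linarith
  then show ?thesis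
  proof cases
    case 1
    then show ?thesis using ordered_transversal_scale[OF v] by auto
  next
    case 2
    then show ?thesis using ordered_transversal_scale[OF u] by auto
  next
    case 3
    define W where "W = \<alpha> *\<^sub>R u + \<beta> *\<^sub>R v"
    have ord: "0 < u \<bullet> (c j - c i)" "0 < v \<bullet> (c j - c i)" if "i < j" "j < n" for i j
      using u v that by (auto simp: ordered_transversal_def)
    then have ordW: "0 < W \<bullet> (c j - c i)" if "i < j" "j < n" for i j
      using that 3 by (simp add: W_def inner_add_left add_pos_pos)
    have "u \<noteq> 0" "v \<noteq> 0" "W \<noteq> 0" using ord[of 0 1] ordW[of 0 1] n by auto
    note nz = this
    define s where "s i = u \<bullet> (c i - p) / (u \<bullet> u)" for i
    define t where "t i = v \<bullet> (c i - q) / (v \<bullet> v)" for i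
    have P: "p + s i *\<^sub>R u \<in> cball (c i) (r i)" if "i < n" for i
      unfolding s_def using u r that nz by (intro foot_of_perpendicular) (auto simp: ordered_transversal_def)
    have Q: "q + t i *\<^sub>R v \<in> cball (c i) (r i)" if "i < n" for i
      unfolding t_def using v r that nz by (intro foot_of_perpendicular) (auto simp: ordered_transversal_def)
    have s_mono: "s i < s j" and t_mono: "t i < t j" if "i < j" "j < n" for i j
      using ord[OF that] nz by (simp_all add: s_def t_def divide_strict_right_mono inner_diff_right)
    have "\<exists>x. \<forall>i<n. shadow W (c i - x) \<le> (r i)\<^sup>2 * (W \<bullet> W)"
    proof (cases "n = 2")
      case True
      have st: "0 < s 1 - s 0" "0 < t 1 - t 0" using s_mono[of 0 1] t_mono[of 0 1] True by auto
      have "\<exists>x. shadow W (c 0 - x) \<le> (r 0)\<^sup>2 * (W \<bullet> W) \<and> shadow W (c 1 - x) \<le> (r 1)\<^sup>2 * (W \<bullet> W)"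
      proof (rule pair_transversal)
        show "W = (\<alpha> / (s 1 - s 0)) *\<^sub>R ((p + s 1 *\<^sub>R u) - (p + s 0 *\<^sub>R u)) + (\<beta> / (t 1 - t 0)) *\<^sub>R ((q + t 1 *\<^sub>R v) - (q + t 0 *\<^sub>R v))"
          using st by (simp add: W_def flip: scaleR_diff_left)
        show "0 \<le> \<alpha> / (s 1 - s 0)" "0 \<le> \<beta> / (t 1 - t 0)" "0 < \<alpha> / (s 1 - s 0) + \<beta> / (t 1 - t 0)"
          using st 3 by (auto intro!: add_pos_pos)
      qed (use P Q True r nz in auto)
      then show ?thesis using True by (auto simp: less_2_cases_iff)
    next
      case False
      define U where "U = span {q - p, u, v}"
      have Uin: "q - p \<in> U" "u \<in> U" "v \<in> U" unfolding U_def by (auto intro: span_base)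
      have "\<exists>h o'. h \<in> U \<and> (\<forall>y\<in>U. orthogonal o' y) \<and> c i - p = h + o'" for i
        unfolding U_def by (metis orthogonal_subspace_decomp_exists)
      then obtain h o' where h: "\<And>i. h i \<in> U" and o': "\<And>i y. y \<in> U \<Longrightarrow> o' i \<bullet> y = 0"
        and cho: "\<And>i. c i - p = h i + o' i"
        unfolding orthogonal_def by metis
      have subU: "subspace U" by (simp add: U_def)
      have pyth: "(norm (c i - (p + y)))\<^sup>2 = (norm (h i - y))\<^sup>2 + (norm (o' i))\<^sup>2" if "y \<in> U" for i y
      proof -
        have e: "c i - (p + y) = (h i - y) + o' i" using cho[of i] by (simp add: algebra_simps)
        have "o' i \<bullet> (h i - y) = 0" using o' subspace_diff[OF subU h that] by blast
        then show ?thesis unfolding e by (simp add: power2_norm_eq_inner inner_add_left inner_add_right inner_commute)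
      qed
      define c' where "c' i = p + h i" for i
      define \<rho> where "\<rho> i = sqrt ((r i)\<^sup>2 - (norm (o' i))\<^sup>2)" for i
      have PU: "s i *\<^sub>R u \<in> U" "(q - p) + t i *\<^sub>R v \<in> U" for i
        using Uin subU by (auto intro: subspace_add subspace_scale)
      have le: "(norm (o' i))\<^sup>2 \<le> (r i)\<^sup>2" if "i < n" for i
      proof -
        have "norm (c i - (p + s i *\<^sub>R u)) \<le> r i" using P[OF that] by (simp add: dist_norm)
        then have "(norm (c i - (p + s i *\<^sub>R u)))\<^sup>2 \<le> (r i)\<^sup>2" by (intro power_mono) auto
        then show ?thesis unfolding pyth[OF PU(1)] using zero_le_power2[of "norm (h i - s i *\<^sub>R u)"] by linarith
      qed
      have \<rho>2: "(\<rho> i)\<^sup>2 + (norm (o' i))\<^sup>2 = (r i)\<^sup>2" and \<rho>0: "0 \<le> \<rho> i" if "i < n" for i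
        using le[OF that] by (auto simp: \<rho>_def)
      have slice: "p + y \<in> cball (c' i) (\<rho> i) \<longleftrightarrow> p + y \<in> cball (c i) (r i)" if "i < n" "y \<in> U" for i y
      proof -
        have "p + y \<in> cball (c i) (r i) \<longleftrightarrow> (norm (c i - (p + y)))\<^sup>2 \<le> (r i)\<^sup>2"
          using r[OF that(1)] by (simp add: dist_norm abs_le_square_iff[symmetric])
        also have "\<dots> \<longleftrightarrow> (norm (h i - y))\<^sup>2 \<le> (\<rho> i)\<^sup>2" unfolding pyth[OF that(2)] \<rho>2[OF that(1), symmetric] by simp
        also have "\<dots> \<longleftrightarrow> p + y \<in> cball (c' i) (\<rho> i)"
          using \<rho>0[OF that(1)] by (simp add: dist_norm c'_def abs_le_square_iff[symmetric])
        finally show ?thesis ..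
      qed
      have P': "p + s i *\<^sub>R u \<in> cball (c' i) (\<rho> i)" and Q': "q + t i *\<^sub>R v \<in> cball (c' i) (\<rho> i)" if "i < n" for i
        using slice[OF that PU(1)] P[OF that] slice[OF that PU(2)] Q[OF that] by (auto simp: algebra_simps)
      have disj': "\<rho> i + \<rho> j < dist (c' i) (c' j)" if "i < n" "j < n" "i \<noteq> j" for i j
      proof -
        have "\<rho> i + \<rho> j < norm (h i - h j)"
        proof (rule slice_disjoint[OF _ _ \<rho>0 \<rho>0 \<rho>2 \<rho>2 r r])
          have "o' l \<bullet> (h i - h j) = 0" for l by (rule o'[OF subspace_diff[OF subU h h]])
          then show "(h i - h j) \<bullet> (o' i - o' j) = 0"
            by (simp only: inner_diff_right inner_commute[of "h i - h j"])
          have "(h i - h j) + (o' i - o' j) = c i - c j" using cho[of i] cho[of j] by (simp add: algebra_simps)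
          then show "r i + r j < norm ((h i - h j) + (o' i - o' j))" using disj[OF that] by (simp add: dist_norm)
        qed (use that in auto)
        then show ?thesis by (simp add: c'_def dist_norm)
      qed
      define E where "E i = {z :: real \<times> real. shadow W (c i - (p + fst z *\<^sub>R (q - p) + snd z *\<^sub>R u)) \<le> (r i)\<^sup>2 * (W \<bullet> W)}" for i
      have "\<Inter>(E ` {..<n}) \<noteq> {}"
      proof (rule Helly_indexed)
        show "DIM(real \<times> real) + 1 \<le> card {..<n}" using n False by simp
        show "convex (E i)" if "i \<in> {..<n}" for i
        proof (rule convexI)
          have ri: "0 \<le> r i" using r that by simp
          define g where "g z = p + fst z *\<^sub>R (q - p) + snd z *\<^sub>R u" for z :: "real \<times> real"
          fix z z' :: "real \<times> real" and x y :: real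
          assume z: "z \<in> E i" "z' \<in> E i" and xy: "0 \<le> x" "0 \<le> y" "x + y = 1"
          have "g (x *\<^sub>R z + y *\<^sub>R z') = (x + y) *\<^sub>R p + (x * fst z + y * fst z') *\<^sub>R (q - p) + (x * snd z + y * snd z') *\<^sub>R u"
            by (simp add: g_def xy(3))
          also have "\<dots> = x *\<^sub>R g z + y *\<^sub>R g z'"
            by (simp add: g_def scaleR_add_right scaleR_add_left ac_simps)
          finally show "x *\<^sub>R z + y *\<^sub>R z' \<in> E i"
            using convexD[OF convex_line_meets_cball[OF nz(3) ri] _ _ xy, of "g z" "c i" "g z'"] z
            by (simp add: E_def g_def)
        qed
        fix T assume T: "T \<subseteq> {..<n}" "card T = DIM(real \<times> real) + 1"
        then have "card T = 3" by simp
        then obtain i j k where ijk: "T = {i, j, k}" "i < j" "j < k" using three_element_nat_set by metis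
        then have lt: "i < n" "j < n" "k < n" using T by auto
        define m :: "3 \<Rightarrow> nat" where "m l = (if l = 1 then i else if l = 2 then j else k)" for l
        have m: "m 1 = i" "m 2 = j" "m 3 = k" by (auto simp: m_def)
        have mn: "m l < n" for l using lt by (auto simp: m_def)
        have inj: "m l \<noteq> m l'" if "l \<noteq> l'" for l l'
          using that ijk(2,3) exhaust_3[of l] exhaust_3[of l'] by (auto simp: m_def split: if_splits)
        have "\<exists>a\<in>weights. \<forall>l. shadow W (c' (m l) - (\<Sum>j\<in>UNIV. a $ j *\<^sub>R c' (m j))) \<le> (\<rho> (m l))\<^sup>2 * (W \<bullet> W)"
          unfolding W_def
        proof (rule sliced_triple_transversal)
          show "0 \<le> \<rho> (m l)" for l by (rule \<rho>0[OF mn])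
          show "\<rho> (m l) + \<rho> (m l') < dist (c' (m l)) (c' (m l'))" if "l \<noteq> l'" for l l'
            by (rule disj'[OF mn mn inj[OF that]])
          show "p + s (m l) *\<^sub>R u \<in> cball (c' (m l)) (\<rho> (m l))" for l by (rule P'[OF mn])
          show "q + t (m l) *\<^sub>R v \<in> cball (c' (m l)) (\<rho> (m l))" for l by (rule Q'[OF mn])
          show "s (m 1) < s (m 2)" "s (m 2) < s (m 3)" "t (m 1) < t (m 2)" "t (m 2) < t (m 3)"
            unfolding m using ijk lt by (auto intro: s_mono t_mono)
        qed (use 3 in auto)
        then obtain a where a: "a \<in> weights" "\<And>l. shadow W (c' (m l) - (\<Sum>j\<in>UNIV. a $ j *\<^sub>R c' (m j))) \<le> (\<rho> (m l))\<^sup>2 * (W \<bullet> W)"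
          by blast
        define x where "x = (\<Sum>j\<in>UNIV. a $ j *\<^sub>R h (m j))"
        have px: "(\<Sum>j\<in>UNIV. a $ j *\<^sub>R c' (m j)) = p + x"
          using a(1) by (simp add: c'_def x_def scaleR_add_right sum.distrib weights_def flip: scaleR_sum_left)
        have xU: "x \<in> U" unfolding x_def using h subU by (intro subspace_sum subspace_scale)
        have WU: "W \<in> U" unfolding W_def using Uin subU by (intro subspace_add subspace_scale)
        have x: "shadow W (c (m l) - (p + x)) \<le> (r (m l))\<^sup>2 * (W \<bullet> W)" for l
        proof -
          obtain z where "p + x + z *\<^sub>R W \<in> cball (c' (m l)) (\<rho> (m l))"
            using a(2)[of l] unfolding px shadow_le_iff[OF nz(3) \<rho>0[OF mn]] by blast
          moreover have "x + z *\<^sub>R W \<in> U" using xU WU subU by (intro subspace_add subspace_scale)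
          ultimately have "p + x + z *\<^sub>R W \<in> cball (c (m l)) (r (m l))"
            using slice[OF mn[of l], of "x + z *\<^sub>R W"] by (simp only: add.assoc)
          then show ?thesis unfolding shadow_le_iff[OF nz(3) r[OF mn]] by blast
        qed
        obtain e1 e2 e3 where e: "x = e1 *\<^sub>R (q - p) + e2 *\<^sub>R u + e3 *\<^sub>R v"
        proof -
          obtain e1 where "x - e1 *\<^sub>R (q - p) \<in> span {u, v}" using xU unfolding U_def span_breakdown_eq[of x] by blast
          then obtain e2 where "x - e1 *\<^sub>R (q - p) - e2 *\<^sub>R u \<in> span {v}" unfolding span_breakdown_eq[of _ u] by blast
          then obtain e3 where "x - e1 *\<^sub>R (q - p) - e2 *\<^sub>R u = e3 *\<^sub>R v" by (auto simp: span_singleton)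
          then show thesis using that[of e1 e2 e3] by (simp add: algebra_simps)
        qed
        \<comment> \<open>The component along \<open>v\<close> is traded for one along \<open>u\<close> by moving on the line of direction \<open>W\<close>, which is
          possible since \<open>\<beta> > 0\<close>.\<close>
        define z where "z = (e1, e2 - e3 * \<alpha> / \<beta>)"
        have "p + x = p + fst z *\<^sub>R (q - p) + snd z *\<^sub>R u + (e3 / \<beta>) *\<^sub>R W"
          using 3 by (simp add: z_def e W_def algebra_simps)
        then have "c (m l) - (p + fst z *\<^sub>R (q - p) + snd z *\<^sub>R u) = c (m l) - (p + x) + (e3 / \<beta>) *\<^sub>R W" for l by simp
        then have "z \<in> E (m l)" for l
          using x[of l] unfolding E_def mem_Collect_eq by (simp only: shadow_shift)
        then show "\<Inter>(E ` T) \<noteq> {}" using ijk(1) m by (metis INT_iff empty_iff insertE)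
      qed simp
      then obtain z where "\<And>i. i < n \<Longrightarrow> z \<in> E i" by blast
      then show ?thesis by (auto simp: E_def)
    qed
    then obtain x where "\<forall>i<n. shadow W (c i - x) \<le> (r i)\<^sup>2 * (W \<bullet> W)" ..
    then have "ordered_transversal n c r x W" using ordW by (simp add: ordered_transversal_def)
    then show ?thesis unfolding W_def ..
  qed
qed

section \<open>Contraction onto central lines\<close>

lemma continuous_on_Max_image:
  fixes f :: "'i \<Rightarrow> 'a::topological_space \<Rightarrow> real"
  assumes "finite I" "I \<noteq> {}" "\<And>i. i \<in> I \<Longrightarrow> continuous_on S (f i)"
  shows "continuous_on S (\<lambda>x. Max ((\<lambda>i. f i x) ` I))"
  using assms
proof (induction I rule: finite_ne_induct)
  case (insert i I)
  then have "continuous_on S (\<lambda>x. max (f i x) (Max ((\<lambda>i. f i x) ` I)))" by (intro continuous_on_max) auto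
  then show ?case using insert.hyps by simp
qed simp

lemma shadow_midpoint:
  "shadow w (c - (1/2) *\<^sub>R (p + q)) = (shadow w (c - p) + shadow w (c - q)) / 2 - shadow w (p - q) / 4"
  by (simp add: shadow_def inner_diff_left inner_diff_right inner_add_left inner_add_right inner_commute power2_eq_square field_simps)

lemma shadow_eq_0:
  assumes "shadow w y = 0" shows "(w \<bullet> w) *\<^sub>R y = (w \<bullet> y) *\<^sub>R w"
proof -
  have "((w \<bullet> w) *\<^sub>R y - (w \<bullet> y) *\<^sub>R w) \<bullet> ((w \<bullet> w) *\<^sub>R y - (w \<bullet> y) *\<^sub>R w) = (w \<bullet> w) * shadow w y"
    by (simp add: shadow_def inner_diff_left inner_diff_right inner_commute power2_eq_square algebra_simps)
  then show ?thesis using assms by simp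
qed

lemma shadow_triangle_scaled:
  assumes w: "w \<noteq> 0" and "shadow w (x - p) \<le> r\<^sup>2 * (w \<bullet> w)" "shadow w (y - p) \<le> s\<^sup>2 * (w \<bullet> w)" "0 \<le> r" "0 \<le> s"
  shows "shadow w (x - y) \<le> (r + s)\<^sup>2 * (w \<bullet> w)"
proof -
  define w' where "w' = w /\<^sub>R norm w"
  have w': "w = norm w *\<^sub>R w'" "w' \<bullet> w' = 1"
    using w by (simp_all add: w'_def flip: power2_norm_eq_inner)
  have ww: "w \<bullet> w = (norm w)\<^sup>2" by (simp add: power2_norm_eq_inner)
  have sh: "shadow w z = (norm w)\<^sup>2 * shadow w' z" for z by (subst w'(1)) (rule shadow_scale)
  have "shadow w' (x - p) \<le> r\<^sup>2" "shadow w' (y - p) \<le> s\<^sup>2"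
    using assms(2,3) w unfolding sh ww by (simp_all add: mult.commute)
  then have "shadow w' (x - y) \<le> (r + s)\<^sup>2" using assms(4,5) by (intro shadow_triangle[OF w'(2)])
  then have "(norm w)\<^sup>2 * shadow w' (x - y) \<le> (norm w)\<^sup>2 * (r + s)\<^sup>2" by (intro mult_left_mono) auto
  then show ?thesis unfolding sh ww by (simp only: mult.commute)
qed

text \<open>A fixed order of the balls is encoded by their numbering.\<close>

locale disjoint_balls =
  fixes n :: nat and c :: "nat \<Rightarrow> 'a::euclidean_space" and r :: "nat \<Rightarrow> real"
  assumes two: "2 \<le> n" and r_pos: "\<And>i. i < n \<Longrightarrow> 0 < r i"
    and disj: "\<And>i j. i < n \<Longrightarrow> j < n \<Longrightarrow> i \<noteq> j \<Longrightarrow> r i + r j < dist (c i) (c j)"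
begin

abbreviation transversal :: "'a \<Rightarrow> 'a \<Rightarrow> bool" where "transversal \<equiv> ordered_transversal n c r"

text \<open>Ordered transversals have positive product with this vector, so a direction can be normalised to product
\<open>1\<close> and a base point to product \<open>0\<close>.\<close>

definition axis01 :: 'a where "axis01 = c 1 - c 0"

lemma transversal_axis_pos: "transversal p v \<Longrightarrow> 0 < v \<bullet> axis01"
  using two by (simp add: ordered_transversal_def axis01_def)

lemma transversal_shift: "transversal (p + t *\<^sub>R v) v \<longleftrightarrow> transversal p v"
proof -
  have "shadow v (c i - (p + t *\<^sub>R v)) = shadow v (c i - p)" for i
    using shadow_shift[of v "c i - (p + t *\<^sub>R v)" t] by simp
  then show ?thesis by (simp add: ordered_transversal_def)
qed

text \<open>A line orthogonal to the difference of two centres cannot meet both of the disjoint balls, so the strict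
order conditions may be replaced by closed ones; this yields compactness.\<close>

lemma transversal_iff_weak_order:
  assumes v: "v \<noteq> 0"
  shows "transversal p v \<longleftrightarrow> (\<forall>i<n. shadow v (c i - p) \<le> (r i)\<^sup>2 * (v \<bullet> v)) \<and> (\<forall>i j. i < j \<longrightarrow> j < n \<longrightarrow> 0 \<le> v \<bullet> (c j - c i))"
proof -
  have ne: "v \<bullet> (c j - c i) \<noteq> 0"
    if meet: "\<forall>i<n. shadow v (c i - p) \<le> (r i)\<^sup>2 * (v \<bullet> v)" and ij: "i < j" "j < n" for i j
  proof
    assume 0: "v \<bullet> (c j - c i) = 0"
    have "shadow v (c j - c i) \<le> (r j + r i)\<^sup>2 * (v \<bullet> v)"
      using meet ij r_pos[of i] r_pos[of j] by (intro shadow_triangle_scaled[OF v]) auto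
    then have "(v \<bullet> v) * (dist (c j) (c i))\<^sup>2 \<le> (v \<bullet> v) * (r j + r i)\<^sup>2"
      by (simp add: shadow_def 0 dist_norm power2_norm_eq_inner mult.commute)
    then have "(dist (c j) (c i))\<^sup>2 \<le> (r j + r i)\<^sup>2" using v by simp
    then have "dist (c j) (c i) \<le> r j + r i" using r_pos[of i] r_pos[of j] ij by (auto intro: power2_le_imp_le)
    then show False using disj[of j i] ij by simp
  qed
  show ?thesis unfolding ordered_transversal_def
    by (intro conj_cong refl all_cong iffI less_imp_le) (simp_all add: order_less_le ne)
qed

definition normal_lines :: "('a \<times> 'a) set" where "normal_lines = {(p, v). axis01 \<bullet> p = 0 \<and> axis01 \<bullet> v = 1 \<and> transversal p v}"

definition directions :: "'a set" where "directions = {v. axis01 \<bullet> v = 1 \<and> (\<exists>p. transversal p v)}"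

lemma directions_eq: "directions = snd ` normal_lines"
proof (intro equalityI subsetI)
  fix v assume "v \<in> directions"
  then obtain p where v: "axis01 \<bullet> v = 1" "transversal p v" by (auto simp: directions_def)
  then have "(p + (- (axis01 \<bullet> p)) *\<^sub>R v, v) \<in> normal_lines" unfolding normal_lines_def using transversal_shift[of p "- (axis01 \<bullet> p)" v] by (simp add: inner_diff_right)
  then show "v \<in> snd ` normal_lines" by force
qed (auto simp: normal_lines_def directions_def)

lemma convex_directions: "convex directions"
proof (rule convexI)
  fix u v and x y :: real
  assume uv: "u \<in> directions" "v \<in> directions" and xy: "0 \<le> x" "0 \<le> y" "x + y = 1"
  then obtain p q where "transversal p u" "transversal q v" by (auto simp: directions_def)
  then have "\<exists>z. transversal z (x *\<^sub>R u + y *\<^sub>R v)"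
    using two r_pos disj xy by (intro ordered_transversal_directions_convex) (auto simp: less_imp_le)
  then show "x *\<^sub>R u + y *\<^sub>R v \<in> directions" using uv xy by (simp add: directions_def inner_add_right)
qed

text \<open>Boundedness: a line of the family contains points of the balls \<open>0\<close> and \<open>1\<close>, and their difference has
product at least \<open>m > 0\<close> with \<open>axis01\<close> because the balls are disjoint.  This bounds the normalised
direction by \<open>R / m\<close>.\<close>

lemma compact_normal_lines: "compact normal_lines"
proof (rule compact_eq_bounded_closed[THEN iffD2], intro conjI)
  have normal_lines_closed_form: "normal_lines = {z. axis01 \<bullet> fst z = 0} \<inter> {z. axis01 \<bullet> snd z = 1}
    \<inter> (\<Inter>i\<in>{..<n}. {z. shadow (snd z) (c i - fst z) \<le> (r i)\<^sup>2 * (snd z \<bullet> snd z)})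
    \<inter> (\<Inter>i. \<Inter>j\<in>{i<..<n}. {z. 0 \<le> snd z \<bullet> (c j - c i)})"
  proof -
    have "transversal p v \<longleftrightarrow> (\<forall>i<n. shadow v (c i - p) \<le> (r i)\<^sup>2 * (v \<bullet> v)) \<and> (\<forall>i j. i < j \<longrightarrow> j < n \<longrightarrow> 0 \<le> v \<bullet> (c j - c i))"
      if "axis01 \<bullet> v = 1" for p v
      using that by (intro transversal_iff_weak_order) auto
    then show ?thesis by (auto simp: normal_lines_def)
  qed
  have "closed {z :: 'a \<times> 'a. axis01 \<bullet> fst z = 0}" "closed {z :: 'a \<times> 'a. axis01 \<bullet> snd z = 1}"
    by (intro closed_Collect_eq continuous_intros)+
  moreover have "closed {z. shadow (snd z) (c i - fst z) \<le> (r i)\<^sup>2 * (snd z \<bullet> snd z)}" for i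
    unfolding shadow_def by (intro closed_Collect_le continuous_intros)
  moreover have "closed {z :: 'a \<times> 'a. 0 \<le> snd z \<bullet> (c j - c i)}" for i j
    by (intro closed_Collect_le continuous_intros)
  ultimately show "closed normal_lines" unfolding normal_lines_closed_form by (simp only: closed_Int closed_INT ball_simps simp_thms Ball_def)
  define m where "m = norm axis01 * (norm axis01 - (r 0 + r 1))"
  have lt: "0 < n" "1 < n" using two by auto
  have ne: "r 0 + r 1 < norm axis01" using disj[of 1 0] two by (simp add: axis01_def dist_norm)
  then have m: "m > 0" using r_pos[OF lt(1)] r_pos[OF lt(2)] by (auto simp: m_def intro!: mult_pos_pos)
  define R where "R = norm axis01 + (r 0 + r 1)"
  define Q where "Q = norm (c 0) + r 0"
  define X where "X = Q + norm axis01 * Q * (R / m)"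
  have R: "R \<ge> 0" "Q \<ge> 0" using r_pos[OF lt(1)] r_pos[OF lt(2)] by (auto simp: R_def Q_def)
  show "bounded normal_lines"
  proof (rule boundedI)
    fix z assume "z \<in> normal_lines"
    then obtain p v where z: "z = (p, v)" "axis01 \<bullet> p = 0" "axis01 \<bullet> v = 1" "transversal p v" by (auto simp: normal_lines_def)
    then have v: "v \<noteq> 0" by auto
    have "\<exists>t. p + t *\<^sub>R v \<in> cball (c i) (r i)" if "i < n" for i
      using z(4) that shadow_le_iff[OF v, of "r i" "c i" p] r_pos[OF that] by (auto simp: ordered_transversal_def)
    then obtain s t where s: "p + s *\<^sub>R v \<in> cball (c 0) (r 0)" and t: "p + t *\<^sub>R v \<in> cball (c 1) (r 1)" using lt by blast
    define d where "d = ((p + t *\<^sub>R v) - c 1) - ((p + s *\<^sub>R v) - c 0)"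
    have d: "norm d \<le> r 0 + r 1"
      using s t norm_triangle_ineq4[of "(p + t *\<^sub>R v) - c 1" "(p + s *\<^sub>R v) - c 0"]
      by (simp add: d_def dist_norm norm_minus_commute)
    have ed: "(t - s) *\<^sub>R v = axis01 + d" by (simp add: d_def axis01_def algebra_simps)
    have "t - s = axis01 \<bullet> ((t - s) *\<^sub>R v)" by (simp add: z(3))
    also have "\<dots> = norm axis01 * norm axis01 + axis01 \<bullet> d" unfolding ed by (simp add: inner_add_right flip: power2_norm_eq_inner power2_eq_square)
    also have "\<dots> \<ge> m"
    proof -
      have "- (axis01 \<bullet> d) \<le> norm axis01 * norm d" using Cauchy_Schwarz_ineq2[of axis01 d] by linarith
      also have "\<dots> \<le> norm axis01 * (r 0 + r 1)" by (intro mult_left_mono d) simp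
      finally show ?thesis by (simp add: m_def algebra_simps)
    qed
    finally have ts: "m \<le> t - s" .
    have "m * norm v \<le> norm ((t - s) *\<^sub>R v)" using ts m by (simp add: mult_right_mono)
    also have "\<dots> \<le> R" unfolding ed R_def using norm_triangle_ineq[of axis01 d] d by linarith
    finally have nv: "norm v \<le> R / m" using m by (simp add: field_simps)
    have "norm (p + s *\<^sub>R v) \<le> Q"
      using s norm_triangle_ineq[of "c 0" "(p + s *\<^sub>R v) - c 0"] by (simp add: Q_def dist_norm norm_minus_commute)
    moreover have "s = axis01 \<bullet> (p + s *\<^sub>R v)" by (simp add: inner_add_right z)
    then have "\<bar>s\<bar> \<le> norm axis01 * norm (p + s *\<^sub>R v)" by (metis Cauchy_Schwarz_ineq2)
    ultimately have "\<bar>s\<bar> \<le> norm axis01 * Q" by (meson mult_left_mono norm_ge_zero order_trans)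
    then have "\<bar>s\<bar> * norm v \<le> norm axis01 * Q * (R / m)" using nv R m by (intro mult_mono) auto
    then have "norm p \<le> X" unfolding X_def
      using norm_triangle_ineq4[of "p + s *\<^sub>R v" "s *\<^sub>R v"] \<open>norm (p + s *\<^sub>R v) \<le> Q\<close> by simp
    then show "norm z \<le> X + R / m"
      unfolding z(1) using nv norm_Pair_le[of p v] by linarith
  qed
qed

lemma compact_directions: "compact directions"
  unfolding directions_eq by (intro compact_continuous_image compact_normal_lines continuous_intros)

text \<open>The function to be minimised in each fibre; a line with direction in \<open>directions\<close> is an ordered transversal
iff it is nonpositive.  It is minimised over a whole hyperplane of base points, so that being a minimiser
is a closed condition.\<close>

definition worst :: "'a \<Rightarrow> 'a \<Rightarrow> real" where
  "worst v p = Max ((\<lambda>i. shadow v (c i - p) - (r i)\<^sup>2 * (v \<bullet> v)) ` {..<n})"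

lemma worst_le_iff: "worst v p \<le> b \<longleftrightarrow> (\<forall>i<n. shadow v (c i - p) - (r i)\<^sup>2 * (v \<bullet> v) \<le> b)"
  unfolding worst_def using two by (subst Max_le_iff) (auto simp: lessThan_empty_iff)

lemma continuous_worst:
  assumes "continuous_on S f" "continuous_on S g"
  shows "continuous_on S (\<lambda>x. worst (f x) (g x))"
  unfolding worst_def shadow_def using two
  by (intro continuous_on_Max_image continuous_intros assms) (auto simp: lessThan_empty_iff)

definition central :: "'a \<Rightarrow> 'a \<Rightarrow> bool" where
  "central v p \<longleftrightarrow> axis01 \<bullet> p = 0 \<and> (\<forall>q. axis01 \<bullet> q = 0 \<longrightarrow> worst v p \<le> worst v q)"

lemma transversal_iff_worst:
  assumes "v \<in> directions"
  shows "transversal p v \<longleftrightarrow> worst v p \<le> 0"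
  using assms by (auto simp: directions_def ordered_transversal_def worst_le_iff)

text \<open>At the midpoint of two minimisers the parallelogram identity lowers every term by
\<open>shadow v (p - q) / 4\<close>, which vanishes only if the two lines coincide.\<close>

lemma central_unique:
  assumes v: "axis01 \<bullet> v = 1" and p: "central v p" and q: "central v q"
  shows "p = q"
proof -
  define m where "m = (1/2) *\<^sub>R (p + q)"
  have ep: "axis01 \<bullet> p = 0" "axis01 \<bullet> q = 0" using p q by (auto simp: central_def)
  then have "axis01 \<bullet> m = 0" by (simp add: m_def inner_add_right)
  then have le: "worst v p \<le> worst v m" "worst v q = worst v p"
    using p q ep by (auto simp: central_def intro: antisym)
  have "worst v m \<le> worst v p - shadow v (p - q) / 4"
    unfolding worst_le_iff
  proof (intro allI impI)
    fix i assume "i < n"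
    then have "shadow v (c i - p) - (r i)\<^sup>2 * (v \<bullet> v) \<le> worst v p" "shadow v (c i - q) - (r i)\<^sup>2 * (v \<bullet> v) \<le> worst v p"
      using worst_le_iff[of v p "worst v p"] worst_le_iff[of v q "worst v p"] le(2) by auto
    then show "shadow v (c i - m) - (r i)\<^sup>2 * (v \<bullet> v) \<le> worst v p - shadow v (p - q) / 4"
      unfolding m_def shadow_midpoint by (simp add: field_simps)
  qed
  then have "shadow v (p - q) = 0" using le(1) shadow_nonneg[of v "p - q"] by linarith
  then have eq: "(v \<bullet> v) *\<^sub>R (p - q) = (v \<bullet> (p - q)) *\<^sub>R v" by (rule shadow_eq_0)
  have "axis01 \<bullet> ((v \<bullet> v) *\<^sub>R (p - q)) = 0" using ep by (simp add: inner_diff_right)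
  then have "v \<bullet> (p - q) = 0" unfolding eq using v by simp
  moreover have "v \<bullet> v \<noteq> 0" using v by auto
  ultimately show ?thesis using eq by simp
qed

lemma central_exists:
  assumes "v \<in> directions"
  shows "\<exists>p. central v p"
proof -
  have v: "axis01 \<bullet> v = 1" using assms by (simp add: directions_def)
  define F where "F = fst ` (normal_lines \<inter> {z. snd z = v})"
  have F: "F = {p. axis01 \<bullet> p = 0 \<and> worst v p \<le> 0}"
    using transversal_iff_worst[OF assms] v by (force simp: F_def normal_lines_def)
  have "compact F" unfolding F_def
    by (intro compact_continuous_image compact_Int_closed compact_normal_lines closed_Collect_eq continuous_intros)
  moreover have "F \<noteq> {}" using assms unfolding directions_eq F_def by auto
  ultimately obtain p where p: "p \<in> F" "\<And>q. q \<in> F \<Longrightarrow> worst v p \<le> worst v q"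
    using continuous_attains_inf[of F "worst v"] continuous_worst[OF continuous_on_const continuous_on_id] by blast
  have "worst v p \<le> worst v q" if "axis01 \<bullet> q = 0" for q
  proof (cases "q \<in> F")
    case False
    then show ?thesis using that p(1) by (simp add: F)
  qed (rule p(2))
  then have "central v p" using p(1) by (simp add: central_def F)
  then show ?thesis ..
qed

definition centre :: "'a \<Rightarrow> 'a" where "centre v = (SOME p. central v p)"

lemma central_centre: "v \<in> directions \<Longrightarrow> central v (centre v)"
  unfolding centre_def by (rule someI_ex) (rule central_exists)

lemma centre_in_normal_lines: "v \<in> directions \<Longrightarrow> (centre v, v) \<in> normal_lines"
proof -
  assume v: "v \<in> directions"
  then obtain p where "(p, v) \<in> normal_lines" by (auto simp: directions_eq)
  then have "axis01 \<bullet> p = 0" "worst v p \<le> 0" "axis01 \<bullet> v = 1" using transversal_iff_worst[OF v] by (auto simp: normal_lines_def)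
  then show "(centre v, v) \<in> normal_lines"
    using central_centre[OF v] transversal_iff_worst[OF v] by (force simp: central_def normal_lines_def)
qed

text \<open>The graph is closed, since being a minimiser is preserved under limits, and the values stay in a compact
set.\<close>

lemma continuous_centre: "continuous_on directions centre"
proof (rule continuous_from_closed_graph)
  show "compact (fst ` normal_lines)" by (intro compact_continuous_image compact_normal_lines continuous_intros)
  show "centre \<in> directions \<rightarrow> fst ` normal_lines" using centre_in_normal_lines by force
  have "(\<lambda>v. (v, centre v)) ` directions = (directions \<times> UNIV) \<inter> {z. axis01 \<bullet> snd z = 0}
     \<inter> (\<Inter>q\<in>{q. axis01 \<bullet> q = 0}. {z. worst (fst z) (snd z) \<le> worst (fst z) q})" (is "?L = ?R")
  proof (intro equalityI subsetI)
    fix z assume "z \<in> ?L"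
    then show "z \<in> ?R" using central_centre by (auto simp: central_def)
  next
    fix z assume z: "z \<in> ?R"
    then have "central (fst z) (snd z)" "fst z \<in> directions" by (auto simp: central_def)
    then have "snd z = centre (fst z)" using central_unique[OF _ _ central_centre] by (auto simp: directions_def)
    then show "z \<in> ?L"
      by (intro image_eqI[of _ _ "fst z"] \<open>fst z \<in> directions\<close>) (simp add: prod_eq_iff)
  qed
  moreover have "closed ?R"
  proof (intro closed_Int closed_INT ballI)
    show "closed (directions \<times> (UNIV :: 'a set))"
      by (intro closed_Times compact_imp_closed compact_directions closed_UNIV)
    show "closed {z :: 'a \<times> 'a. axis01 \<bullet> snd z = 0}" by (intro closed_Collect_eq continuous_intros)
    show "closed {z. worst (fst z) (snd z) \<le> worst (fst z) q}" for q
      by (intro closed_Collect_le continuous_worst continuous_intros)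
  qed
  ultimately show "closed ((\<lambda>v. (v, centre v)) ` directions)" by simp
qed

text \<open>Each fibre is convex, so every line slides straight to the central line of its direction; this deforms the
family onto a copy of the convex set of directions.\<close>

lemma contractible_normal_lines: "contractible_space (top_of_set normal_lines)"
proof (rule homotopy_dominated_contractibility)
  show "contractible_space (top_of_set directions)" using convex_directions by (simp add: convex_imp_contractible)
  show "continuous_map (top_of_set directions) (top_of_set normal_lines) (\<lambda>v. (centre v, v))"
    using centre_in_normal_lines by (auto intro!: continuous_intros continuous_centre)
  show cs: "continuous_map (top_of_set normal_lines) (top_of_set directions) snd"
    by (auto simp: directions_eq intro!: continuous_intros)
  have "homotopic_with_canon (\<lambda>z. True) normal_lines normal_lines ((\<lambda>v. (centre v, v)) \<circ> snd) id"
  proof (rule homotopic_with_linear)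
    show "continuous_on normal_lines ((\<lambda>v. (centre v, v)) \<circ> snd)"
      by (intro continuous_on_compose continuous_intros continuous_on_Pair)
        (auto simp flip: directions_eq intro!: continuous_centre)
    show "continuous_on normal_lines id" by (simp add: id_def)
    fix z assume z: "z \<in> normal_lines"
    then obtain p v where pv: "z = (p, v)" "axis01 \<bullet> p = 0" "axis01 \<bullet> v = 1" "transversal p v" by (auto simp: normal_lines_def)
    then have vK: "v \<in> directions" and v: "v \<noteq> 0" by (auto simp: directions_def)
    have "convex {q. axis01 \<bullet> q = 0}" by (rule convex_hyperplane)
    moreover have "convex (\<Inter>i\<in>{..<n}. {q. shadow v (c i - q) \<le> (r i)\<^sup>2 * (v \<bullet> v)})"
      using r_pos by (intro convex_INT convex_line_meets_cball[OF v]) (auto simp: less_imp_le)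
    ultimately have "convex ({q. axis01 \<bullet> q = 0} \<inter> (\<Inter>i\<in>{..<n}. {q. shadow v (c i - q) \<le> (r i)\<^sup>2 * (v \<bullet> v)}))"
      by (rule convex_Int)
    moreover have fibre: "{q. axis01 \<bullet> q = 0} \<inter> (\<Inter>i\<in>{..<n}. {q. shadow v (c i - q) \<le> (r i)\<^sup>2 * (v \<bullet> v)}) = {q. (q, v) \<in> normal_lines}"
      using pv by (auto simp: normal_lines_def ordered_transversal_def)
    ultimately have "convex ({q. (q, v) \<in> normal_lines} \<times> {v})" by (intro convex_Times) auto
    then have "closed_segment (centre v, v) (p, v) \<subseteq> {q. (q, v) \<in> normal_lines} \<times> {v}"
      using z pv(1) centre_in_normal_lines[OF vK] by (intro closed_segment_subset) auto
    then show "closed_segment (((\<lambda>v. (centre v, v)) \<circ> snd) z) (id z) \<subseteq> normal_lines" using pv(1) by auto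
  qed
  then show "homotopic_with (\<lambda>x. True) (top_of_set normal_lines) (top_of_set normal_lines) ((\<lambda>v. (centre v, v)) \<circ> snd) id" .
qed

section \<open>The space of lines realizing an order\<close>

text \<open>A line meets a ball in an interval that contains the foot of the perpendicular from the centre.  For
disjoint balls these intervals are disjoint, hence ordered like the feet.\<close>

lemma visits_in_order_iff:
  assumes v: "v \<noteq> 0"
  shows "(\<forall>i<n. \<exists>t. p + t *\<^sub>R v \<in> cball (c i) (r i)) \<and> visits_in_order p v (map (\<lambda>i. cball (c i) (r i)) [0..<n])
    \<longleftrightarrow> transversal p v"
proof -
  define s where "s i = v \<bullet> (c i - p) / (v \<bullet> v)" for i
  have vv: "v \<bullet> v > 0" using v by simp
  have s_less: "s i < s j \<longleftrightarrow> 0 < v \<bullet> (c j - c i)" for i j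
    using vv v by (simp add: s_def divide_less_cancel inner_diff_right order_less_not_sym del: inner_gt_zero_iff)
  have meet: "(\<exists>t. p + t *\<^sub>R v \<in> cball (c i) (r i)) \<longleftrightarrow> shadow v (c i - p) \<le> (r i)\<^sup>2 * (v \<bullet> v)" if "i < n" for i
    using shadow_le_iff[OF v] r_pos[OF that] by (simp add: less_imp_le)
  have foot: "p + s i *\<^sub>R v \<in> cball (c i) (r i)" if "i < n" "shadow v (c i - p) \<le> (r i)\<^sup>2 * (v \<bullet> v)" for i
    unfolding s_def using that r_pos[of i] by (intro foot_of_perpendicular[OF v]) auto
  have order: "0 < v \<bullet> (c j - c i) \<longleftrightarrow>
      (\<forall>x y. p + x *\<^sub>R v \<in> cball (c i) (r i) \<longrightarrow> p + y *\<^sub>R v \<in> cball (c j) (r j) \<longrightarrow> x < y)"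
    if ij: "i < j" "j < n" and m: "shadow v (c i - p) \<le> (r i)\<^sup>2 * (v \<bullet> v)" "shadow v (c j - p) \<le> (r j)\<^sup>2 * (v \<bullet> v)" for i j
  proof
    assume "\<forall>x y. p + x *\<^sub>R v \<in> cball (c i) (r i) \<longrightarrow> p + y *\<^sub>R v \<in> cball (c j) (r j) \<longrightarrow> x < y"
    then have "s i < s j" using foot[of i] foot[of j] ij m by simp
    then show "0 < v \<bullet> (c j - c i)" by (simp add: s_less)
  next
    assume pos: "0 < v \<bullet> (c j - c i)"
    show "\<forall>x y. p + x *\<^sub>R v \<in> cball (c i) (r i) \<longrightarrow> p + y *\<^sub>R v \<in> cball (c j) (r j) \<longrightarrow> x < y"
    proof (intro allI impI, rule ccontr)
      fix x y assume x: "p + x *\<^sub>R v \<in> cball (c i) (r i)" and y: "p + y *\<^sub>R v \<in> cball (c j) (r j)" and "\<not> x < y"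
      have sij: "s i < s j" using pos by (simp add: s_less)
      \<comment> \<open>If \<open>y \<le> x\<close>, the point moving from \<open>s i\<close> to \<open>x\<close> meets at time \<open>l\<close> the one moving from \<open>s j\<close> to \<open>y\<close>, in
        a common point of the two balls.\<close>
      define l where "l = (s j - s i) / ((s j - s i) + (x - y))"
      have l: "0 \<le> l" "l \<le> 1" using sij \<open>\<not> x < y\<close> by (auto simp: l_def)
      have "l * ((s j - s i) + (x - y)) = s j - s i" using sij \<open>\<not> x < y\<close> by (simp add: l_def)
      then have eq: "(1 - l) * s i + l * x = (1 - l) * s j + l * y" by (simp add: algebra_simps)
      have comb: "p + ((1 - l) * a + l * b) *\<^sub>R v = (1 - l) *\<^sub>R (p + a *\<^sub>R v) + l *\<^sub>R (p + b *\<^sub>R v)" for a b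
        by (simp add: algebra_simps)
      have "p + ((1 - l) * s i + l * x) *\<^sub>R v \<in> cball (c i) (r i)"
        unfolding comb by (rule convexD_alt[OF convex_cball foot x l]) (use ij m in auto)
      moreover have "p + ((1 - l) * s i + l * x) *\<^sub>R v \<in> cball (c j) (r j)"
        unfolding eq comb by (rule convexD_alt[OF convex_cball foot y l]) (use ij m in auto)
      ultimately show False
        using disj[of i j] ij dist_triangle2[of "c i" "c j" "p + ((1 - l) * s i + l * x) *\<^sub>R v"]
        by (simp add: dist_commute)
    qed
  qed
  have visits: "visits_in_order p v (map (\<lambda>i. cball (c i) (r i)) [0..<n]) \<longleftrightarrow> (\<forall>i j. i < j \<longrightarrow> j < n \<longrightarrow>
      (\<forall>x y. p + x *\<^sub>R v \<in> cball (c i) (r i) \<longrightarrow> p + y *\<^sub>R v \<in> cball (c j) (r j) \<longrightarrow> x < y))"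
    unfolding visits_in_order_def sorted_wrt_iff_nth_less by (simp del: mem_cball)
  show ?thesis
    unfolding visits ordered_transversal_def
  proof (rule conj_cong)
    show "(\<forall>i<n. \<exists>t. p + t *\<^sub>R v \<in> cball (c i) (r i)) = (\<forall>i<n. shadow v (c i - p) \<le> (r i)\<^sup>2 * (v \<bullet> v))"
      by (rule all_cong1, rule imp_cong, rule refl, rule meet)
    assume m: "\<forall>i<n. shadow v (c i - p) \<le> (r i)\<^sup>2 * (v \<bullet> v)"
    show "(\<forall>i j. i < j \<longrightarrow> j < n \<longrightarrow>
      (\<forall>x y. p + x *\<^sub>R v \<in> cball (c i) (r i) \<longrightarrow> p + y *\<^sub>R v \<in> cball (c j) (r j) \<longrightarrow> x < y))
      = (\<forall>i j. i < j \<longrightarrow> j < n \<longrightarrow> 0 < v \<bullet> (c j - c i))"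
      by (rule all_cong1, rule all_cong1, rule imp_cong, rule refl, rule imp_cong, rule refl, rule order[symmetric])
        (use m in auto)
  qed
qed

end

lemma line_through_eq_imp:
  assumes "line_through p v = line_through q w"
  obtains t k where "q = p + t *\<^sub>R v" "w = k *\<^sub>R v"
proof -
  have "q \<in> line_through p v" "q + w \<in> line_through p v"
    unfolding assms unfolding line_through_def
    using rangeI[of "\<lambda>t. q + t *\<^sub>R w" 0] rangeI[of "\<lambda>t. q + t *\<^sub>R w" 1] by simp_all
  then obtain t s where ts: "q = p + t *\<^sub>R v" "q + w = p + s *\<^sub>R v"
    unfolding line_through_def by (elim rangeE)
  then have "w = (s - t) *\<^sub>R v" by (simp add: algebra_simps)
  then show thesis using that ts(1) by blast
qed

lemma line_through_minus: "line_through p (- v) = line_through p v"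
  unfolding line_through_def
proof (intro equalityI subsetI)
  fix x assume "x \<in> range (\<lambda>t. p + t *\<^sub>R (- v))"
  then obtain t where "x = p + (- t) *\<^sub>R v" by auto
  then show "x \<in> range (\<lambda>t. p + t *\<^sub>R v)" by blast
next
  fix x assume "x \<in> range (\<lambda>t. p + t *\<^sub>R v)"
  then obtain t where "x = p + (- t) *\<^sub>R (- v)" by auto
  then show "x \<in> range (\<lambda>t. p + t *\<^sub>R (- v))" by blast
qed

context disjoint_balls
begin

text \<open>An open set of lines, on which \<open>normalise\<close> below induces a continuous section of the quotient map.\<close>

definition crossing_lines :: "'a set set" where
  "crossing_lines = {line_through p v | p v. axis01 \<bullet> v \<noteq> 0}"

definition normalise :: "'a \<times> 'a \<Rightarrow> 'a \<times> 'a" where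
  "normalise = (\<lambda>(p, v). (p - (axis01 \<bullet> p / (axis01 \<bullet> v)) *\<^sub>R v, (1 / (axis01 \<bullet> v)) *\<^sub>R v))"

lemma line_through_normalise:
  assumes "axis01 \<bullet> v \<noteq> 0"
  shows "(case normalise (p, v) of (q, w) \<Rightarrow> line_through q w) = line_through p v"
proof -
  define k where "k = axis01 \<bullet> v"
  have k: "k \<noteq> 0" using assms by (simp add: k_def)
  have f1: "p - (axis01 \<bullet> p / k) *\<^sub>R v + t *\<^sub>R ((1 / k) *\<^sub>R v) = p + ((t - axis01 \<bullet> p) / k) *\<^sub>R v" for t
    by (simp add: diff_divide_distrib scaleR_diff_left)
  have f2: "p + t *\<^sub>R v = p - (axis01 \<bullet> p / k) *\<^sub>R v + (t * k + axis01 \<bullet> p) *\<^sub>R ((1 / k) *\<^sub>R v)" for t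
    using k by (simp add: add_divide_distrib scaleR_add_left)
  show ?thesis
    unfolding line_through_def normalise_def k_def[symmetric] prod.case
  proof (intro equalityI image_subsetI)
    fix t
    show "p - (axis01 \<bullet> p / k) *\<^sub>R v + t *\<^sub>R ((1 / k) *\<^sub>R v) \<in> range (\<lambda>t. p + t *\<^sub>R v)"
      unfolding f1 by (rule rangeI)
    show "p + t *\<^sub>R v \<in> range (\<lambda>t. p - (axis01 \<bullet> p / k) *\<^sub>R v + t *\<^sub>R ((1 / k) *\<^sub>R v))"
      by (subst f2) (rule rangeI)
  qed
qed

lemma normalise_unique:
  assumes "line_through p v = line_through q w" "axis01 \<bullet> v \<noteq> 0" "w \<noteq> 0"
  shows "axis01 \<bullet> w \<noteq> 0" "normalise (p, v) = normalise (q, w)"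
proof -
  obtain t k where tk: "q = p + t *\<^sub>R v" "w = k *\<^sub>R v" by (rule line_through_eq_imp[OF assms(1)])
  then show ew: "axis01 \<bullet> w \<noteq> 0" using assms by auto
  then have k: "k \<noteq> 0" using tk by auto
  have "axis01 \<bullet> q / (axis01 \<bullet> w) * k = axis01 \<bullet> p / (axis01 \<bullet> v) + t"
    using k assms(2) unfolding tk by (simp add: inner_add_right field_simps)
  then have "(axis01 \<bullet> q / (axis01 \<bullet> w)) *\<^sub>R w = (axis01 \<bullet> p / (axis01 \<bullet> v)) *\<^sub>R v + t *\<^sub>R v"
    by (simp only: tk(2) scaleR_scaleR scaleR_add_left)
  moreover have "(1 / (axis01 \<bullet> w)) *\<^sub>R w = (1 / (axis01 \<bullet> v)) *\<^sub>R v" using k by (simp add: tk(2))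
  ultimately show "normalise (p, v) = normalise (q, w)" by (simp add: normalise_def tk(1))
qed

definition section_of :: "'a set \<Rightarrow> 'a \<times> 'a" where
  "section_of L = normalise (SOME (p, v). v \<noteq> 0 \<and> line_through p v = L)"

lemma section_of_line:
  assumes "axis01 \<bullet> v \<noteq> 0"
  shows "section_of (line_through p v) = normalise (p, v)"
proof -
  define z where "z = (SOME (q, w). w \<noteq> 0 \<and> line_through q w = line_through p v)"
  have "\<exists>z. case z of (q, w) \<Rightarrow> w \<noteq> 0 \<and> line_through q w = line_through p v" using assms by (intro exI[of _ "(p, v)"]) auto
  then have "case z of (q, w) \<Rightarrow> w \<noteq> 0 \<and> line_through q w = line_through p v" unfolding z_def by (rule someI_ex)
  moreover obtain q w where z: "z = (q, w)" by (cases z)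
  ultimately have qw: "w \<noteq> 0" "line_through p v = line_through q w" by auto
  have "normalise (p, v) = normalise z" unfolding z by (rule normalise_unique(2)[OF qw(2) assms qw(1)])
  then show ?thesis by (simp add: section_of_def z_def[symmetric])
qed

text \<open>A quotient map restricted to an open set of lines is again a quotient map, so continuity can be tested on
pairs of a point and a direction, where \<open>normalise\<close> is an explicit formula.\<close>

lemma continuous_section_of: "continuous_map (subtopology line_topology crossing_lines) euclidean section_of"
proof -
  define N where "N = {z :: 'a \<times> 'a. axis01 \<bullet> snd z \<noteq> 0}"
  have mem: "line_through p v \<in> crossing_lines \<longleftrightarrow> axis01 \<bullet> v \<noteq> 0" if "v \<noteq> 0" for p v
    using that normalise_unique(1) by (auto simp: crossing_lines_def) metis
  have N: "{(p, v). v \<noteq> 0 \<and> line_through p v \<in> crossing_lines} = N"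
    using mem by (auto simp: N_def) (auto simp: crossing_lines_def)
  have "open N" unfolding N_def by (intro open_Collect_neq continuous_intros)
  then have "openin line_topology crossing_lines"
    unfolding openin_line_topology N affine_lines_eq by (auto simp: crossing_lines_def)
  moreover have "{x \<in> topspace (top_of_set {(p, v). v \<noteq> 0}). (case x of (p, v) \<Rightarrow> line_through p v) \<in> crossing_lines} = N"
    using N by auto
  ultimately have quot: "quotient_map (subtopology (top_of_set {(p, v). v \<noteq> 0}) N) (subtopology line_topology crossing_lines)
      (\<lambda>(p, v). line_through p v)"
    using quotient_map_restriction[OF quotient_map_line_through] by blast
  have sub: "subtopology (top_of_set {(p, v). v \<noteq> 0}) N = top_of_set N"
    by (simp add: subtopology_subtopology) (rule arg_cong[where f = top_of_set], auto simp: N_def)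
  have "continuous_on N normalise"
    unfolding normalise_def case_prod_unfold by (intro continuous_intros) (auto simp: N_def)
  then have "continuous_map (top_of_set N) euclidean normalise" by simp
  then have "continuous_map (top_of_set N) euclidean (section_of \<circ> (\<lambda>(p, v). line_through p v))"
    by (rule continuous_map_eq) (auto simp: N_def section_of_line)
  then show ?thesis using continuous_compose_quotient_map[OF quot[unfolded sub]] by blast
qed

lemma normalise_transversal:
  assumes "transversal p v"
  shows "normalise (p, v) \<in> normal_lines"
proof -
  have ev: "0 < axis01 \<bullet> v" using transversal_axis_pos[OF assms] by (simp add: inner_commute)
  have "transversal p ((1 / (axis01 \<bullet> v)) *\<^sub>R v)" using ordered_transversal_scale[OF assms] ev by simp
  then have "transversal (p + (- (axis01 \<bullet> p)) *\<^sub>R ((1 / (axis01 \<bullet> v)) *\<^sub>R v)) ((1 / (axis01 \<bullet> v)) *\<^sub>R v)" by (simp only: transversal_shift)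
  then show ?thesis using ev by (simp add: normalise_def normal_lines_def inner_diff_right)
qed

text \<open>The space of these lines is a retract of the contractible space \<open>normal_lines\<close>.\<close>

lemma contractible_ordered_lines:
  "contractible_space (subtopology line_topology {line_through p v | p v. transversal p v})"
proof -
  define T where "T = {line_through p v | p v. transversal p v}"
  have TU: "T \<subseteq> crossing_lines" using transversal_axis_pos by (fastforce simp: T_def crossing_lines_def inner_commute)
  have nonzero: "normal_lines \<subseteq> {(p, v). v \<noteq> 0}" by (auto simp: normal_lines_def)
  have "retraction_maps (top_of_set normal_lines) (subtopology line_topology T) (\<lambda>(p, v). line_through p v) section_of"
    unfolding retraction_maps_def
  proof (intro conjI ballI)
    have "continuous_map (top_of_set normal_lines) line_topology (\<lambda>(p, v). line_through p v)"
      using continuous_map_from_subtopology_mono[OF quotient_imp_continuous_map[OF quotient_map_line_through] nonzero] .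
    then show "continuous_map (top_of_set normal_lines) (subtopology line_topology T) (\<lambda>(p, v). line_through p v)"
      by (auto simp: continuous_map_in_subtopology normal_lines_def T_def)
    have im: "section_of L \<in> normal_lines" "(case section_of L of (p, v) \<Rightarrow> line_through p v) = L" if LT: "L \<in> T" for L
    proof -
      obtain p v where L: "L = line_through p v" "transversal p v" using LT unfolding T_def by blast
      have ev: "axis01 \<bullet> v \<noteq> 0" using transversal_axis_pos[OF L(2)] by (simp add: inner_commute)
      show "section_of L \<in> normal_lines" unfolding L(1) section_of_line[OF ev] by (rule normalise_transversal[OF L(2)])
      show "(case section_of L of (p, v) \<Rightarrow> line_through p v) = L"
        unfolding L(1) section_of_line[OF ev] by (rule line_through_normalise[OF ev])
    qed
    have "continuous_map (subtopology line_topology T) euclidean section_of"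
      using continuous_map_from_subtopology_mono[OF continuous_section_of TU] .
    then show "continuous_map (subtopology line_topology T) (top_of_set normal_lines) section_of"
      using im(1) by (auto simp: continuous_map_in_subtopology)
    show "(case section_of L of (p, v) \<Rightarrow> line_through p v) = L" if "L \<in> topspace (subtopology line_topology T)" for L
      using that im(2) by simp
  qed
  then have "retraction_map (top_of_set normal_lines) (subtopology line_topology T) (\<lambda>(p, v). line_through p v)"
    unfolding retraction_map_def by blast
  then show ?thesis
    using contractible_space_retraction_map_image contractible_normal_lines unfolding T_def by blast
qed

end

lemma disjnt_cball_dist:
  fixes a b :: "'a::real_normed_vector"
  assumes r: "0 < r" "0 < s" and dj: "disjnt (cball a r) (cball b s)"
  shows "r + s < dist a b"
proof (rule ccontr)
  assume le: "\<not> r + s < dist a b"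
  define l where "l = r / (r + s)"
  have l: "0 \<le> l" "0 \<le> 1 - l" "1 - l = s / (r + s)" using r by (auto simp: l_def field_simps)
  define z where "z = a + l *\<^sub>R (b - a)"
  have "dist a z = l * dist a b" using l(1) by (simp add: z_def dist_norm norm_minus_commute)
  also have "\<dots> \<le> l * (r + s)" using le l by (intro mult_left_mono) auto
  also have "\<dots> = r" using r by (simp add: l_def)
  finally have "z \<in> cball a r" by simp
  have "b - z = (1 - l) *\<^sub>R (b - a)" by (simp add: z_def algebra_simps)
  then have "dist b z = (1 - l) * dist a b" using l(2) by (simp add: dist_norm norm_minus_commute)
  also have "\<dots> \<le> (1 - l) * (r + s)" using le l by (intro mult_left_mono) auto
  also have "\<dots> = s" using r unfolding l(3) by simp
  finally have "z \<in> cball b s" by simp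
  then show False using \<open>z \<in> cball a r\<close> dj by (auto simp: disjnt_iff)
qed

theorem corollary11:
  fixes S :: "(real ^ 'd) set set" and n :: nat and P :: "(real ^ 'd) set list set"
  assumes "n \<ge> 2"
    and "finite S" and "card S = n"
    and "\<And>B. B \<in> S \<Longrightarrow> \<exists>c r. r > 0 \<and> B = cball c r"
    and "pairwise disjnt S"
    and "geometric_permutation S P"
  shows "contractible_space (subtopology line_topology {L. realizes S L P})"
proof -
  obtain C R where CR: "\<And>B. B \<in> S \<Longrightarrow> R B > 0 \<and> B = cball (C B) (R B)" using assms(4) by metis
  obtain Bs where Bs: "Bs \<in> permutations_of_set S" "P = {Bs, rev Bs}"
    using assms(6) by (auto simp: geometric_permutation_def realizes_def)
  have set_Bs: "set Bs = S" "distinct Bs" using Bs(1) by (auto simp: permutations_of_set_def)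
  have len: "length Bs = n" using set_Bs assms(3) distinct_card by metis
  define c where "c i = C (Bs ! i)" for i
  define r where "r i = R (Bs ! i)" for i
  have nth: "Bs ! i \<in> S" "Bs ! i = cball (c i) (r i)" "0 < r i" if "i < n" for i
    using CR[of "Bs ! i"] that set_Bs(1) len nth_mem[of i Bs] by (auto simp: c_def r_def)
  interpret disjoint_balls n c r
  proof
    fix i j assume ij: "i < n" "j < n" "i \<noteq> j"
    then have "Bs ! i \<noteq> Bs ! j" using set_Bs(2) len by (simp add: nth_eq_iff_index_eq)
    then have dj: "disjnt (cball (c i) (r i)) (cball (c j) (r j))"
      using pairwiseD[OF assms(5) nth(1)[OF ij(1)] nth(1)[OF ij(2)]] nth(2) ij by simp
    show "r i + r j < dist (c i) (c j)"
      by (rule disjnt_cball_dist[OF nth(3)[OF ij(1)] nth(3)[OF ij(2)] dj])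
  qed (use assms(1) nth in auto)
  have Bs_eq: "Bs = map (\<lambda>i. cball (c i) (r i)) [0..<n]"
    using len nth(2) by (intro nth_equalityI) auto
  have "realizes S L P \<longleftrightarrow> L \<in> {line_through p v | p v. transversal p v}" for L
  proof
    assume "realizes S L P"
    then obtain p v Bs' where L: "L \<in> line_transversals S" "v \<noteq> 0" "L = line_through p v" "visits_in_order p v Bs'" "P = {Bs', rev Bs'}"
      by (auto simp: realizes_def)
    have "\<exists>w. w \<noteq> 0 \<and> L = line_through p w \<and> visits_in_order p w Bs"
    \<comment> \<open>If the line realizes the reverse order, its direction is reversed.\<close>
    proof (cases "Bs' = Bs")
      case False
      then have "Bs = rev Bs'" using L(5) Bs(2) by (auto simp: doubleton_eq_iff)
      then have "visits_in_order p (- v) Bs" using L(4) by (simp add: visits_in_order_rev)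
      then show ?thesis using L(2,3) by (intro exI[of _ "- v"]) (simp add: line_through_minus)
    qed (use L in auto)
    then obtain w where w: "w \<noteq> 0" "L = line_through p w" "visits_in_order p w Bs" by blast
    have "\<exists>t. p + t *\<^sub>R w \<in> cball (c i) (r i)" if "i < n" for i
    proof -
      have "L \<inter> Bs ! i \<noteq> {}" using L(1) nth(1)[OF that] by (simp add: line_transversals_def)
      then show ?thesis unfolding nth(2)[OF that] w(2) line_through_def by blast
    qed
    then have "transversal p w" using visits_in_order_iff[OF w(1)] w(3) Bs_eq by metis
    then show "L \<in> {line_through p v | p v. transversal p v}" using w(2) by blast
  next
    assume "L \<in> {line_through p v | p v. transversal p v}"
    then obtain p v where L: "L = line_through p v" "transversal p v" by blast
    have v: "v \<noteq> 0" using transversal_axis_pos[OF L(2)] by auto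
    have vis: "\<exists>t. p + t *\<^sub>R v \<in> cball (c i) (r i)" if "i < n" for i using visits_in_order_iff[OF v] L(2) that by blast
    have "visits_in_order p v Bs" using visits_in_order_iff[OF v] L(2) Bs_eq by metis
    moreover have "L \<in> line_transversals S"
    proof -
      have "L \<inter> B \<noteq> {}" if BS: "B \<in> S" for B
      proof -
        have "\<exists>i<n. Bs ! i = B" using BS set_Bs(1) len in_set_conv_nth[of B Bs] by auto
        then obtain i where i: "i < n" "B = Bs ! i" by blast
        then show ?thesis using vis[OF i(1)] unfolding i(2) nth(2)[OF i(1)] L(1) line_through_def by blast
      qed
      moreover have "L \<in> affine_lines" unfolding affine_lines_eq L(1) using v by force
      ultimately show ?thesis by (simp add: line_transversals_def)
    qed
    ultimately show "realizes S L P" unfolding realizes_def using v L(1) Bs by blast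
  qed
  then have "{L. realizes S L P} = {line_through p v | p v. transversal p v}" by blast
  then show ?thesis using contractible_ordered_lines by simp
qed

end
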